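(* Let $\Gamma=\langle\xi,\eta\rangle$ be a Kleinian group that is free on $\xi,\eta$, geometrically infinite, and contains no parabolic elements. Let $k\ge2$ and $z_0\in\mathbb{H}^3$. Then there is a family of Borel measures $\{\nu_\psi\}_{\psi\in\Psi^k}$ on $S_\infty$ such that (i) $A_{z_0}=\sum_{\psi\in\Psi^k}\nu_\psi$, and (ii) for every group-theoretical relation $(\gamma,\psi)$ of level $k$, $$\int_{S_\infty}(\lambda_{\gamma,z_0})^2\,d\nu_\psi \;=\;1-\sum_{\psi'\in S(\gamma,\psi)}\nu_{\psi'}(S_\infty).$$
   Context: $S_\infty\cong S^2$ is the sphere at infinity of $\mathbb{H}^3$. $A_{z_0}$ is the area measure on $S_\infty$ based at $z_0$ (the round measure obtained by identifying $S_\infty$ with the unit tangent sphere at $z_0$), normalized so that $A_{z_0}(S_\infty)=1$. For an isometry $\gamma$, $(\lambda_{\gamma,z_0})^2$ denotes the conformal expansion factor of the action of $\gamma$ on $S_\infty$, measured in the round metric centered at $z_0$ (so $\lambda_{\gamma,z_0}^2$ is the Jacobian of $\gamma$ with respect to $A_{z_0}$). $\Psi^k$ is the set of reduced words of length exactly $k$ in $\xi^{\pm1},\eta^{\pm1}$; $|w|$ is reduced length. A group-theoretical relation of level $k$ is a pair $(\gamma,\psi)$ with $\gamma\in\Gamma\setminus\{1\}$, $|\gamma|\le k$, $\psi\in\Psi^k$, and $|\gamma\psi|\le k$. For such a pair, $S(\gamma,\psi)\subset\Psi^k$ is defined as follows: if $\gamma\psi=1$, $S(\gamma,\psi)$ is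 the set of words in $\Psi^k$ whose first letter equals the first letter of the reduced word $\gamma$; if $\gamma\psi\neq1$, $S(\gamma,\psi)$ is the set of words in $\Psi^k$ that do not have the reduced word $\gamma\psi$ as an initial subword. *)

theory Defs
  imports "HOL-Analysis.Analysis" "HOL-Library.Sublist"
begin

text \<open>H^3 is the open unit ball of R^3 (Klein model, geodesics are straight chords);
  the sphere at infinity S_inf is the unit sphere. Orientation preserving isometries
  are the matrices of SO+(3,1), acting projectively. In real^4 the time coordinate is index 1.\<close>

definition mink :: "real^4 \<Rightarrow> real^4 \<Rightarrow> real" where
  "mink v w = - v$1 * w$1 + v$2 * w$2 + v$3 * w$3 + v$4 * w$4"

definition lift :: "real^3 \<Rightarrow> real^4" where
  "lift x = vector [1, x$1, x$2, x$3]"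

definition proj :: "real^4 \<Rightarrow> real^3" where
  "proj w = vector [w$2 / w$1, w$3 / w$1, w$4 / w$1]"

text \<open>Orientation- and time-orientation-preserving Lorentz matrices = Isom^+(H^3).\<close>
definition lorentz :: "real^4^4 \<Rightarrow> bool" where
  "lorentz L \<longleftrightarrow> (\<forall>v w. mink (L *v v) (L *v w) = mink v w) \<and> det L = 1 \<and> L$1$1 > 0"

definition act :: "real^4^4 \<Rightarrow> real^3 \<Rightarrow> real^3" where
  "act L x = proj (L *v lift x)"

definition H3 :: "(real^3) set" where "H3 = ball 0 1"

definition S_inf :: "(real^3) measure" where
  "S_inf = restrict_space borel (sphere 0 1)"

definition hdist :: "real^3 \<Rightarrow> real^3 \<Rightarrow> real" where
  "hdist x y = arcosh ((1 - x \<bullet> y) / sqrt ((1 - (norm x)^2) * (1 - (norm y)^2)))"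

definition hvol :: "(real^3) measure" where
  "hvol = density lborel (\<lambda>x. indicator (ball 0 1) x * ennreal (1 / (1 - (norm x)^2)^2))"

definition radial :: "real^3 \<Rightarrow> real^3" where
  "radial x = (if x = 0 then axis 1 1 else x /\<^sub>R norm x)"

text \<open>Normalized round (rotation invariant) area measure on the unit sphere = the measure
  A_0 based at the centre 0 of the ball: push-forward of normalized Lebesgue measure on the
  unit ball under radial projection (cone measure).\<close>
definition A0 :: "(real^3) measure" where
  "A0 = distr (uniform_measure lborel (ball 0 1)) S_inf radial"

text \<open>Area measure based at z0: transport of A_0 by any isometry g with g(0) = z0
  (it maps the unit tangent sphere at 0 to the one at z0, and geodesic rays to rays).\<close>
definition area_at :: "real^3 \<Rightarrow> (real^3) measure" where
  "area_at z0 = distr A0 S_inf (act (SOME g. lorentz g \<and> act g 0 = z0))"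

text \<open>Squared conformal expansion factor of gamma at z0: the Jacobian of the action of
  gamma on S_inf w.r.t. A_{z0}, i.e. the density f with A_{z0}(gamma E) = int_E f dA_{z0}.\<close>
definition lam2 :: "real^4^4 \<Rightarrow> real^3 \<Rightarrow> real^3 \<Rightarrow> ennreal" where
  "lam2 \<gamma> z0 = RN_deriv (area_at z0) (distr (area_at z0) S_inf (act (matrix_inv \<gamma>)))"

datatype letter = Xi | XiInv | Eta | EtaInv

fun inv_letter :: "letter \<Rightarrow> letter" where
  "inv_letter Xi = XiInv" | "inv_letter XiInv = Xi"
| "inv_letter Eta = EtaInv" | "inv_letter EtaInv = Eta"

fun letter_mat :: "real^4^4 \<Rightarrow> real^4^4 \<Rightarrow> letter \<Rightarrow> real^4^4" where
  "letter_mat \<xi> \<eta> Xi = \<xi>" | "letter_mat \<xi> \<eta> XiInv = matrix_inv \<xi>"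
| "letter_mat \<xi> \<eta> Eta = \<eta>" | "letter_mat \<xi> \<eta> EtaInv = matrix_inv \<eta>"

definition eval_word :: "real^4^4 \<Rightarrow> real^4^4 \<Rightarrow> letter list \<Rightarrow> real^4^4" where
  "eval_word \<xi> \<eta> w = foldr (\<lambda>a M. letter_mat \<xi> \<eta> a ** M) w (mat 1)"

definition reduced :: "letter list \<Rightarrow> bool" where
  "reduced w \<longleftrightarrow> (\<forall>i. Suc i < length w \<longrightarrow> w ! Suc i \<noteq> inv_letter (w ! i))"

fun reduce :: "letter list \<Rightarrow> letter list" where
  "reduce [] = []"
| "reduce (a # w) = (case reduce w of [] \<Rightarrow> [a]
                      | b # r \<Rightarrow> (if b = inv_letter a then r else a # b # r))"

definition Psi :: "nat \<Rightarrow> letter list set" where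
  "Psi k = {w. length w = k \<and> reduced w}"

definition Gamma :: "real^4^4 \<Rightarrow> real^4^4 \<Rightarrow> (real^4^4) set" where
  "Gamma \<xi> \<eta> = range (eval_word \<xi> \<eta>)"

definition kleinian :: "real^4^4 \<Rightarrow> real^4^4 \<Rightarrow> bool" where
  "kleinian \<xi> \<eta> \<longleftrightarrow> lorentz \<xi> \<and> lorentz \<eta> \<and> discrete (Gamma \<xi> \<eta>)"

definition free_on :: "real^4^4 \<Rightarrow> real^4^4 \<Rightarrow> bool" where
  "free_on \<xi> \<eta> \<longleftrightarrow> (\<forall>w. reduced w \<and> w \<noteq> [] \<longrightarrow> eval_word \<xi> \<eta> w \<noteq> mat 1)"

text \<open>Parabolic isometry: exactly one fixed point in the closed ball H^3 \<union> S_inf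
  (no fixed point in H^3, exactly one on S_inf).\<close>
definition parabolic :: "real^4^4 \<Rightarrow> bool" where
  "parabolic L \<longleftrightarrow> (\<exists>!x. x \<in> cball 0 1 \<and> act L x = x)"

definition no_parabolics :: "real^4^4 \<Rightarrow> real^4^4 \<Rightarrow> bool" where
  "no_parabolics \<xi> \<eta> \<longleftrightarrow> (\<forall>g\<in>Gamma \<xi> \<eta>. \<not> parabolic g)"

definition limit_set :: "real^4^4 \<Rightarrow> real^4^4 \<Rightarrow> (real^3) set" where
  "limit_set \<xi> \<eta> = {\<zeta> \<in> sphere 0 1. \<zeta> islimpt ((\<lambda>g. act g 0) ` Gamma \<xi> \<eta>)}"

text \<open>Convex core (in H^3): hyperbolic convex hull of the limit set; in the Klein model this is
  the Euclidean convex hull intersected with the open ball.\<close>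
definition convex_core :: "real^4^4 \<Rightarrow> real^4^4 \<Rightarrow> (real^3) set" where
  "convex_core \<xi> \<eta> = convex hull (limit_set \<xi> \<eta>) \<inter> ball 0 1"

definition dirichlet :: "real^4^4 \<Rightarrow> real^4^4 \<Rightarrow> (real^3) set" where
  "dirichlet \<xi> \<eta> = {x \<in> ball 0 1. \<forall>g\<in>Gamma \<xi> \<eta>. hdist x 0 \<le> hdist x (act g 0)}"

text \<open>Geometrically finite (Bowditch): the 1-neighbourhood of the convex core has finite
  volume in the quotient H^3/Gamma (volume computed in the Dirichlet fundamental domain).\<close>
definition geometrically_finite :: "real^4^4 \<Rightarrow> real^4^4 \<Rightarrow> bool" where
  "geometrically_finite \<xi> \<eta> \<longleftrightarrow>
     emeasure hvol ({x \<in> ball 0 1. \<exists>c\<in>convex_core \<xi> \<eta>. hdist x c \<le> 1} \<inter> dirichlet \<xi> \<eta>) < \<infinity>"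

definition geometrically_infinite :: "real^4^4 \<Rightarrow> real^4^4 \<Rightarrow> bool" where
  "geometrically_infinite \<xi> \<eta> \<longleftrightarrow> \<not> geometrically_finite \<xi> \<eta>"

text \<open>(gamma, psi) with gamma given by its (unique, by freeness) reduced word g.\<close>
definition grp_relation :: "nat \<Rightarrow> letter list \<Rightarrow> letter list \<Rightarrow> bool" where
  "grp_relation k g \<psi> \<longleftrightarrow> reduced g \<and> g \<noteq> [] \<and> length g \<le> k \<and> \<psi> \<in> Psi k
      \<and> length (reduce (g @ \<psi>)) \<le> k"

definition S_rel :: "nat \<Rightarrow> letter list \<Rightarrow> letter list \<Rightarrow> letter list set" where
  "S_rel k g \<psi> = (if reduce (g @ \<psi>) = [] then {\<psi>' \<in> Psi k. hd \<psi>' = hd g}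
                   else {\<psi>' \<in> Psi k. \<not> prefix (reduce (g @ \<psi>)) \<psi>'})"

end

theory Submission
  imports Defs
begin

text \<open>
  The action of a discrete group on the sphere at infinity is amenable, and this alone yields the
  decomposition. For a point \<open>X\<close> of hyperbolic space, weight each word \<open>w\<close> by a large negative
  power of \<open>cosh d(X, w o)\<close> and normalise; discreteness makes the weights summable. The resulting
  probability measure on the free group depends equivariantly and (by a Harnack inequality)
  Lipschitz-continuously on \<open>X\<close>. Since rays to a common ideal point are asymptotic, averaging it
  over a long initial piece of the ray from a base point to \<open>\<zeta>\<close> gives probability measures \<open>m\<^sub>\<zeta>\<close> on
  the group for which \<open>m\<^sub>\<gamma>\<^sub>\<zeta>\<close> is uniformly close to \<open>\<gamma> m\<^sub>\<zeta>\<close>. A right translation, which commutes with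
  this approximate equivariance, pushes their mass off any finite set of words. Hence the densities
  \<open>\<zeta> \<mapsto> m\<^sub>\<zeta> {words starting with \<psi>}\<close> satisfy the required identities up to an arbitrarily small error, and a
  weak cluster point of them satisfies the identities exactly.
\<close>

text \<open>For measures with densities f_\<psi>, the change of variables by \<gamma> turns (ii)
  into an integrated form of f_\<psi>(\<gamma>^-1 \<zeta>) = 1 - sum of f_\<psi>'(\<zeta>) over
  \<psi>' in S(\<gamma>,\<psi>). If f_\<psi>(\<zeta>) is the mass of the words starting with \<psi>
  under an equivariant family m_\<zeta>, this only says how \<gamma> moves the words starting with
  \<psi>. Two obstacles shape the proof. Exact equivariance fails already at a fixed point of an
  element of infinite order: no probability measure on the group is invariant under translation by
  an infinite cyclic subgroup. And words shorter than k start with no \<psi>, so their mass spoils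
  both (i) and (ii). The equivariance error for averages of length n is K / n, with K independent of
  the right translate; hence the translate can be chosen after n, so far out that the short words
  carry less than 1 / n. The limit is taken in the dual of L^1, because the Jacobian used as a test
  function is only known to be integrable; the identities survive since they are linear in the
  densities.\<close>

section \<open>Weak compactness of densities\<close>

text \<open>The index type is uncountable in the application, so a convergent subsequence need not
  exist; a filter finer than \<open>sequentially\<close> takes its place. It comes from Tychonoff
  compactness of the box of functions bounded by \<open>c\<close>.\<close>

lemma pointwise_bounded_cluster_filter:
  fixes x :: "nat \<Rightarrow> 'j \<Rightarrow> real"
  assumes bnd: "\<And>n j. \<bar>x n j\<bar> \<le> c j"
  obtains F y where "F \<noteq> bot" "F \<le> sequentially" "\<And>j. ((\<lambda>n. x n j) \<longlongrightarrow> y j) F"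
proof -
  define U where "U = (\<Pi>\<^sub>E j\<in>UNIV. {- c j .. c j})"
  have "compactin (product_topology (\<lambda>j::'j. euclidean :: real topology) UNIV) U"
    unfolding U_def compactin_PiE by (auto simp: compactin_euclidean_iff)
  then have "compact U"
    by (simp add: euclidean_product_topology compactin_euclidean_iff)
  moreover have "eventually (\<lambda>y. y \<in> U) (filtermap x sequentially)"
    unfolding eventually_filtermap U_def using bnd by (intro always_eventually) (auto simp: abs_le_iff minus_le_iff)
  moreover have "filtermap x sequentially \<noteq> bot"
    by (simp add: filtermap_bot_iff)
  ultimately obtain y where y: "inf (nhds y) (filtermap x sequentially) \<noteq> bot"
    unfolding compact_filter by blast
  \<comment> \<open>Tails of the sequence, restricted to the indices at which it is close to
    \<open>y\<close>. The filter is proper because no tail avoids a neighbourhood of the cluster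
    point.\<close>
  define F where "F = inf sequentially (filtercomap x (nhds y))"
  have "filtermap x F \<le> nhds y"
    unfolding F_def filtermap_le_iff_le_filtercomap by simp
  then have lim: "(x \<longlongrightarrow> y) F" by (simp add: filterlim_def)
  have "F \<noteq> bot"
  proof
    assume "F = bot"
    then have "eventually (\<lambda>_. False) F" by simp
    then obtain P Q where P: "eventually P sequentially" and Q: "eventually Q (nhds y)"
      and PQ: "\<And>n. P n \<Longrightarrow> Q (x n) \<Longrightarrow> False"
      unfolding F_def eventually_inf eventually_filtercomap by blast
    have "eventually (\<lambda>z. \<not> Q z) (filtermap x sequentially)"
      unfolding eventually_filtermap using P by (rule eventually_mono) (use PQ in blast)
    then have "eventually (\<lambda>_. False) (inf (nhds y) (filtermap x sequentially))"
      unfolding eventually_inf using Q by blast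
    with y show False by (simp add: trivial_limit_def)
  qed
  moreover have "F \<le> sequentially" unfolding F_def by simp
  moreover have "((\<lambda>n. x n j) \<longlongrightarrow> y j) F" for j
  proof -
    have "open ((\<lambda>z::'j \<Rightarrow> real. z j) -` V)" if "open V" for V
      using continuous_on_product_coordinates[of j] that by (auto intro: open_vimage)
    then show ?thesis
      using topological_tendstoD[OF lim] by (intro topological_tendstoI) force
  qed
  ultimately show ?thesis by (rule that)
qed

text \<open>Functions with values in [0,1] are functionals of norm at most one on L^1, so this is
  Banach-Alaoglu; the limit functional is dominated by M and is therefore integration against a
  measure.\<close>

lemma weak_cluster_measures:
  fixes f :: "nat \<Rightarrow> 'i \<Rightarrow> 'a \<Rightarrow> real"
  assumes "finite_measure M"
    and fm: "\<And>n i. f n i \<in> borel_measurable M"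
    and f01: "\<And>n i x. x \<in> space M \<Longrightarrow> 0 \<le> f n i x \<and> f n i x \<le> 1"
  obtains F and \<nu> :: "'i \<Rightarrow> 'a measure" where
    "F \<noteq> bot" "F \<le> sequentially"
    "\<And>i. sets (\<nu> i) = sets M"
    "\<And>i E. E \<in> sets M \<Longrightarrow> emeasure (\<nu> i) E \<le> emeasure M E"
    "\<And>i (h :: 'a \<Rightarrow> real). integrable M h \<Longrightarrow> integrable (\<nu> i) h"
    "\<And>i h. integrable M h \<Longrightarrow> ((\<lambda>n. \<integral>x. h x * f n i x \<partial>M) \<longlongrightarrow> (\<integral>x. h x \<partial>\<nu> i)) F"
proof -
  interpret finite_measure M by fact
  have int: "integrable M (\<lambda>x. h x * f n i x)" if "integrable M h" for h n i
    by (rule Bochner_Integration.integrable_bound[OF that])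
      (use that fm[of n i] f01[of _ n i] in \<open>auto simp: abs_mult mult_left_le\<close>)
  have absint: "\<bar>\<integral>x. h x * f n i x \<partial>M\<bar> \<le> (\<integral>x. \<bar>h x\<bar> \<partial>M)" if "integrable M h" for h n i
  proof -
    have "\<bar>\<integral>x. h x * f n i x \<partial>M\<bar> \<le> (\<integral>x. \<bar>h x * f n i x\<bar> \<partial>M)"
      by (rule integral_abs_bound)
    also have "\<dots> \<le> (\<integral>x. \<bar>h x\<bar> \<partial>M)"
      using integrable_abs[OF int[OF that, of n i]] that f01[of _ n i]
      by (intro integral_mono) (auto simp: abs_mult mult_left_le)
    finally show ?thesis .
  qed
  \<comment> \<open>Test functions that are not integrable get the value 0, so that the bound holds
    at every index.\<close>
  define X where "X n = (\<lambda>(i, h). if integrable M h then (\<integral>x. h x * f n i x \<partial>M) else 0)" for n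
  obtain F y where F: "F \<noteq> bot" "F \<le> sequentially" and y: "\<And>j. ((\<lambda>n. X n j) \<longlongrightarrow> y j) F"
    by (rule pointwise_bounded_cluster_filter[of X "\<lambda>(i, h). if integrable M h then (\<integral>x. \<bar>h x\<bar> \<partial>M) else 0"])
      (auto simp: X_def absint)
  define l where "l i h = y (i, h)" for i h
  have l: "((\<lambda>n. \<integral>x. h x * f n i x \<partial>M) \<longlongrightarrow> l i h) F" if "integrable M h" for i h
    using y[of "(i, h)"] that by (simp add: X_def l_def)
  note uniq = tendsto_unique[OF F(1)]
  have l_add: "l i (\<lambda>x. h x + k x) = l i h + l i k" if "integrable M h" "integrable M k" for i h k
  proof -
    have "((\<lambda>n. (\<integral>x. h x * f n i x \<partial>M) + (\<integral>x. k x * f n i x \<partial>M)) \<longlongrightarrow> l i h + l i k) F"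
      by (intro tendsto_add l that)
    moreover have "(\<integral>x. h x * f n i x \<partial>M) + (\<integral>x. k x * f n i x \<partial>M) = (\<integral>x. (h x + k x) * f n i x \<partial>M)" for n
      using int[OF that(1)] int[OF that(2)] by (simp add: distrib_right)
    ultimately show ?thesis
      using l[of "\<lambda>x. h x + k x" i] that uniq by auto
  qed
  have l_cmult: "l i (\<lambda>x. h x * c) = l i h * c" if "integrable M h" for i h c
  proof -
    have "((\<lambda>n. (\<integral>x. h x * f n i x \<partial>M) * c) \<longlongrightarrow> l i h * c) F"
      by (intro tendsto_mult tendsto_const l that)
    moreover have "(\<integral>x. h x * f n i x \<partial>M) * c = (\<integral>x. (h x * c) * f n i x \<partial>M)" for n
      using int[OF that] by (simp add: mult_ac flip: integral_mult_left_zero)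
    ultimately show ?thesis
      using l[of "\<lambda>x. h x * c" i] that uniq by auto
  qed
  have l_abs: "\<bar>l i h\<bar> \<le> (\<integral>x. \<bar>h x\<bar> \<partial>M)" if "integrable M h" for i h
    by (rule tendsto_upperbound[OF tendsto_rabs[OF l[OF that, of i]] _ F(1)])
      (simp add: absint[OF that])
  have l_nonneg: "0 \<le> l i h" if "integrable M h" "\<And>x. x \<in> space M \<Longrightarrow> 0 \<le> h x" for i h
    by (rule tendsto_lowerbound[OF l[OF that(1), of i] _ F(1)])
      (use f01[of _ _ i] that in \<open>auto intro!: always_eventually integral_nonneg_AE\<close>)
  define \<mu> where "\<mu> i E = ennreal (l i (indicator E))" for i and E :: "'a set"
  define \<nu> where "\<nu> i = measure_of (space M) (sets M) (\<mu> i)" for i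
  have ind: "integrable M (indicator E :: 'a \<Rightarrow> real)" if "E \<in> sets M" for E
    using that by (simp add: integrable_indicator_iff less_top[symmetric])
  have l_ind_le: "l i (indicator E) \<le> measure M E" if "E \<in> sets M" for i E
    using l_abs[OF ind[OF that], of i] that by simp
  have l_ind_nonneg: "0 \<le> l i (indicator E)" if "E \<in> sets M" for i E
    using l_nonneg[OF ind[OF that]] by simp
  have \<mu>_le: "\<mu> i E \<le> emeasure M E" if "E \<in> sets M" for i E
    using l_ind_le[OF that, of i] unfolding \<mu>_def by (simp add: emeasure_eq_measure ennreal_leI)
  have pos: "positive (sets M) (\<mu> i)" for i
    using \<mu>_le[of "{}" i] by (simp add: positive_def)
  have "additive (sets M) (\<mu> i)" for i
    unfolding additive_def
  proof (intro ballI impI)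
    fix A B assume AB: "A \<in> sets M" "B \<in> sets M" "A \<inter> B = {}"
    have "(indicator (A \<union> B) :: 'a \<Rightarrow> real) = (\<lambda>x. indicator A x + indicator B x)"
      using AB(3) by (auto simp: indicator_def fun_eq_iff)
    then have "l i (indicator (A \<union> B)) = l i (indicator A) + l i (indicator B)"
      using l_add[OF ind[OF AB(1)] ind[OF AB(2)]] by simp
    then show "\<mu> i (A \<union> B) = \<mu> i A + \<mu> i B"
      unfolding \<mu>_def using AB by (simp add: l_ind_nonneg ennreal_plus)
  qed
  \<comment> \<open>Domination by the finite measure M gives continuity at the empty set, and with
    it countable additivity.\<close>
  then have ca: "countably_additive (sets M) (\<mu> i)" for i
  proof (rule sets.empty_continuous_imp_countably_additive[OF pos])
    show "\<forall>A\<in>sets M. \<mu> i A \<noteq> \<infinity>" by (simp add: \<mu>_def)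
    fix A assume A: "range A \<subseteq> sets M" "decseq A" "(\<Inter>n::nat. A n) = {}"
    have "(\<lambda>n. emeasure M (A n)) \<longlonglongrightarrow> emeasure M (\<Inter>n. A n)"
      using A(1,2) by (intro Lim_emeasure_decseq) auto
    then show "(\<lambda>n. \<mu> i (A n)) \<longlonglongrightarrow> 0"
      unfolding A(3) using \<mu>_le A(1)
      by (intro tendsto_sandwich[of "\<lambda>_. 0" "\<lambda>n. \<mu> i (A n)" _ "\<lambda>n. emeasure M (A n)"]) auto
  qed
  have sets_\<nu>: "sets (\<nu> i) = sets M" for i
    unfolding \<nu>_def by (simp add: sets.space_closed)
  have space_\<nu>: "space (\<nu> i) = space M" for i
    using sets_\<nu> by (rule sets_eq_imp_space_eq)
  have em: "emeasure (\<nu> i) E = \<mu> i E" if "E \<in> sets M" for i E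
    unfolding \<nu>_def by (rule emeasure_measure_of_sigma[OF sets.sigma_algebra_axioms pos ca that])
  have le: "emeasure (\<nu> i) E \<le> emeasure M E" if "E \<in> sets M" for i E
    using \<mu>_le[OF that] em[OF that] by simp
  have meas_\<nu>: "borel_measurable (\<nu> i) = (borel_measurable M :: ('a \<Rightarrow> real) set)" for i
    by (rule measurable_cong_sets[OF sets_\<nu> refl])
  have nn_le: "(\<integral>\<^sup>+x. h x \<partial>\<nu> i) \<le> (\<integral>\<^sup>+x. h x \<partial>M)" for i h
    by (rule nn_integral_mono_measure) (use sets_\<nu> le in \<open>auto simp: le_measure\<close>)
  have integrable_\<nu>: "integrable (\<nu> i) h" if "integrable M h" for i and h :: "'a \<Rightarrow> real"
    using that nn_le[of i "\<lambda>x. ennreal (norm (h x))"]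
    unfolding integrable_iff_bounded by (auto simp: meas_\<nu> intro: le_less_trans)
  have "l i h = (\<integral>x. h x \<partial>\<nu> i)" if "integrable M h" for i h
    using that
  proof (induction rule: integrable_induct)
    case (base A c)
    have "measure (\<nu> i) A = l i (indicator A)"
      using base by (simp add: measure_def em \<mu>_def l_ind_nonneg)
    then show ?case
      using base l_cmult[OF ind[of A], of i c] by (simp add: sets_\<nu>)
  next
    case (add g h)
    then show ?case by (simp add: l_add integrable_\<nu>)
  next
    \<comment> \<open>Both sides are continuous along \<open>s\<close>: the rule supplies |s j| <= 2
      |h|, hence |s j - h| <= 3 |h|, and \<open>l\<close> is bounded by the L^1 norm.\<close>
    case (lim h s)
    note [measurable] = borel_measurable_integrable[OF lim.hyps(1)] borel_measurable_integrable[OF lim.hyps(4)]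
    have "(\<lambda>j. \<integral>x. s j x \<partial>\<nu> i) \<longlonglongrightarrow> (\<integral>x. h x \<partial>\<nu> i)"
      by (rule integral_dominated_convergence[where w="\<lambda>x. 2 * norm (h x)"])
        (use lim.hyps(2,3) integrable_\<nu>[OF lim.hyps(4)] integrable_\<nu>[OF lim.hyps(1)] in \<open>auto simp: space_\<nu>\<close>)
    moreover have "(\<lambda>j. l i (s j)) \<longlonglongrightarrow> l i h"
    proof -
      have lim0: "(\<lambda>j. \<integral>x. \<bar>s j x - h x\<bar> \<partial>M) \<longlonglongrightarrow> (\<integral>x. 0 \<partial>M)"
      proof (rule integral_dominated_convergence[where w="\<lambda>x. 3 * norm (h x)"])
        show "AE x in M. (\<lambda>j. \<bar>s j x - h x\<bar>) \<longlonglongrightarrow> 0"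
          using lim.hyps(2) by (auto intro!: AE_I2 tendsto_rabs_zero simp: LIM_zero_iff)
        show "AE x in M. norm \<bar>s j x - h x\<bar> \<le> 3 * norm (h x)" for j
          using lim.hyps(3)[of _ j] by (intro AE_I2) fastforce
      qed (use lim.hyps(4) in auto)
      have bd: "norm (l i (s j) - l i h) \<le> (\<integral>x. \<bar>s j x - h x\<bar> \<partial>M)" for j
      proof -
        have "l i (s j) = l i (\<lambda>x. (s j x - h x) + h x)" by simp
        also have "\<dots> = l i (\<lambda>x. s j x - h x) + l i h"
          by (rule l_add) (use lim in auto)
        finally show ?thesis using l_abs[of "\<lambda>x. s j x - h x" i] lim by simp
      qed
      have "(\<lambda>j. l i (s j) - l i h) \<longlonglongrightarrow> 0"
        by (rule Lim_null_comparison[OF always_eventually]) (use bd lim0 in simp_all)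
      then show ?thesis by (simp add: LIM_zero_iff)
    qed
    ultimately show ?case
      using lim.IH LIMSEQ_unique by auto
  qed
  with l F sets_\<nu> le integrable_\<nu> show ?thesis
    by (intro that[of F \<nu>]) auto
qed

section \<open>Reduced words\<close>

definition inv_word :: "letter list \<Rightarrow> letter list" where
  "inv_word w = rev (map inv_letter w)"

lemma inv_letter_inv_letter [simp]: "inv_letter (inv_letter a) = a"
  by (cases a) auto

lemma length_inv_word [simp]: "length (inv_word w) = length w"
  by (simp add: inv_word_def)

lemma inv_word_Nil [simp]: "inv_word [] = []"
  by (simp add: inv_word_def)

lemma inv_word_inv_word [simp]: "inv_word (inv_word w) = w"
  by (simp add: inv_word_def rev_map[symmetric] comp_def)

lemma inv_word_append: "inv_word (u @ v) = inv_word v @ inv_word u"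
  by (simp add: inv_word_def)

lemma reduced_Nil [simp]: "reduced []"
  by (simp add: reduced_def)

lemma reduced_singleton [simp]: "reduced [a]"
  by (simp add: reduced_def)

lemma reduced_append:
  "reduced (u @ v) \<longleftrightarrow> reduced u \<and> reduced v \<and> (u \<noteq> [] \<longrightarrow> v \<noteq> [] \<longrightarrow> hd v \<noteq> inv_letter (last u))"
proof -
  have key: "reduced (a # w) \<longleftrightarrow> (w \<noteq> [] \<longrightarrow> hd w \<noteq> inv_letter a) \<and> reduced w" for a w
    unfolding reduced_def by (cases w) (auto simp: nth_Cons split: nat.splits)
  show ?thesis
    by (induction u) (auto simp: key hd_append)
qed

lemma reduced_Cons: "reduced (a # w) \<longleftrightarrow> (w \<noteq> [] \<longrightarrow> hd w \<noteq> inv_letter a) \<and> reduced w"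
  using reduced_append[of "[a]" w] by auto

lemma reduced_reduce [simp]: "reduced (reduce w)"
  by (induction w) (auto simp: reduced_Cons split: list.splits)

lemma reduce_reduced: "reduced w \<Longrightarrow> reduce w = w"
  by (induction w) (auto simp: reduced_Cons split: list.splits)

lemma reduce_append_right: "reduce (u @ reduce v) = reduce (u @ v)"
  by (induction u) (simp_all add: reduce_reduced)

lemma reduce_Cons_inverse: "reduce (a # inv_letter a # w) = reduce w"
proof (cases "reduce w")
  case Nil then show ?thesis by simp
next
  case (Cons b r)
  have "reduced (b # r)" using reduced_reduce[of w] Cons by simp
  then show ?thesis using Cons
    by (cases r) (auto simp: reduced_Cons)
qed

lemma reduce_append_left: "reduce (reduce u @ v) = reduce (u @ v)"
proof (induction u)
  case (Cons a u)
  show ?case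
  proof (cases "reduce u")
    case Nil
    then show ?thesis using Cons by simp
  next
    case (Cons b r)
    have *: "reduce (a # u @ v) = reduce (a # b # r @ v)"
      using Cons.IH Cons by simp
    show ?thesis
    proof (cases "b = inv_letter a")
      case True
      then show ?thesis using * Cons reduce_Cons_inverse[of a "r @ v"] by simp
    next
      case False
      then show ?thesis using * Cons by simp
    qed
  qed
qed simp

lemma reduce_cancel: "reduce (u @ inv_word u @ v) = reduce v"
proof (induction u arbitrary: v)
  case (Cons a u)
  have "reduce ((a # u) @ inv_word (a # u) @ v) = reduce ([a] @ reduce (u @ inv_word u @ (inv_letter a # v)))"
    by (simp only: reduce_append_right) (simp add: inv_word_def)
  also have "\<dots> = reduce ([a] @ (inv_letter a # v))"
    by (simp only: Cons reduce_append_right)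
  finally show ?case using reduce_Cons_inverse by simp
qed simp

lemma reduce_cancel': "reduce (inv_word u @ u @ v) = reduce v"
  using reduce_cancel[of "inv_word u" v] by simp

text \<open>The word \<open>c\<close> is the full cancellation between \<open>g\<close> and
  \<open>p\<close>. It is consumed letter by letter at the end of \<open>g\<close>, hence the
  induction from the right with \<open>p\<close> arbitrary.\<close>

lemma reduce_append_cancellation:
  assumes "reduced g" "reduced p"
  obtains a c d where "g = a @ inv_word c" "p = c @ d" "reduced (a @ d)" "reduce (g @ p) = a @ d"
  using assms
proof (induction g arbitrary: p thesis rule: rev_induct)
  case Nil
  show ?case by (rule Nil(1)[of "[]" "[]" p]) (use Nil in \<open>auto simp: reduce_reduced\<close>)
next
  case (snoc b g)
  show ?case
  proof (cases "p \<noteq> [] \<and> hd p = inv_letter b")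
    case True
    then obtain q where q: "p = inv_letter b # q" by (cases p) auto
    have "reduced g" "reduced q" using snoc.prems q by (auto simp: reduced_append reduced_Cons)
    then obtain a c d where *: "g = a @ inv_word c" "q = c @ d" "reduced (a @ d)" "reduce (g @ q) = a @ d"
      using snoc.IH by blast
    have "reduce ((g @ [b]) @ p) = reduce (g @ reduce (b # inv_letter b # q))"
      by (simp only: reduce_append_right) (simp add: q)
    also have "\<dots> = reduce (g @ q)"
      by (simp only: reduce_Cons_inverse reduce_append_right)
    finally have "reduce ((g @ [b]) @ p) = a @ d" using * by simp
    then show ?thesis
      by (intro snoc.prems(1)[of a "inv_letter b # c" d]) (use * q in \<open>auto simp: inv_word_def\<close>)
  next
    case False
    then have "reduced ((g @ [b]) @ p)"
      using snoc.prems(2,3) by (auto simp: reduced_append reduced_Cons)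
    then show ?thesis
      by (intro snoc.prems(1)[of "g @ [b]" "[]" p]) (auto simp: reduce_reduced)
  qed
qed

text \<open>For \<open>u\<close> of length at least \<open>k\<close> this says that, up to words shorter than \<open>k\<close>, the translate
  \<open>g \<cdot> {words starting with \<psi>}\<close> is the union of the cylinders indexed by \<open>Psi k - S_rel k g \<psi>\<close>.\<close>
lemma prefix_reduce_iff_notin_S_rel:
  assumes rel: "grp_relation k g \<psi>" and u: "reduced u" "k \<le> length u"
  shows "prefix \<psi> (reduce (inv_word g @ u)) \<longleftrightarrow> take k u \<notin> S_rel k g \<psi>"
proof -
  have g: "reduced g" "g \<noteq> []" "length g \<le> k" and psi: "length \<psi> = k" "reduced \<psi>"
    and lk: "length (reduce (g @ \<psi>)) \<le> k"
    using rel by (auto simp: grp_relation_def Psi_def)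
  obtain a c d where acd: "g = a @ inv_word c" "\<psi> = c @ d" "reduced (a @ d)" "reduce (g @ \<psi>) = a @ d"
    by (rule reduce_append_cancellation[OF g(1) psi(2)])
  have tk: "take k u \<in> Psi k"
    using u reduced_append[of "take k u" "drop k u"] by (auto simp: Psi_def)
  have k0: "k > 0" using g by (cases k) auto
  have u0: "u \<noteq> []" using k0 u by auto
  show ?thesis
  proof (cases "d = []")
    case True
    \<comment> \<open>Nothing of \<psi> survives, so \<open>c\<close> has length k; as
      \<open>g\<close> has length at most k, it is cancelled completely and is the inverse of
      \<psi>.\<close>
    then have a0: "a = []" and c: "c = \<psi>"
      using acd(1,2) psi(1) g(3) by auto
    have g_eq: "g = inv_word \<psi>" using acd(1) a0 c by simp
    have hdg: "hd g = inv_letter (last \<psi>)"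
      using psi k0 unfolding g_eq inv_word_def by (cases \<psi> rule: rev_cases) auto
    have "hd (take k u) = hd u" using k0 by simp
    \<comment> \<open>In other words, \<open>\<psi> @ u\<close> has no cancellation at the
      junction.\<close>
    then have S: "take k u \<notin> S_rel k g \<psi> \<longleftrightarrow> hd u \<noteq> inv_letter (last \<psi>)"
      using tk acd(4) True a0 hdg by (simp add: S_rel_def)
    have ne: "\<psi> \<noteq> []" using psi k0 by auto
    show ?thesis
    proof
      assume "prefix \<psi> (reduce (inv_word g @ u))"
      then obtain t where t: "reduce (inv_word g @ u) = \<psi> @ t" by (auto simp: prefix_def)
      have "u = reduce (inv_word \<psi> @ reduce (\<psi> @ u))"
        unfolding reduce_append_right reduce_cancel' using u by (simp add: reduce_reduced)
      also have "\<dots> = reduce (inv_word \<psi> @ \<psi> @ t)" using t g_eq by simp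
      also have "\<dots> = reduce t" by (rule reduce_cancel')
      also have "\<dots> = t"
        using reduced_reduce[of "inv_word g @ u"] unfolding t by (simp add: reduced_append reduce_reduced)
      finally have "reduced (\<psi> @ u)" using t reduced_reduce[of "inv_word g @ u"] by simp
      then show "take k u \<notin> S_rel k g \<psi>"
        using S ne u0 by (simp add: reduced_append)
    next
      assume "take k u \<notin> S_rel k g \<psi>"
      then have "reduced (\<psi> @ u)" using S psi u by (simp add: reduced_append)
      then show "prefix \<psi> (reduce (inv_word g @ u))" by (simp add: g_eq reduce_reduced)
    qed
  next
    case False
    \<comment> \<open>The word \<open>a @ d\<close> has length at most k, so the first k letters of
      \<open>u\<close> decide whether \<open>u\<close> starts with it.\<close>
    have "prefix (a @ d) (take k u) \<longleftrightarrow> prefix (a @ d) u"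
      using lk acd(4) u(2) prefix_length_prefix[of "a @ d" u "take k u"]
        prefix_order.trans[of "a @ d" "take k u" u] take_is_prefix[of k u]
      by auto
    then have S: "take k u \<notin> S_rel k g \<psi> \<longleftrightarrow> prefix (a @ d) u"
      using tk False acd(4) by (simp add: S_rel_def)
    show ?thesis
    proof
      assume "prefix \<psi> (reduce (inv_word g @ u))"
      then obtain t where t: "reduce (inv_word g @ u) = \<psi> @ t" by (auto simp: prefix_def)
      have red: "reduced (\<psi> @ t)" using reduced_reduce[of "inv_word g @ u"] unfolding t .
      have "u = reduce (g @ reduce (inv_word g @ u))"
        unfolding reduce_append_right reduce_cancel using u by (simp add: reduce_reduced)
      also have "\<dots> = reduce (reduce (g @ \<psi>) @ t)" unfolding t reduce_append_left by simp
      also have "\<dots> = a @ d @ t"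
      proof -
        \<comment> \<open>The nonempty \<open>d\<close> separates \<open>a\<close> from
          \<open>t\<close>, so both junctions are already known to be reduced.\<close>
        have "reduced (a @ d @ t)"
          using red acd False by (auto simp: reduced_append)
        then show ?thesis unfolding acd(4) by (simp add: reduce_reduced)
      qed
      finally have "prefix (a @ d) u" by simp
      then show "take k u \<notin> S_rel k g \<psi>" using S by simp
    next
      assume "take k u \<notin> S_rel k g \<psi>"
      then obtain t where t: "u = a @ d @ t" using S by (auto simp: prefix_def)
      have "reduced (\<psi> @ t)"
        using u psi acd(2) False t by (auto simp: reduced_append)
      moreover have "reduce (inv_word g @ u) = reduce (c @ reduce (inv_word a @ a @ d @ t))"
        unfolding reduce_append_right by (simp add: acd(1) t inv_word_append)
      then have "reduce (inv_word g @ u) = reduce (\<psi> @ t)"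
        unfolding reduce_cancel' reduce_append_right by (simp add: acd(2))
      ultimately show "prefix \<psi> (reduce (inv_word g @ u))" by (simp add: reduce_reduced)
    qed
  qed
qed

section \<open>Lorentz geometry\<close>

abbreviation e1 :: "real^4" where "e1 \<equiv> axis 1 1"

lemma mink_commute: "mink v w = mink w v"
  by (simp add: mink_def)

lemma mink_add_left: "mink (u + v) w = mink u w + mink v w"
  and mink_add_right: "mink w (u + v) = mink w u + mink w v"
  and mink_diff_left: "mink (u - v) w = mink u w - mink v w"
  and mink_diff_right: "mink w (u - v) = mink w u - mink w v"
  and mink_scale_left: "mink (c *\<^sub>R u) w = c * mink u w"
  and mink_scale_right: "mink w (c *\<^sub>R u) = c * mink w u"
  and mink_minus_left: "mink (- u) w = - mink u w"
  by (simp_all add: mink_def algebra_simps)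

lemmas mink_simps = mink_add_left mink_add_right mink_diff_left mink_diff_right
  mink_scale_left mink_scale_right mink_minus_left

lemma mink_e1_left [simp]: "mink e1 w = - w$1"
  by (simp add: mink_def axis_def)

lemma mink_e1_right [simp]: "mink w e1 = - w$1"
  by (simp add: mink_def axis_def)

lemma mink_axis: "j \<noteq> 1 \<Longrightarrow> mink v (axis j 1) = v$j"
  using exhaust_4[of j] by (auto simp: mink_def axis_def)

lemma continuous_on_mink_left: "continuous_on UNIV (\<lambda>v. mink v w)"
  unfolding mink_def by (intro continuous_intros)

definition future :: "real^4 \<Rightarrow> bool" where
  "future v \<longleftrightarrow> mink v v \<le> 0 \<and> 0 \<le> v$1"

text \<open>Cauchy-Schwarz for the space parts, whose lengths are bounded by the time coordinates.
  Later inequalities between pairings are proved by showing that a suitable combination of vectors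
  lies in this cone.\<close>

lemma future_mink_nonpos:
  assumes "future v" "future w"
  shows "mink v w \<le> 0"
proof -
  let ?p = "v$2 * w$2 + v$3 * w$3 + v$4 * w$4"
  let ?v = "(v$2)\<^sup>2 + (v$3)\<^sup>2 + (v$4)\<^sup>2" and ?w = "(w$2)\<^sup>2 + (w$3)\<^sup>2 + (w$4)\<^sup>2"
  have v: "?v \<le> (v$1)\<^sup>2" "0 \<le> v$1" and w: "?w \<le> (w$1)\<^sup>2" "0 \<le> w$1"
    using assms by (auto simp: future_def mink_def power2_eq_square)
  \<comment> \<open>Lagrange's identity; the right side is the squared length of the cross product
    of the space parts.\<close>
  have "?v * ?w - ?p\<^sup>2 = (v$2 * w$3 - v$3 * w$2)\<^sup>2 + (v$2 * w$4 - v$4 * w$2)\<^sup>2 + (v$3 * w$4 - v$4 * w$3)\<^sup>2"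
    by (simp add: power2_eq_square algebra_simps)
  moreover have "0 \<le> \<dots>" by (intro add_nonneg_nonneg zero_le_power2)
  ultimately have "?p\<^sup>2 \<le> ?v * ?w" by linarith
  also have "\<dots> \<le> (v$1)\<^sup>2 * (w$1)\<^sup>2"
    by (rule mult_mono) (use v w in auto)
  finally have "?p\<^sup>2 \<le> (v$1 * w$1)\<^sup>2" by (simp add: power_mult_distrib)
  then have "?p \<le> v$1 * w$1"
    by (rule power2_le_imp_le) (rule mult_nonneg_nonneg[OF v(2) w(2)])
  then show ?thesis by (simp add: mink_def)
qed

text \<open>A timelike vector is interior to the cone, so it can move a little in the direction -e1
  without leaving it.\<close>

lemma timelike_minus_e1_future:
  assumes "mink v v < 0" "0 < v$1"
  obtains d where "d > 0" "future (v - d *\<^sub>R e1)"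
proof -
  \<comment> \<open>The first bound keeps the time coordinate nonnegative; the second makes the gain
    \<open>2 * d * v$1\<close> at most \<open>- mink v v\<close>.\<close>
  define d where "d = min (v$1) (- mink v v / (2 * v$1))"
  have "d > 0" "d \<le> v$1" using assms by (auto simp: d_def intro: divide_neg_pos)
  have "d \<le> - mink v v / (2 * v$1)" by (simp add: d_def)
  then have "2 * d * v$1 \<le> - mink v v" using assms by (simp add: field_simps)
  moreover have "mink (v - d *\<^sub>R e1) (v - d *\<^sub>R e1) = mink v v + 2 * d * v$1 - d * d"
    by (simp add: mink_simps algebra_simps)
  moreover have "d * d \<ge> 0" by simp
  ultimately have "mink (v - d *\<^sub>R e1) (v - d *\<^sub>R e1) \<le> 0" by linarith
  then have "future (v - d *\<^sub>R e1)"
    using \<open>d \<le> v$1\<close> by (simp add: future_def axis_def)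
  with \<open>d > 0\<close> show ?thesis by (rule that)
qed

text \<open>For orbit vectors this compares the weights seen from an arbitrary point with those seen
  from the centre.\<close>

lemma timelike_mink_le:
  assumes "mink v v < 0" "0 < v$1"
  obtains d where "d > 0" "\<And>w. future w \<Longrightarrow> d * w$1 \<le> - mink v w"
proof -
  obtain d where d: "d > 0" "future (v - d *\<^sub>R e1)"
    by (rule timelike_minus_e1_future[OF assms])
  have "d * w$1 \<le> - mink v w" if "future w" for w
    using future_mink_nonpos[OF d(2) that] by (simp add: mink_simps)
  with d(1) show ?thesis by (rule that)
qed

lemma timelike_mink_neg:
  assumes "mink v v < 0" "0 < v$1" "future w" "0 < w$1"
  shows "mink v w < 0"
proof -
  obtain d where d: "d > 0" "d * w$1 \<le> - mink v w"
    using timelike_mink_le[OF assms(1,2)] assms(3) by metis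
  have "0 < d * w$1" using d assms by simp
  then show ?thesis using d by linarith
qed

section \<open>Lorentz matrices, their inverses and the size of their entries\<close>

lemma matrix_vector_axis: "(L *v axis j 1) $ i = (L::real^4^4) $ i $ j"
  by (simp add: matrix_vector_mult_def axis_def sum.delta' if_distrib cong: if_cong)

lemma lorentz_mink: "lorentz L \<Longrightarrow> mink (L *v v) (L *v w) = mink v w"
  by (simp add: lorentz_def)

lemma lorentz_matrix_inv:
  assumes "lorentz L"
  shows "L ** matrix_inv L = mat 1" "matrix_inv L ** L = mat 1"
    "L *v (matrix_inv L *v v) = v" "matrix_inv L *v (L *v v) = v"
proof -
  have "invertible L" using assms by (simp add: lorentz_def invertible_det_nz)
  then show *: "L ** matrix_inv L = mat 1" "matrix_inv L ** L = mat 1"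
    unfolding invertible_def matrix_inv_def by (metis (mono_tags, lifting) someI_ex)+
  show "L *v (matrix_inv L *v v) = v" "matrix_inv L *v (L *v v) = v"
    by (simp_all add: matrix_vector_mul_assoc *)
qed

lemma lorentz_mink_inv:
  assumes "lorentz L"
  shows "mink (matrix_inv L *v v) w = mink v (L *v w)"
  using lorentz_mink[OF assms, of "matrix_inv L *v v" w]
  unfolding lorentz_matrix_inv(3)[OF assms] by (rule sym)

lemma lorentz_inv_11: "lorentz L \<Longrightarrow> matrix_inv L $ 1 $ 1 = L $ 1 $ 1"
  using lorentz_mink_inv[of L e1 e1] by (simp add: matrix_vector_axis)

lemma lorentz_inv:
  assumes "lorentz L"
  shows "lorentz (matrix_inv L)"
proof -
  have "det L * det (matrix_inv L) = 1"
    unfolding det_mul[symmetric] by (simp add: lorentz_matrix_inv[OF assms])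
  moreover have "mink (matrix_inv L *v v) (matrix_inv L *v w) = mink v w" for v w
    using lorentz_mink_inv[OF assms] by (simp add: lorentz_matrix_inv[OF assms])
  ultimately show ?thesis
    using assms by (simp add: lorentz_def lorentz_inv_11)
qed

lemma matrix_inv_matrix_inv: "lorentz L \<Longrightarrow> matrix_inv (matrix_inv L) = L"
proof -
  assume L: "lorentz L"
  have "matrix_inv (matrix_inv L) = L ** matrix_inv L ** matrix_inv (matrix_inv L)"
    by (simp add: lorentz_matrix_inv[OF L])
  also have "\<dots> = L"
    unfolding matrix_mul_assoc[symmetric] by (simp add: lorentz_matrix_inv[OF lorentz_inv[OF L]])
  finally show ?thesis .
qed

lemma lorentz_e1:
  assumes "lorentz L"
  shows "mink (L *v e1) (L *v e1) = -1" "0 < (L *v e1)$1" "future (L *v e1)" "(L *v e1)$1 = L$1$1"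
  using assms by (auto simp: lorentz_mink matrix_vector_axis lorentz_def future_def)

text \<open>The time coordinate of the image is minus the pairing of \<open>v\<close> with the
  timelike vector \<open>matrix_inv L *v e1\<close>.\<close>

lemma lorentz_future_pos:
  assumes "lorentz L" "future v" "0 < v$1"
  shows "0 < (L *v v)$1"
proof -
  note inv = lorentz_e1[OF lorentz_inv[OF assms(1)]]
  have "mink (matrix_inv L *v e1) (matrix_inv L *v e1) < 0" unfolding inv(1) by simp
  then have "mink (matrix_inv L *v e1) v < 0"
    by (rule timelike_mink_neg[OF _ inv(2) assms(2,3)])
  then show ?thesis by (simp add: lorentz_mink_inv[OF assms(1)])
qed

lemma lorentz_mat1: "lorentz (mat 1)"
proof -
  have "(mat 1 :: real^4^4)$1$1 = 1" by (simp add: mat_def)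
  then show ?thesis by (simp add: lorentz_def)
qed

lemma lorentz_mult:
  assumes "lorentz L" "lorentz M"
  shows "lorentz (L ** M)"
proof -
  have "0 < (L *v (M *v e1))$1"
    using lorentz_future_pos[OF assms(1) lorentz_e1(3,2)[OF assms(2)]] .
  then have "0 < (L ** M)$1$1"
    by (simp add: matrix_vector_mul_assoc matrix_vector_axis)
  moreover have "mink ((L ** M) *v v) ((L ** M) *v w) = mink v w" for v w
    unfolding matrix_vector_mul_assoc[symmetric] by (simp only: lorentz_mink[OF assms(1)] lorentz_mink[OF assms(2)])
  moreover have "det (L ** M) = 1" using assms by (simp add: lorentz_def det_mul)
  ultimately show ?thesis by (simp add: lorentz_def)
qed

text \<open>Up to signs the first row is \<open>matrix_inv L *v e1\<close>, whose form value is
  -1.\<close>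

lemma lorentz_row1:
  assumes "lorentz L"
  shows "(L$1$1)\<^sup>2 = 1 + (L$1$2)\<^sup>2 + (L$1$3)\<^sup>2 + (L$1$4)\<^sup>2"
proof -
  let ?u = "matrix_inv L *v e1"
  have "?u$j = - L$1$j" if "j \<noteq> 1" for j
    using lorentz_mink_inv[OF assms, of e1 "axis j 1"] that by (simp add: mink_axis matrix_vector_axis)
  moreover have "?u$1 = L$1$1"
    using lorentz_mink_inv[OF assms, of e1 e1] by (simp add: matrix_vector_axis)
  ultimately show ?thesis
    using lorentz_e1(1)[OF lorentz_inv[OF assms]] by (simp add: mink_def power2_eq_square)
qed

text \<open>The entry \<open>L$1$1\<close> is the hyperbolic cosine of the distance by which L moves
  the centre, so displacement controls the whole matrix. Columns have form value -1 or 1, and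
  \<open>lorentz_row1\<close> bounds their time coordinates.\<close>

lemma lorentz_entry_le:
  assumes "lorentz L"
  shows "\<bar>L$i$j\<bar> \<le> L$1$1"
proof -
  have pos: "0 < L$1$1" using assms by (simp add: lorentz_def)
  have "(L$i$j)\<^sup>2 \<le> (L$1$1)\<^sup>2"
  proof (cases "j = 1")
    case True
    have "- (L$1$1)\<^sup>2 + (L$2$1)\<^sup>2 + (L$3$1)\<^sup>2 + (L$4$1)\<^sup>2 = -1"
      using lorentz_e1(1)[OF assms] by (simp add: mink_def matrix_vector_axis power2_eq_square)
    moreover have "0 \<le> (L$2$1)\<^sup>2" "0 \<le> (L$3$1)\<^sup>2" "0 \<le> (L$4$1)\<^sup>2" by auto
    ultimately have "(L$2$1)\<^sup>2 \<le> (L$1$1)\<^sup>2" "(L$3$1)\<^sup>2 \<le> (L$1$1)\<^sup>2" "(L$4$1)\<^sup>2 \<le> (L$1$1)\<^sup>2"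
      by linarith+
    then show ?thesis using exhaust_4[of i] True by auto
  next
    case False
    have "mink (L *v axis j 1) (L *v axis j 1) = 1"
      using False by (simp add: lorentz_mink[OF assms] mink_axis)
    then have c: "(L$2$j)\<^sup>2 + (L$3$j)\<^sup>2 + (L$4$j)\<^sup>2 = 1 + (L$1$j)\<^sup>2"
      by (simp add: mink_def matrix_vector_axis power2_eq_square)
    have nn: "0 \<le> (L$m$n)\<^sup>2" for m n by simp
    have r: "1 + (L$1$j)\<^sup>2 \<le> (L$1$1)\<^sup>2"
      using lorentz_row1[OF assms] exhaust_4[of j] False nn[of 1 2] nn[of 1 3] nn[of 1 4] by auto
    have "(L$i$j)\<^sup>2 \<le> 1 + (L$1$j)\<^sup>2"
      using exhaust_4[of i]
      by (elim disjE; hypsubst) (use c nn[of 1 j] nn[of 2 j] nn[of 3 j] nn[of 4 j] in linarith)+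
    with r show ?thesis by linarith
  qed
  then show ?thesis using pos abs_le_square_iff[of "L$i$j" "L$1$1"] by simp
qed

lemma lorentz_11_ge_1:
  assumes "lorentz L"
  shows "1 \<le> L$1$1"
proof -
  have "1 \<le> (L$1$1)\<^sup>2" using lorentz_row1[OF assms] by simp
  moreover have "0 < L$1$1" using assms by (simp add: lorentz_def)
  ultimately show ?thesis using power2_le_imp_le[of 1 "L$1$1"] by simp
qed

section \<open>The projective action on the closed ball\<close>

lemma lift_nth [simp]: "lift x $ 1 = 1" "lift x $ 2 = x$1" "lift x $ 3 = x$2" "lift x $ 4 = x$3"
  by (simp_all add: lift_def vector_def)

lemma lift_zero: "lift 0 = e1"
  unfolding vec_eq_iff forall_4 by (simp add: axis_def)

lemma norm_sq_vec3: "(norm (x::real^3))\<^sup>2 = (x$1)\<^sup>2 + (x$2)\<^sup>2 + (x$3)\<^sup>2"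
  by (simp add: norm_vec_def L2_set_def sum_3)

lemma mink_lift: "mink (lift x) (lift x) = (norm x)\<^sup>2 - 1"
  unfolding mink_def norm_sq_vec3 by (simp add: power2_eq_square)

lemma future_lift: "norm x \<le> 1 \<Longrightarrow> future (lift x)"
  by (simp add: future_def mink_lift power_le_one)

lemma lift_proj: "w$1 \<noteq> 0 \<Longrightarrow> lift (proj w) = (1 / w$1) *\<^sub>R w"
  unfolding vec_eq_iff forall_4 by (simp add: proj_def)

lemma act_factor_pos:
  assumes "lorentz L" "norm x \<le> 1"
  shows "0 < (L *v lift x)$1"
  using assms by (intro lorentz_future_pos future_lift) auto

lemma lift_act:
  assumes "lorentz L" "norm x \<le> 1"
  shows "lift (act L x) = (1 / (L *v lift x)$1) *\<^sub>R (L *v lift x)"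
  unfolding act_def using act_factor_pos[OF assms] by (intro lift_proj) auto

lemma act_in_sphere:
  assumes "lorentz L" "x \<in> sphere 0 1"
  shows "act L x \<in> sphere 0 1"
proof -
  have x: "norm x = 1" using assms by simp
  have "mink (lift (act L x)) (lift (act L x)) = 0"
    using x by (simp add: lift_act[OF assms(1)] mink_simps lorentz_mink[OF assms(1)] mink_lift)
  then have "(norm (act L x))\<^sup>2 = 1" by (simp add: mink_lift)
  then have "norm (act L x) = 1" by (simp add: power2_eq_1_iff) (smt (verit) norm_ge_zero)
  then show ?thesis by simp
qed

lemma proj_scale: "c \<noteq> 0 \<Longrightarrow> proj (c *\<^sub>R w) = proj w"
  by (simp add: proj_def)

lemma act_mult:
  assumes "lorentz M" "norm x \<le> 1"
  shows "act (L ** M) x = act L (act M x)"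
proof -
  have "act L (act M x) = proj ((1 / (M *v lift x)$1) *\<^sub>R (L *v (M *v lift x)))"
    unfolding act_def[of L] lift_act[OF assms]
    by (simp only: matrix_vector_mult_scaleR)
  also have "\<dots> = proj (L *v (M *v lift x))"
    using act_factor_pos[OF assms] by (intro proj_scale) simp
  also have "\<dots> = act (L ** M) x" unfolding act_def matrix_vector_mul_assoc ..
  finally show ?thesis ..
qed

lemma act_mat1 [simp]: "act (mat 1) x = x"
  unfolding vec_eq_iff forall_3 by (simp add: act_def proj_def)

lemma act_inv_act:
  assumes "lorentz L" "norm x \<le> 1"
  shows "act (matrix_inv L) (act L x) = x"
  using act_mult[OF assms, of "matrix_inv L"]
  unfolding lorentz_matrix_inv(2)[OF assms(1)] act_mat1 by (rule sym)

section \<open>Determinants and transitivity on hyperbolic space\<close>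

lemma det_square_of_mink_preserving:
  assumes "\<And>v w. mink (L *v v) (L *v w) = mink v w"
  shows "(det L)\<^sup>2 = 1"
proof -
  \<comment> \<open>With the Gram matrix J of the form, invariance reads
    \<open>transpose L ** J ** L = J\<close>, and determinants can be compared.\<close>
  define J :: "real^4^4" where "J = (\<chi> i j. if i = j then (if i = 1 then -1 else 1) else 0)"
  have J: "mink v w = v \<bullet> (J *v w)" for v w
    by (simp add: J_def inner_vec_def matrix_vector_mult_def sum_4 mink_def)
  have "v \<bullet> ((transpose L ** J ** L) *v w) = v \<bullet> (J *v w)" for v w
  proof -
    have "v \<bullet> ((transpose L ** J ** L) *v w) = ((J *v (L *v w)) v* L) \<bullet> v"
      by (simp only: matrix_vector_mul_assoc[symmetric] transpose_matrix_vector inner_commute[of v])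
    also have "\<dots> = (L *v v) \<bullet> (J *v (L *v w))"
      unfolding dot_lmul_matrix by (rule inner_commute)
    finally show ?thesis using assms[of v w] unfolding J by (rule trans)
  qed
  then have "(transpose L ** J ** L) *v w = J *v w" for w
    using vector_eq_ldot by blast
  then have "transpose L ** J ** L = J"
    using matrix_eq by blast
  then have "det (transpose L ** J ** L) = det J" by simp
  then have "det L * det J * det L = det J" by (simp add: det_mul det_transpose)
  moreover have "det J = -1"
  proof -
    have "det J = (\<Prod>i\<in>UNIV. J$i$i)" by (rule det_diagonal) (simp add: J_def)
    also have "\<dots> = -1" unfolding UNIV_4 by (simp add: J_def)
    finally show ?thesis .
  qed
  ultimately show ?thesis by (simp add: power2_eq_square)
qed

text \<open>The reflection in \<open>e1 - b\<close> exchanges e1 and the point \<open>b\<close> of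
  the hyperboloid above \<open>z\<close>; a reflection fixing e1 then repairs the determinant if
  necessary.\<close>

lemma lorentz_transitive:
  assumes "norm z < 1"
  obtains g where "lorentz g" "act g 0 = z"
proof -
  define b where "b = (1 / sqrt (1 - (norm z)\<^sup>2)) *\<^sub>R lift z"
  have n1: "(norm z)\<^sup>2 < 1" using assms by (simp add: power_less_one_iff)
  have b1: "b$1 > 0" using n1 by (simp add: b_def)
  have bb: "mink b b = -1"
    using n1 by (simp add: b_def mink_simps mink_lift field_simps)
  define U where "U = e1 - b"
  have UU: "mink U U = 2 * (b$1 - 1)"
    using bb by (simp add: U_def mink_simps)
  obtain R :: "real^4^4" where Rm: "\<And>v w. mink (R *v v) (R *v w) = mink v w" and Re: "R *v e1 = b"
  proof (cases "b$1 = 1")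
    \<comment> \<open>Here \<open>b = e1\<close> and the reflection vector U vanishes.\<close>
    case True
    have "b = e1"
    proof -
      have "(b$2)\<^sup>2 + (b$3)\<^sup>2 + (b$4)\<^sup>2 = 0" using bb True by (simp add: mink_def power2_eq_square)
      moreover have "0 \<le> (b$2)\<^sup>2" "0 \<le> (b$3)\<^sup>2" "0 \<le> (b$4)\<^sup>2" by auto
      ultimately have "(b$2)\<^sup>2 = 0" "(b$3)\<^sup>2 = 0" "(b$4)\<^sup>2 = 0" by linarith+
      then show ?thesis using True unfolding vec_eq_iff forall_4 by (simp add: axis_def)
    qed
    then show ?thesis by (intro that[of "mat 1"]) auto
  next
    case False
    then have U0: "mink U U \<noteq> 0" using UU by simp
    define r where "r v = v - (2 * mink v U / mink U U) *\<^sub>R U" for v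
    have "linear r"
      unfolding r_def by (rule linearI) (simp_all add: mink_simps add_divide_distrib algebra_simps)
    then have rv: "matrix r *v v = r v" for v by (simp add: matrix_works)
    have rr: "mink (r v) (r w) = mink v w" for v w
    proof -
      have "mink (r v) (r w) = mink v w - (2 * mink w U / mink U U) * mink v U - (2 * mink v U / mink U U) * mink w U
          + (2 * mink v U / mink U U) * (2 * mink w U / mink U U) * mink U U"
        unfolding r_def mink_simps mink_commute[of U w] by algebra
      also have "\<dots> = mink v w" using U0 by simp
      finally show ?thesis .
    qed
    have "mink e1 U / mink U U = 1 / 2"
      using False unfolding UU by (simp add: U_def field_simps)
    then have "2 * mink e1 U / mink U U = 1" by linarith
    then have "r e1 = b" unfolding r_def by (simp add: U_def)
    with rr rv show ?thesis by (intro that[of "matrix r"]) auto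
  qed
  \<comment> \<open>The sign change of the last coordinate fixes e1 and has determinant -1; it is
    composed with R when R reverses orientation.\<close>
  define D :: "real^4^4" where "D = (\<chi> i j. if i = j then (if i = 4 then -1 else 1) else 0)"
  have D: "D *v v = (\<chi> i. if i = 4 then - v$i else v$i)" for v
    unfolding vec_eq_iff forall_4 by (simp add: D_def matrix_vector_mult_def sum_4)
  have De: "D *v e1 = e1" by (simp add: D vec_eq_iff axis_def)
  have detD: "det D = -1"
  proof -
    have "det D = (\<Prod>i\<in>UNIV. D$i$i)" by (rule det_diagonal) (simp add: D_def)
    also have "\<dots> = -1" unfolding UNIV_4 by (simp add: D_def)
    finally show ?thesis .
  qed
  define g where "g = (if det R = 1 then R else R ** D)"
  have "(det R)\<^sup>2 = 1" by (rule det_square_of_mink_preserving[OF Rm])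
  then have "det g = 1" by (auto simp: g_def det_mul detD power2_eq_1_iff)
  moreover have ge: "g *v e1 = b"
    by (simp add: g_def Re matrix_vector_mul_assoc[symmetric] De)
  moreover have "mink (g *v v) (g *v w) = mink v w" for v w
  proof -
    have "mink (D *v v) (D *v w) = mink v w" unfolding D by (simp add: mink_def)
    then show ?thesis by (simp add: g_def Rm matrix_vector_mul_assoc[symmetric])
  qed
  moreover have "g$1$1 > 0" using b1 ge matrix_vector_axis[of g 1 1] by simp
  ultimately have "lorentz g" by (simp add: lorentz_def)
  moreover have "act g 0 = z"
  proof -
    have "act g 0 = proj b" by (simp add: act_def lift_zero ge)
    also have "\<dots> = proj (lift z)" unfolding b_def using n1 by (intro proj_scale) simp
    also have "\<dots> = z" unfolding vec_eq_iff forall_3 by (simp add: proj_def)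
    finally show ?thesis .
  qed
  ultimately show ?thesis by (rule that)
qed

section \<open>Words as Lorentz matrices\<close>

lemma eval_word_Nil [simp]: "eval_word \<xi> \<eta> [] = mat 1"
  by (simp add: eval_word_def)

lemma eval_word_Cons: "eval_word \<xi> \<eta> (a # w) = letter_mat \<xi> \<eta> a ** eval_word \<xi> \<eta> w"
  by (simp only: eval_word_def foldr.simps comp_apply)

lemma eval_word_append: "eval_word \<xi> \<eta> (u @ v) = eval_word \<xi> \<eta> u ** eval_word \<xi> \<eta> v"
  by (induction u) (simp_all add: eval_word_Cons matrix_mul_assoc)

lemma lorentz_eval_word:
  assumes "lorentz \<xi>" "lorentz \<eta>"
  shows "lorentz (eval_word \<xi> \<eta> w)"
proof (induction w)
  case (Cons a w)
  then show ?case
    using assms by (cases a) (auto simp: eval_word_Cons intro!: lorentz_mult lorentz_inv)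
qed (simp add: lorentz_mat1)

lemma letter_mat_inverse:
  assumes "lorentz \<xi>" "lorentz \<eta>"
  shows "letter_mat \<xi> \<eta> a ** letter_mat \<xi> \<eta> (inv_letter a) = mat 1"
  using assms by (cases a) (auto simp: lorentz_matrix_inv)

lemma eval_word_reduce:
  assumes "lorentz \<xi>" "lorentz \<eta>"
  shows "eval_word \<xi> \<eta> (reduce w) = eval_word \<xi> \<eta> w"
proof (induction w)
  case (Cons a w)
  have *: "letter_mat \<xi> \<eta> a ** (letter_mat \<xi> \<eta> (inv_letter a) ** M) = M" for M
    by (simp add: matrix_mul_assoc letter_mat_inverse[OF assms])
  show ?case
    by (auto simp: eval_word_Cons Cons[symmetric] * split: list.splits)
qed simp

section \<open>Growth of a discrete free group\<close>

lemma matrix_norm_le_entries: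
  fixes M :: "real^4^4"
  assumes "\<And>i j. \<bar>M$i$j\<bar> < e"
  shows "norm M < 16 * e"
proof -
  have row: "norm (M$i) < 4 * e" for i
  proof -
    have "norm (M$i) \<le> (\<Sum>j\<in>UNIV. \<bar>M$i$j\<bar>)" by (rule norm_le_l1_cart)
    also have "\<dots> < 4 * e"
      unfolding sum_4 using assms[of i 1] assms[of i 2] assms[of i 3] assms[of i 4] by linarith
    finally show ?thesis .
  qed
  have "norm M \<le> (\<Sum>i\<in>UNIV. norm (M$i))"
    unfolding norm_vec_def[of M] by (rule L2_set_le_sum) simp
  also have "\<dots> < 16 * e"
    unfolding sum_4 using row[of 1] row[of 2] row[of 3] row[of 4] by linarith
  finally show ?thesis .
qed

locale free_kleinian =
  fixes \<xi> \<eta> :: "real^4^4"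
  assumes kleinian: "kleinian \<xi> \<eta>" and free: "free_on \<xi> \<eta>"
begin

abbreviation ev :: "letter list \<Rightarrow> real^4^4" where
  "ev \<equiv> eval_word \<xi> \<eta>"

text \<open>Reduced words stand for the elements of the free group, with
  \<open>reduce (u @ v)\<close> as product.\<close>

abbreviation W :: "letter list set" where
  "W \<equiv> {w. reduced w}"

lemma lorentz_ev: "lorentz (ev w)"
  using kleinian by (intro lorentz_eval_word) (auto simp: kleinian_def)

lemma ev_reduce: "ev (reduce w) = ev w"
  using kleinian by (intro eval_word_reduce) (auto simp: kleinian_def)

lemma ev_inv_word: "ev (inv_word w) ** ev w = mat 1" "ev w ** ev (inv_word w) = mat 1"
  using ev_reduce[of "inv_word w @ w"] ev_reduce[of "w @ inv_word w"]
    reduce_cancel'[of w "[]"] reduce_cancel[of w "[]"]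
  by (simp_all add: eval_word_append)

lemma matrix_inv_ev: "matrix_inv (ev w) = ev (inv_word w)"
proof -
  have "matrix_inv (ev w) = matrix_inv (ev w) ** (ev w ** ev (inv_word w))"
    by (simp add: ev_inv_word)
  also have "\<dots> = ev (inv_word w)"
    unfolding matrix_mul_assoc by (simp add: lorentz_matrix_inv[OF lorentz_ev])
  finally show ?thesis .
qed

lemma ev_eq_imp_reduce:
  assumes "ev u = ev v"
  shows "reduce u = reduce v"
proof -
  have "ev (reduce (inv_word u @ v)) = mat 1"
    unfolding ev_reduce eval_word_append assms[symmetric] by (simp add: ev_inv_word)
  then have *: "reduce (inv_word u @ v) = []"
    using free reduced_reduce[of "inv_word u @ v"] unfolding free_on_def by blast
  have "reduce v = reduce (u @ reduce (inv_word u @ v))"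
    unfolding reduce_append_right reduce_cancel ..
  then show ?thesis unfolding * by simp
qed

lemma bij_betw_left_mult: "bij_betw (\<lambda>w. reduce (g @ w)) W W"
  by (rule bij_betwI[where g="\<lambda>w. reduce (inv_word g @ w)"])
    (simp_all add: reduce_append_right reduce_cancel reduce_cancel' reduce_reduced)

lemma bij_betw_right_mult: "bij_betw (\<lambda>w. reduce (w @ h)) W W"
proof -
  have "reduce (w @ h @ inv_word h) = reduce w" for w
    using reduce_append_right[of w "h @ inv_word h"] reduce_cancel[of h "[]"] by simp
  moreover have "reduce (w @ inv_word h @ h) = reduce w" for w
    using reduce_append_right[of w "inv_word h @ h"] reduce_cancel'[of h "[]"] by simp
  ultimately show ?thesis
    by (intro bij_betwI[where g="\<lambda>w. reduce (w @ inv_word h)"])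
      (simp_all add: reduce_append_left reduce_reduced)
qed

text \<open>Discreteness enters through the isolation of the identity; the entrywise form suits the
  counting by rounded entries.\<close>

lemma ev_near_identity:
  obtains e where "e > 0" "\<And>w. (\<And>i j. \<bar>(ev w - mat 1)$i$j\<bar> < e) \<Longrightarrow> ev w = mat 1"
proof -
  have "mat 1 \<in> Gamma \<xi> \<eta>" unfolding Gamma_def using eval_word_Nil[of \<xi> \<eta>] by (metis rangeI)
  then have "mat 1 isolated_in Gamma \<xi> \<eta>"
    using kleinian unfolding kleinian_def discrete_def by blast
  then obtain d where d: "d > 0" "\<And>y. y \<in> Gamma \<xi> \<eta> \<Longrightarrow> dist (mat 1) y < d \<Longrightarrow> y = mat 1"
    using isolated_inE_dist[of "mat 1" "Gamma \<xi> \<eta>"] by metis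
  show ?thesis
  proof (rule that[of "d / 16"])
    fix w assume "\<And>i j. \<bar>(ev w - mat 1)$i$j\<bar> < d / 16"
    then have "norm (ev w - mat 1) < 16 * (d / 16)" by (rule matrix_norm_le_entries)
    then have "dist (mat 1) (ev w) < d" by (simp add: dist_norm norm_minus_commute)
    then show "ev w = mat 1" by (intro d(2)) (auto simp: Gamma_def)
  qed (use d in simp)
qed

text \<open>Left translation by the inverse of \<open>u\<close> brings \<open>v\<close> near the
  identity. The entries of that inverse are at most R in absolute value, and an entry of the product
  is a sum of four terms, whence the factor \<open>4 * R\<close>.\<close>

lemma ev_separated:
  obtains e where "e > 0"
    "\<And>u v R. u \<in> W \<Longrightarrow> v \<in> W \<Longrightarrow> ev u$1$1 \<le> R \<Longrightarrow>
      (\<And>i j. \<bar>ev v$i$j - ev u$i$j\<bar> * (4 * R) < e) \<Longrightarrow> u = v"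
proof -
  obtain e where e: "e > 0" "\<And>w. (\<And>i j. \<bar>(ev w - mat 1)$i$j\<bar> < e) \<Longrightarrow> ev w = mat 1"
    using ev_near_identity by metis
  have "u = v" if uv: "u \<in> W" "v \<in> W" and R: "ev u$1$1 \<le> R"
    and close: "\<And>i j. \<bar>ev v$i$j - ev u$i$j\<bar> * (4 * R) < e" for u v R
  proof -
    let ?w = "inv_word u @ v"
    have R1: "R \<ge> 1" using R lorentz_11_ge_1[OF lorentz_ev[of u]] by linarith
    have eq: "ev ?w - mat 1 = ev (inv_word u) ** (ev v - ev u)"
    proof -
      have "A ** (B - C) = A ** B - A ** C" for A B C :: "real^4^4"
        unfolding vec_eq_iff by (simp add: matrix_matrix_mult_def right_diff_distrib sum_subtractf)
      then show ?thesis by (simp only: eval_word_append ev_inv_word)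
    qed
    have inv_le: "\<bar>ev (inv_word u)$i$m\<bar> \<le> R" for i m
      using lorentz_entry_le[OF lorentz_ev[of "inv_word u"], of i m] R
        lorentz_inv_11[OF lorentz_ev[of u]] matrix_inv_ev[of u] by simp
    have "\<bar>(ev ?w - mat 1)$i$j\<bar> < e" for i j
    proof -
      have t: "\<bar>ev (inv_word u)$i$m * (ev v - ev u)$m$j\<bar> < e / 4" for m
      proof -
        have "\<bar>ev (inv_word u)$i$m * (ev v - ev u)$m$j\<bar> \<le> R * \<bar>ev v$m$j - ev u$m$j\<bar>"
          unfolding abs_mult using inv_le[of i m] by (simp add: mult_right_mono)
        also have "\<dots> < e / 4" using close[of m j] by (simp add: mult_ac)
        finally show ?thesis .
      qed
      have "(ev ?w - mat 1)$i$j = (\<Sum>m\<in>UNIV. ev (inv_word u)$i$m * (ev v - ev u)$m$j)"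
        unfolding eq matrix_matrix_mult_def by simp
      then show ?thesis
        using t[of 1] t[of 2] t[of 3] t[of 4] unfolding sum_4 by linarith
    qed
    then have "ev ?w = mat 1" by (rule e(2))
    then have "ev u ** (ev (inv_word u) ** ev v) = ev u"
      unfolding eval_word_append by (simp only: matrix_mul_rid)
    then have "ev v = ev u"
      by (simp only: matrix_mul_assoc ev_inv_word matrix_mul_lid)
    then show "u = v" using ev_eq_imp_reduce[of u v] uv by (simp add: reduce_reduced)
  qed
  with e(1) show ?thesis by (rule that)
qed

text \<open>Rounding the 16 entries to a grid of mesh e / (4 R) is injective by
  \<open>ev_separated\<close>. The entries are at most R, so each takes O(R^2) values, which gives
  the crude exponent 2 * 16.\<close>

lemma card_ev_le:
  "\<exists>K>0. \<forall>R\<ge>1. finite {w \<in> W. ev w$1$1 \<le> R} \<and> real (card {w \<in> W. ev w$1$1 \<le> R}) \<le> K * R ^ 32"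
proof -
  obtain e where e: "e > 0"
    "\<And>u v R. u \<in> W \<Longrightarrow> v \<in> W \<Longrightarrow> ev u$1$1 \<le> R \<Longrightarrow>
      (\<And>i j. \<bar>ev v$i$j - ev u$i$j\<bar> * (4 * R) < e) \<Longrightarrow> u = v"
    using ev_separated by metis
  \<comment> \<open>Chosen so that the number 2 m + 1 of grid values is at most c R^2 when R >=
    1.\<close>
  define c where "c = 8 / e + 5"
  have c0: "c > 0" using e by (simp add: c_def add_pos_pos)
  have main: "finite {w \<in> W. ev w$1$1 \<le> R} \<and> real (card {w \<in> W. ev w$1$1 \<le> R}) \<le> c ^ 16 * R ^ 32"
    if R: "R \<ge> 1" for R
  proof -
    define S where "S = {w \<in> W. ev w$1$1 \<le> R}"
    define q where "q w = (\<lambda>p::4\<times>4. \<lfloor>ev w $ fst p $ snd p * (4 * R / e)\<rfloor>)" for w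
    define m where "m = \<lceil>4 * R\<^sup>2 / e\<rceil> + 1"
    define B where "B = (\<Pi>\<^sub>E p\<in>(UNIV::(4\<times>4) set). {- m .. m})"
    have inj: "inj_on q S"
    proof (rule inj_onI)
      fix u v assume uv: "u \<in> S" "v \<in> S" "q u = q v"
      show "u = v"
      proof (rule e(2))
        show "u \<in> W" "v \<in> W" "ev u$1$1 \<le> R" using uv by (auto simp: S_def)
        fix i j
        have fl: "\<lfloor>ev u$i$j * (4 * R / e)\<rfloor> = \<lfloor>ev v$i$j * (4 * R / e)\<rfloor>"
          using fun_cong[OF uv(3), of "(i, j)"] by (simp add: q_def)
        have "\<bar>ev v$i$j * (4 * R / e) - ev u$i$j * (4 * R / e)\<bar> < 1"
          using fl by linarith
        then have "\<bar>(ev v$i$j - ev u$i$j) * (4 * R / e)\<bar> < 1" unfolding left_diff_distrib .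
        then show "\<bar>ev v$i$j - ev u$i$j\<bar> * (4 * R) < e"
          using e(1) R unfolding abs_mult by (simp add: divide_simps)
      qed
    qed
    have sub: "q ` S \<subseteq> B"
    proof -
      have "q w p \<in> {-m..m}" if "w \<in> S" for w p
      proof -
        let ?x = "ev w $ fst p $ snd p * (4 * R / e)"
        have "\<bar>ev w $ fst p $ snd p\<bar> \<le> R"
          using lorentz_entry_le[OF lorentz_ev[of w], of "fst p" "snd p"] that by (simp add: S_def)
        then have "\<bar>?x\<bar> \<le> R * (4 * R / e)"
          unfolding abs_mult using R e(1) by (intro mult_mono) simp_all
        then have "\<bar>?x\<bar> \<le> 4 * R\<^sup>2 / e" by (simp add: power2_eq_square mult_ac)
        then have "\<bar>\<lfloor>?x\<rfloor>\<bar> \<le> \<lceil>4 * R\<^sup>2 / e\<rceil> + 1" by linarith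
        then show ?thesis unfolding q_def m_def by (simp add: abs_le_iff)
      qed
      then show ?thesis unfolding B_def by auto
    qed
    have finB: "finite B" unfolding B_def by (intro finite_PiE) auto
    have "finite S" using finite_imageD[OF finite_subset[OF sub finB] inj] .
    moreover have "real (card S) \<le> c ^ 16 * R ^ 32"
    proof -
      have "card S \<le> card B" using card_inj_on_le[OF inj sub finB] .
      also have "card B = nat (2 * m + 1) ^ 16"
        unfolding B_def by (simp add: card_PiE)
      finally have "real (card S) \<le> real (nat (2 * m + 1)) ^ 16"
        by (metis of_nat_le_iff of_nat_power)
      also have "\<dots> \<le> (c * R\<^sup>2) ^ 16"
      proof (rule power_mono)
        have q0: "0 \<le> 4 * R\<^sup>2 / e" using e(1) by simp
        have R2: "R\<^sup>2 \<ge> 1" using R by simp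
        have "real_of_int m \<le> 4 * R\<^sup>2 / e + 2" unfolding m_def by linarith
        moreover have "m \<ge> 0" using q0 unfolding m_def by linarith
        ultimately have "real (nat (2 * m + 1)) \<le> 2 * (4 * R\<^sup>2 / e + 2) + 1" by simp
        also have "\<dots> \<le> 8 * R\<^sup>2 / e + 5 * R\<^sup>2" using R2 by simp
        also have "\<dots> = c * R\<^sup>2" by (simp add: c_def algebra_simps)
        finally show "real (nat (2 * m + 1)) \<le> c * R\<^sup>2" .
      qed simp
      also have "\<dots> = c ^ 16 * R ^ 32" by (simp add: power_mult_distrib flip: power_mult)
      finally show ?thesis .
    qed
    ultimately show ?thesis by (simp add: S_def)
  qed
  show ?thesis using main zero_less_power[OF c0, of 16] by blast
qed

text \<open>A Poincare series in powers of cosh of the displacement. The shell of words with integer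
  part n has O(n^32) elements of weight at most n^-34, so the shells add up like n^-2; this is the
  origin of 34 = 32 + 2.\<close>

lemma poincare_series_finite:
  "(\<integral>\<^sup>+w. ennreal (1 / (ev w$1$1) ^ 34) \<partial>count_space W) < \<infinity>"
proof -
  obtain K where K: "K > 0" "\<And>R. R \<ge> 1 \<Longrightarrow> finite {w \<in> W. ev w$1$1 \<le> R}"
    "\<And>R. R \<ge> 1 \<Longrightarrow> real (card {w \<in> W. ev w$1$1 \<le> R}) \<le> K * R ^ 32"
    using card_ev_le by blast
  define N where "N w = nat \<lfloor>ev w$1$1\<rfloor>" for w
  let ?f = "\<lambda>w. ennreal (1 / (ev w$1$1) ^ 34)"
  have N: "N w \<ge> 1" "real (N w) \<le> ev w$1$1" "ev w$1$1 \<le> real (N w) + 1" for w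
    using lorentz_11_ge_1[OF lorentz_ev[of w]] unfolding N_def by linarith+
  have split_N: "?f w = (\<Sum>n. ?f w * indicator {N w} n)" for w
    by (subst suminf_finite[of "{N w}"]) auto
  have bnd: "(\<integral>\<^sup>+w. ?f w * indicator {N w} n \<partial>count_space W) \<le> ennreal (K * 2 ^ 32 * inverse (real n ^ 2))" for n
  proof (cases "n = 0")
    \<comment> \<open>The shell 0 is empty, since \<open>ev w$1$1\<close> is at least 1.\<close>
    case True
    have "indicator {N w} n = (0::ennreal)" for w using N(1)[of w] True by (simp add: indicator_def)
    then show ?thesis by simp
  next
    case False
    let ?S = "{w \<in> W. ev w$1$1 \<le> real n + 1}"
    have fin: "finite ?S" using K(2)[of "real n + 1"] by simp
    have "(\<integral>\<^sup>+w. ?f w * indicator {N w} n \<partial>count_space W)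
        \<le> (\<integral>\<^sup>+w. ennreal (1 / real n ^ 34) * indicator ?S w \<partial>count_space W)"
    proof (rule nn_integral_mono)
      fix w assume w: "w \<in> space (count_space W)"
      show "?f w * indicator {N w} n \<le> ennreal (1 / real n ^ 34) * indicator ?S w"
      proof (cases "N w = n")
        case True
        have "real n ^ 34 \<le> (ev w$1$1) ^ 34"
          using N(2)[of w] True by (intro power_mono) auto
        moreover have "0 < real n ^ 34" using False by simp
        ultimately have "1 / (ev w$1$1) ^ 34 \<le> 1 / real n ^ 34" by (simp add: frac_le)
        moreover have "w \<in> ?S" using w N(3)[of w] True by simp
        ultimately show ?thesis using True by (simp add: ennreal_leI)
      qed simp
    qed
    also have "\<dots> = ennreal (1 / real n ^ 34) * ennreal (real (card ?S))"
    proof -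
      have "emeasure (count_space W) ?S = of_nat (card ?S)"
        by (rule emeasure_count_space_finite[OF _ fin]) blast
      then show ?thesis
        by (subst nn_integral_cmult_indicator) (auto simp: ennreal_of_nat_eq_real_of_nat)
    qed
    also have "\<dots> = ennreal (1 / real n ^ 34 * real (card ?S))"
      by (rule ennreal_mult[symmetric]) simp_all
    also have "\<dots> \<le> ennreal (K * 2 ^ 32 * inverse (real n ^ 2))"
    proof (rule ennreal_leI)
      have "real (card ?S) \<le> K * (real n + 1) ^ 32" by (rule K(3)) simp
      also have "\<dots> \<le> K * (2 * real n) ^ 32"
        using K(1) False by (intro mult_left_mono power_mono) auto
      finally have "1 / real n ^ 34 * real (card ?S) \<le> 1 / real n ^ 34 * (K * (2 * real n) ^ 32)"
        by (intro mult_left_mono) auto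
      also have "\<dots> = K * 2 ^ 32 * (real n ^ 32 / real n ^ (32 + 2))"
        unfolding power_mult_distrib by simp
      also have "real n ^ 32 / real n ^ (32 + 2) = inverse (real n ^ 2)"
      proof -
        have "x ^ m / x ^ (m + 2) = inverse (x ^ 2)" if "x \<noteq> 0" for x :: real and m :: nat
          using that by (simp add: power_add power2_eq_square divide_simps)
        then show ?thesis using False by (metis of_nat_eq_0_iff)
      qed
      finally show "1 / real n ^ 34 * real (card ?S) \<le> K * 2 ^ 32 * inverse (real n ^ 2)" .
    qed
    finally show ?thesis .
  qed
  have "(\<integral>\<^sup>+w. ?f w \<partial>count_space W) = (\<integral>\<^sup>+w. (\<Sum>n. ?f w * indicator {N w} n) \<partial>count_space W)"
    using split_N by (intro nn_integral_cong) blast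
  also have "\<dots> = (\<Sum>n. \<integral>\<^sup>+w. ?f w * indicator {N w} n \<partial>count_space W)"
    by (rule nn_integral_suminf) simp
  also have "\<dots> \<le> (\<Sum>n. ennreal (K * 2 ^ 32 * inverse (real n ^ 2)))"
    by (intro suminf_le bnd) auto
  also have "\<dots> < \<infinity>"
  proof -
    have "summable (\<lambda>n. K * 2 ^ 32 * inverse (real n ^ 2))"
      by (intro summable_mult inverse_power_summable) simp
    then show ?thesis using K(1) by (subst suminf_ennreal2) auto
  qed
  finally show ?thesis .
qed

end

section \<open>Orbit probabilities\<close>

text \<open>Up to positive scaling these are the points of hyperbolic space. Leaving them
  unnormalised allows a geodesic ray to be written as a fixed vector plus growing multiples of a
  null vector.\<close>

definition timelike :: "real^4 \<Rightarrow> bool" where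
  "timelike v \<longleftrightarrow> mink v v < 0 \<and> 0 < v$1"

lemma timelike_e1: "timelike e1"
  by (simp add: timelike_def)

lemma timelike_lorentz_e1: "lorentz L \<Longrightarrow> timelike (L *v e1)"
  using lorentz_e1(1,2)[of L] by (simp add: timelike_def)

lemma timelike_scale: "timelike v \<Longrightarrow> 0 < c \<Longrightarrow> timelike (c *\<^sub>R v)"
  by (simp add: timelike_def mink_simps mult_pos_neg)

lemma timelike_imp_future: "timelike v \<Longrightarrow> future v"
  by (simp add: timelike_def future_def)

lemma timelike_add_future:
  assumes "timelike v" "future w" "0 \<le> u"
  shows "timelike (v + u *\<^sub>R w)"
proof -
  have "mink v w \<le> 0"
    by (rule future_mink_nonpos[OF timelike_imp_future[OF assms(1)] assms(2)])
  then have "u * mink v w \<le> 0" using assms(3) by (simp add: mult_nonneg_nonpos)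
  moreover have "u * (u * mink w w) \<le> 0"
    using assms(2,3) by (simp add: future_def mult_nonneg_nonpos)
  moreover have "0 \<le> u * w$1" using assms(2,3) by (simp add: future_def)
  ultimately show ?thesis
    using assms(1) unfolding timelike_def
    by (simp add: mink_simps mink_commute[of w v] algebra_simps)
qed

lemma lift_eq: "lift x = e1 + x$1 *\<^sub>R axis 2 1 + x$2 *\<^sub>R axis 3 1 + x$3 *\<^sub>R axis 4 1"
  unfolding vec_eq_iff forall_4 by (simp add: axis_def)

lemma continuous_on_lift: "continuous_on S lift"
  unfolding lift_eq[abs_def] by (intro continuous_intros)

lemma borel_measurable_lift [measurable]: "lift \<in> borel_measurable borel"
  by (intro borel_measurable_continuous_onI continuous_on_lift)

lemma finite_letters: "finite (UNIV :: letter set)"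
proof -
  have "a \<in> {Xi, XiInv, Eta, EtaInv}" for a by (cases a) auto
  then have "(UNIV :: letter set) = {Xi, XiInv, Eta, EtaInv}" by blast
  then show ?thesis by (metis finite.emptyI finite.insertI)
qed

lemma countable_words: "countable (A :: letter list set)"
proof -
  have "countable (lists (UNIV :: letter set))" by (rule countable_lists[OF countable_finite[OF finite_letters]])
  then show ?thesis by (rule countable_subset[rotated]) simp
qed

context free_kleinian
begin

text \<open>The exponent exceeds the growth rate 32 of \<open>card_ev_le\<close>, so the weights are summable. The parameter
  \<open>h\<close> moves the base point of the orbit; equivalently it translates words on the right, which commutes
  with the left action.\<close>
definition orbit_weight :: "letter list \<Rightarrow> real^4 \<Rightarrow> letter list \<Rightarrow> real" where
  "orbit_weight h X w = 1 / (mink X (ev (w @ h) *v e1)) ^ 34"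

definition orbit_measure :: "letter list \<Rightarrow> real^4 \<Rightarrow> letter list measure" where
  "orbit_measure h X = density (count_space W) (\<lambda>w. ennreal (orbit_weight h X w))"

definition orbit_prob :: "letter list \<Rightarrow> real^4 \<Rightarrow> letter list set \<Rightarrow> real" where
  "orbit_prob h X C = measure (orbit_measure h X) C / measure (orbit_measure h X) W"

lemma orbit_weight_nonneg: "0 \<le> orbit_weight h X w"
  by (simp add: orbit_weight_def)

lemma mink_ev_neg:
  assumes "timelike X"
  shows "mink X (ev w *v e1) < 0"
  by (rule timelike_mink_neg) (use assms lorentz_e1[OF lorentz_ev[of w]] in \<open>simp_all add: timelike_def\<close>)

lemma sets_orbit_measure: "sets (orbit_measure h X) = Pow W" and space_orbit_measure: "space (orbit_measure h X) = W"
  by (simp_all add: orbit_measure_def)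

lemma emeasure_orbit_measure:
  assumes "C \<subseteq> W"
  shows "emeasure (orbit_measure h X) C = (\<integral>\<^sup>+w. ennreal (orbit_weight h X w) * indicator C w \<partial>count_space W)"
  unfolding orbit_measure_def using assms by (subst emeasure_density) auto

text \<open>By \<open>timelike_mink_le\<close> each weight is at most a constant times a term of the
  Poincare series, and the shift by \<open>h\<close> only permutes the terms.\<close>

lemma finite_measure_orbit_measure:
  assumes "timelike X"
  shows "finite_measure (orbit_measure h X)"
proof (rule finite_measureI)
  obtain d where d: "d > 0" "\<And>w. future w \<Longrightarrow> d * w$1 \<le> - mink X w"
    using timelike_mink_le[of X] assms unfolding timelike_def by blast
  let ?f = "\<lambda>w. ennreal (1 / (ev w$1$1) ^ 34)"
  have le: "ennreal (orbit_weight h X w) \<le> ennreal (1 / d ^ 34) * ?f (reduce (w @ h))" for w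
  proof -
    let ?a = "ev (w @ h)$1$1"
    have a: "0 < d * ?a" "d * ?a \<le> - mink X (ev (w @ h) *v e1)"
      using d(2)[OF lorentz_e1(3)[OF lorentz_ev[of "w @ h"]]] d(1)
        lorentz_11_ge_1[OF lorentz_ev[of "w @ h"]] by (simp_all add: lorentz_e1(4)[OF lorentz_ev])
    \<comment> \<open>The exponent is even, so the negative pairing may be replaced by its absolute
      value.\<close>
    have "orbit_weight h X w = 1 / (- mink X (ev (w @ h) *v e1)) ^ 34" by (simp add: orbit_weight_def)
    also have "\<dots> \<le> 1 / (d * ?a) ^ 34"
      using a by (intro frac_le power_mono) auto
    also have "\<dots> = 1 / d ^ 34 * (1 / ?a ^ 34)" by (simp add: power_mult_distrib)
    finally have "ennreal (orbit_weight h X w) \<le> ennreal (1 / d ^ 34 * (1 / ?a ^ 34))" by (rule ennreal_leI)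
    also have "\<dots> = ennreal (1 / d ^ 34) * ennreal (1 / ?a ^ 34)"
      by (rule ennreal_mult) simp_all
    finally show ?thesis by (simp only: ev_reduce)
  qed
  have "emeasure (orbit_measure h X) W = (\<integral>\<^sup>+w. ennreal (orbit_weight h X w) \<partial>count_space W)"
    by (subst emeasure_orbit_measure) (auto intro!: nn_integral_cong)
  also have "\<dots> \<le> (\<integral>\<^sup>+w. ennreal (1 / d ^ 34) * ?f (reduce (w @ h)) \<partial>count_space W)"
    by (intro nn_integral_mono le)
  also have "\<dots> = ennreal (1 / d ^ 34) * (\<integral>\<^sup>+w. ?f (reduce (w @ h)) \<partial>count_space W)"
    by (rule nn_integral_cmult) simp
  also have "(\<integral>\<^sup>+w. ?f (reduce (w @ h)) \<partial>count_space W) = (\<integral>\<^sup>+w. ?f w \<partial>count_space W)"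
    by (rule nn_integral_bij_count_space[OF bij_betw_right_mult, where f="?f"])
  also have "ennreal (1 / d ^ 34) * \<dots> < \<infinity>"
    using poincare_series_finite by (simp add: ennreal_mult_less_top)
  finally show "emeasure (orbit_measure h X) (space (orbit_measure h X)) \<noteq> \<infinity>" by (simp add: space_orbit_measure)
qed

lemma measure_orbit_measure_pos:
  assumes "timelike X"
  shows "0 < measure (orbit_measure h X) W"
proof -
  interpret finite_measure "orbit_measure h X" by (rule finite_measure_orbit_measure[OF assms])
  have "0 < orbit_weight h X []"
    using mink_ev_neg[OF assms, of h] by (simp add: orbit_weight_def zero_less_power_eq)
  then have "0 < ennreal (orbit_weight h X [])" by simp
  also have "\<dots> \<le> (\<integral>\<^sup>+w. ennreal (orbit_weight h X w) \<partial>count_space W)"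
    by (rule nn_integral_ge_point) simp
  also have "\<dots> = emeasure (orbit_measure h X) W"
    by (subst emeasure_orbit_measure) (auto intro!: nn_integral_cong)
  finally show ?thesis by (simp add: emeasure_eq_measure)
qed

lemma orbit_prob_nonneg: "0 \<le> orbit_prob h X C"
  by (simp add: orbit_prob_def)

lemma orbit_prob_le_1: "orbit_prob h X C \<le> 1"
proof (cases "emeasure (orbit_measure h X) W = \<infinity>")
  \<comment> \<open>With infinite total mass \<open>measure\<close> is 0 and division by zero gives
    0, so the bound holds for every vector X.\<close>
  case True
  then show ?thesis by (simp add: orbit_prob_def measure_def)
next
  case False
  then interpret finite_measure "orbit_measure h X"
    by (intro finite_measureI) (simp add: space_orbit_measure)
  show ?thesis
    using bounded_measure[of C] unfolding orbit_prob_def space_orbit_measure 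
    using measure_nonneg[of "orbit_measure h X" W] by (auto simp: divide_le_eq_1 less_le)
qed

lemma orbit_prob_W: "timelike X \<Longrightarrow> orbit_prob h X W = 1"
  using measure_orbit_measure_pos[of X h] by (simp add: orbit_prob_def)

lemma orbit_prob_Un:
  assumes "timelike X" "A \<subseteq> W" "B \<subseteq> W" "A \<inter> B = {}"
  shows "orbit_prob h X (A \<union> B) = orbit_prob h X A + orbit_prob h X B"
proof -
  interpret finite_measure "orbit_measure h X" by (rule finite_measure_orbit_measure[OF assms(1)])
  show ?thesis
    unfolding orbit_prob_def using assms(2-4)
    by (subst finite_measure_Union) (auto simp: sets_orbit_measure add_divide_distrib)
qed

section \<open>Comparison and invariance of the orbit probabilities\<close>

lemma measure_orbit_measure_le:
  assumes "timelike X" "timelike Y" "C \<subseteq> W" "0 \<le> c"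
    and le: "\<And>w. orbit_weight h X w \<le> c * orbit_weight h Y w"
  shows "measure (orbit_measure h X) C \<le> c * measure (orbit_measure h Y) C"
proof -
  interpret X: finite_measure "orbit_measure h X" by (rule finite_measure_orbit_measure[OF assms(1)])
  interpret Y: finite_measure "orbit_measure h Y" by (rule finite_measure_orbit_measure[OF assms(2)])
  have "emeasure (orbit_measure h X) C \<le> (\<integral>\<^sup>+w. ennreal c * (ennreal (orbit_weight h Y w) * indicator C w) \<partial>count_space W)"
    unfolding emeasure_orbit_measure[OF assms(3)]
  proof (rule nn_integral_mono)
    fix w
    have "ennreal (orbit_weight h X w) \<le> ennreal (c * orbit_weight h Y w)" by (rule ennreal_leI[OF le])
    also have "\<dots> = ennreal c * ennreal (orbit_weight h Y w)"
      using assms(4) orbit_weight_nonneg by (rule ennreal_mult)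
    finally show "ennreal (orbit_weight h X w) * indicator C w \<le> ennreal c * (ennreal (orbit_weight h Y w) * indicator C w)"
      unfolding mult.assoc[symmetric] by (rule mult_right_mono) simp
  qed
  also have "\<dots> = ennreal c * emeasure (orbit_measure h Y) C"
    unfolding emeasure_orbit_measure[OF assms(3)] by (rule nn_integral_cmult) simp
  also have "\<dots> = ennreal (c * measure (orbit_measure h Y) C)"
    unfolding Y.emeasure_eq_measure using assms(4) by (intro ennreal_mult[symmetric]) simp_all
  finally show ?thesis
    unfolding X.emeasure_eq_measure using assms(4) by (subst (asm) ennreal_le_iff) auto
qed

lemma orbit_weight_le:
  assumes "timelike X" "timelike Y" "0 \<le> \<epsilon>"
    and le: "\<And>w. future w \<Longrightarrow> - mink Y w \<le> (1 + \<epsilon>) * (- mink X w)"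
  shows "orbit_weight h X w \<le> (1 + \<epsilon>) ^ 34 * orbit_weight h Y w"
proof -
  let ?x = "- mink X (ev (w @ h) *v e1)" and ?y = "- mink Y (ev (w @ h) *v e1)"
  have pos: "0 < ?x" "0 < ?y" using mink_ev_neg[OF assms(1), of "w @ h"] mink_ev_neg[OF assms(2), of "w @ h"] by auto
  have "?y \<le> (1 + \<epsilon>) * ?x" by (rule le[OF lorentz_e1(3)[OF lorentz_ev]])
  then have "?y ^ 34 \<le> ((1 + \<epsilon>) * ?x) ^ 34" using pos by (intro power_mono) auto
  then have "?y ^ 34 \<le> (1 + \<epsilon>) ^ 34 * ?x ^ 34" unfolding power_mult_distrib .
  moreover have "0 < ?x ^ 34" "0 < ?y ^ 34" using pos by (simp_all only: zero_less_power)
  moreover have "1 / x \<le> c * (1 / y)" if "y \<le> c * x" "0 < x" "0 < y" for x y c :: real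
    using that by (simp add: divide_simps)
  ultimately have "1 / ?x ^ 34 \<le> (1 + \<epsilon>) ^ 34 * (1 / ?y ^ 34)" by blast
  then show ?thesis by (simp add: orbit_weight_def)
qed

text \<open>Comparing X and Y against the whole future cone compares all weights up to the factor (1
  + \<epsilon>)^34; numerator and normalisation together give the exponent 68.\<close>

lemma orbit_prob_Harnack:
  assumes XY: "timelike X" "timelike Y" "0 \<le> \<epsilon>" "C \<subseteq> W"
    and le1: "\<And>w. future w \<Longrightarrow> - mink Y w \<le> (1 + \<epsilon>) * (- mink X w)"
    and le2: "\<And>w. future w \<Longrightarrow> - mink X w \<le> (1 + \<epsilon>) * (- mink Y w)"
  shows "orbit_prob h X C \<le> orbit_prob h Y C + 2 ^ 68 * \<epsilon>"
proof (cases "\<epsilon> \<le> 1")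
  \<comment> \<open>For \<epsilon> > 1 the right side exceeds 1, and any probability satisfies the
    bound.\<close>
  case False
  then have "1 \<le> 2 ^ 68 * \<epsilon>" by simp
  then show ?thesis using orbit_prob_le_1[of h X C] orbit_prob_nonneg[of h Y C] by linarith
next
  case True
  let ?k = "(1 + \<epsilon>) ^ 34"
  have k0: "0 \<le> ?k" using XY(3) by simp
  note pos = measure_orbit_measure_pos[OF XY(1), of h] measure_orbit_measure_pos[OF XY(2), of h]
  have 1: "measure (orbit_measure h X) C \<le> ?k * measure (orbit_measure h Y) C"
    by (rule measure_orbit_measure_le[OF XY(1,2,4) k0 orbit_weight_le[OF XY(1-3) le1]])
  have 2: "measure (orbit_measure h Y) W \<le> ?k * measure (orbit_measure h X) W"
    by (rule measure_orbit_measure_le[OF XY(2,1) order_refl k0 orbit_weight_le[OF XY(2,1,3) le2]])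
  have "orbit_prob h X C * measure (orbit_measure h X) W = measure (orbit_measure h X) C" using pos by (simp add: orbit_prob_def)
  also have "\<dots> \<le> ?k * (orbit_prob h Y C * measure (orbit_measure h Y) W)" using 1 pos by (simp add: orbit_prob_def)
  also have "\<dots> \<le> ?k * (orbit_prob h Y C * (?k * measure (orbit_measure h X) W))"
    using 2 k0 orbit_prob_nonneg[of h Y C] by (intro mult_left_mono) auto
  also have "\<dots> = (?k * ?k * orbit_prob h Y C) * measure (orbit_measure h X) W" by (simp add: mult_ac)
  finally have "orbit_prob h X C \<le> ?k * ?k * orbit_prob h Y C" using pos by simp
  also have "?k * ?k = (1 + \<epsilon>) ^ 68" unfolding power_add[symmetric] by simp
  finally have *: "orbit_prob h X C \<le> (1 + \<epsilon>) ^ 68 * orbit_prob h Y C" .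
  \<comment> \<open>On [0,1] the convex power lies below its chord; this yields the constant
    2^68.\<close>
  have bern: "(1 + \<epsilon>) ^ m \<le> 1 + (2 ^ m - 1) * \<epsilon>" for m :: nat
  proof (induction m)
    case (Suc m)
    have "(2 ^ m - 1) * (\<epsilon> * \<epsilon>) \<le> (2 ^ m - 1) * \<epsilon>"
      using True XY(3) by (intro mult_left_mono mult_left_le) auto
    moreover have "(1 + \<epsilon>) * (1 + (2 ^ m - 1) * \<epsilon>) = 1 + 2 ^ m * \<epsilon> + (2 ^ m - 1) * (\<epsilon> * \<epsilon>)"
      by (simp add: algebra_simps)
    moreover have "(1 + \<epsilon>) ^ Suc m \<le> (1 + \<epsilon>) * (1 + (2 ^ m - 1) * \<epsilon>)"
      using Suc XY(3) by (simp add: mult_left_mono)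
    moreover have "1 + 2 ^ m * \<epsilon> + (2 ^ m - 1) * \<epsilon> = 1 + (2 ^ Suc m - 1) * \<epsilon>"
      by (simp add: algebra_simps)
    ultimately show ?case by linarith
  qed simp
  have "(1 + \<epsilon>) ^ 68 \<le> 1 + 2 ^ 68 * \<epsilon>"
    using bern[of 68] XY(3) by (simp add: left_diff_distrib)
  then have "(1 + \<epsilon>) ^ 68 * orbit_prob h Y C \<le> (1 + 2 ^ 68 * \<epsilon>) * orbit_prob h Y C"
    using orbit_prob_nonneg[of h Y C] by (intro mult_right_mono)
  also have "\<dots> = orbit_prob h Y C + (2 ^ 68 * \<epsilon>) * orbit_prob h Y C" by (simp add: distrib_right)
  also have "(2 ^ 68 * \<epsilon>) * orbit_prob h Y C \<le> 2 ^ 68 * \<epsilon>"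
    using orbit_prob_le_1[of h Y C] XY(3) by (intro mult_left_le) auto
  finally show ?thesis using * by linarith
qed

text \<open>The weights are homogeneous of degree -34, which cancels on normalisation: the
  probability depends only on the point of hyperbolic space.\<close>

lemma orbit_prob_scale:
  assumes "0 < c"
  shows "orbit_prob h (c *\<^sub>R X) C = orbit_prob h X C"
proof -
  have orbit_weight: "orbit_weight h (c *\<^sub>R X) w = 1 / c ^ 34 * orbit_weight h X w" for w
    unfolding orbit_weight_def mink_scale_left power_mult_distrib by simp
  have m: "measure (orbit_measure h (c *\<^sub>R X)) A = 1 / c ^ 34 * measure (orbit_measure h X) A" if "A \<subseteq> W" for A
  proof -
    have "emeasure (orbit_measure h (c *\<^sub>R X)) A
        = (\<integral>\<^sup>+w. ennreal (1 / c ^ 34) * (ennreal (orbit_weight h X w) * indicator A w) \<partial>count_space W)"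
      unfolding emeasure_orbit_measure[OF that] orbit_weight
      by (subst ennreal_mult) (use assms orbit_weight_nonneg in \<open>simp_all add: mult.assoc\<close>)
    also have "\<dots> = ennreal (1 / c ^ 34) * emeasure (orbit_measure h X) A"
      unfolding emeasure_orbit_measure[OF that] by (rule nn_integral_cmult) simp
    finally have "enn2real (emeasure (orbit_measure h (c *\<^sub>R X)) A) = enn2real (ennreal (1 / c ^ 34)) * enn2real (emeasure (orbit_measure h X) A)"
      by (simp only: enn2real_mult)
    then show ?thesis unfolding measure_def using assms by simp
  qed
  \<comment> \<open>A set that is not measurable has \<open>measure\<close> 0, so both sides
    vanish.\<close>
  have "measure (orbit_measure h Y) C = 0" if "\<not> C \<subseteq> W" for Y
    using that by (intro measure_notin_sets) (simp add: sets_orbit_measure)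
  then show ?thesis
    using assms m[of C] m[of W] unfolding orbit_prob_def by (cases "C \<subseteq> W") auto
qed

text \<open>Invariance of the form moves \<open>g\<close> from the point X to the orbit, where it
  merely relabels the words.\<close>

lemma orbit_prob_translate:
  assumes "D \<subseteq> W"
  shows "orbit_prob h (ev g *v X) D = orbit_prob h X {w \<in> W. reduce (g @ w) \<in> D}"
proof -
  have orbit_weight: "orbit_weight h (ev g *v X) (reduce (g @ w)) = orbit_weight h X w" for w
  proof -
    have "ev (reduce (g @ w) @ h) *v e1 = ev g *v (ev (w @ h) *v e1)"
      by (simp add: eval_word_append ev_reduce matrix_vector_mul_assoc matrix_mul_assoc)
    then show ?thesis by (simp add: orbit_weight_def lorentz_mink[OF lorentz_ev])
  qed
  have m: "measure (orbit_measure h (ev g *v X)) A = measure (orbit_measure h X) {w \<in> W. reduce (g @ w) \<in> A}" if "A \<subseteq> W" for A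
  proof -
    have "emeasure (orbit_measure h (ev g *v X)) A
        = (\<integral>\<^sup>+w. ennreal (orbit_weight h (ev g *v X) (reduce (g @ w))) * indicator A (reduce (g @ w)) \<partial>count_space W)"
      unfolding emeasure_orbit_measure[OF that]
      by (rule nn_integral_bij_count_space[OF bij_betw_left_mult, symmetric])
    also have "\<dots> = emeasure (orbit_measure h X) {w \<in> W. reduce (g @ w) \<in> A}"
      by (subst emeasure_orbit_measure) (auto simp: orbit_weight indicator_def intro!: nn_integral_cong)
    finally show ?thesis by (simp add: measure_def)
  qed
  have "{w \<in> W. reduce (g @ w) \<in> W} = W" by simp
  then show ?thesis using m[OF assms] m[of W] unfolding orbit_prob_def by simp
qed

lemma borel_measurable_orbit_prob [measurable]: "(\<lambda>X. orbit_prob h X C) \<in> borel_measurable borel"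
proof -
  interpret sigma_finite_measure "count_space W"
    by (rule sigma_finite_measure_count_space_countable[OF countable_words])
  have "(\<lambda>X. measure (orbit_measure h X) A) \<in> borel_measurable borel" for A
  proof (cases "A \<subseteq> W")
    case True
    have [measurable]: "(\<lambda>X. orbit_weight h X w) \<in> borel_measurable borel" for w
      unfolding orbit_weight_def
      by (intro borel_measurable_divide borel_measurable_const borel_measurable_power
          borel_measurable_continuous_onI continuous_on_mink_left)
    have "(\<lambda>(X, w). ennreal (orbit_weight h X w) * indicator A w) \<in> borel_measurable (borel \<Otimes>\<^sub>M count_space W)"
      by (subst measurable_pair_swap_iff, rule measurable_pair_measure_countable1[OF countable_words]) auto
    then have "(\<lambda>X. \<integral>\<^sup>+w. ennreal (orbit_weight h X w) * indicator A w \<partial>count_space W) \<in> borel_measurable borel"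
      by (rule borel_measurable_nn_integral)
    then show ?thesis unfolding measure_def emeasure_orbit_measure[OF True] by measurable
  next
    case False
    then have "measure (orbit_measure h X) A = 0" for X
      by (intro measure_notin_sets) (simp add: sets_orbit_measure)
    then show ?thesis by simp
  qed
  then show ?thesis unfolding orbit_prob_def by (intro borel_measurable_divide)
qed

end

section \<open>Averages along rays\<close>

text \<open>Makes precise that V is small against Y in the cone order. The term quadratic in the
  coefficient is at most -2 (B + 1)^2, because Y has form value at most -2 u, and outweighs 2 (B +
  1) B + B; this balance dictates (B + 1) / sqrt u.\<close>

lemma future_perturbation:
  assumes u: "1 \<le> u" and Y: "mink Y Y \<le> - 2 * u" "u \<le> Y$1"
    and V: "\<bar>mink V Y\<bar> \<le> B" "mink V V \<le> B" "\<bar>V$1\<bar> \<le> B"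
  shows "future (((B + 1) / sqrt u) *\<^sub>R Y + V)"
proof -
  define \<epsilon> where "\<epsilon> = (B + 1) / sqrt u"
  have B0: "0 \<le> B" using V(3) by linarith
  have s: "1 \<le> sqrt u" "sqrt u * sqrt u = u" using u by auto
  have \<epsilon>0: "0 \<le> \<epsilon>" using B0 s by (simp add: \<epsilon>_def)
  have \<epsilon>1: "\<epsilon> \<le> B + 1" unfolding \<epsilon>_def using B0 s by (simp add: divide_le_eq mult_right_le_one_le)
  have \<epsilon>2: "\<epsilon> * \<epsilon> * u = (B + 1) * (B + 1)"
    unfolding \<epsilon>_def using s u by (simp add: divide_simps)
  have "mink (\<epsilon> *\<^sub>R Y + V) (\<epsilon> *\<^sub>R Y + V) = \<epsilon> * \<epsilon> * mink Y Y + 2 * (\<epsilon> * mink V Y) + mink V V"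
    by (simp add: mink_simps mink_commute[of Y V] algebra_simps)
  moreover have "\<epsilon> * \<epsilon> * mink Y Y \<le> \<epsilon> * \<epsilon> * (- 2 * u)"
    using Y(1) by (rule mult_left_mono) simp
  then have "\<epsilon> * \<epsilon> * mink Y Y \<le> - 2 * ((B + 1) * (B + 1))" using \<epsilon>2 by linarith
  moreover have "\<epsilon> * mink V Y \<le> (B + 1) * B"
    using mult_left_mono[of "mink V Y" B \<epsilon>] mult_right_mono[OF \<epsilon>1 B0] \<epsilon>0 V(1) by linarith
  moreover have "2 * ((B + 1) * (B + 1)) - 2 * ((B + 1) * B) - B = B + 2"
    by (simp add: algebra_simps)
  ultimately have "mink (\<epsilon> *\<^sub>R Y + V) (\<epsilon> *\<^sub>R Y + V) \<le> 0" using V(2) B0 by linarith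
  moreover have "0 \<le> (\<epsilon> *\<^sub>R Y + V)$1"
  proof -
    have "B + 1 \<le> (B + 1) * sqrt u" using B0 s(1) mult_left_mono[of 1 "sqrt u" "B + 1"] by simp
    also have "\<dots> = \<epsilon> * u"
      unfolding \<epsilon>_def using s u by (simp add: divide_simps mult.assoc)
    also have "\<dots> \<le> \<epsilon> * Y$1" using Y(2) \<epsilon>0 by (rule mult_left_mono)
    finally show ?thesis using V(3) by (simp add: abs_le_iff)
  qed
  ultimately show ?thesis by (simp add: future_def \<epsilon>_def)
qed

text \<open>The factor is minus the pairing of \<open>lift x\<close> with
  \<open>matrix_inv L *v e1\<close>. With a for \<open>L$1$1\<close>, this vector minus e1 / (2 a),
  and 2 a e1 minus this vector, both lie in the future cone.\<close>

lemma lorentz_factor_bounds: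
  assumes L: "lorentz L" and x: "norm x \<le> 1"
  shows "1 / (2 * L$1$1) \<le> (L *v lift x)$1" "(L *v lift x)$1 \<le> 2 * L$1$1"
proof -
  let ?a = "L$1$1" and ?u = "matrix_inv L *v e1"
  have a: "1 \<le> ?a" by (rule lorentz_11_ge_1[OF L])
  have u1: "?u$1 = ?a"
    using lorentz_e1(4)[OF lorentz_inv[OF L]] lorentz_inv_11[OF L] by simp
  have uu: "mink ?u ?u = -1" by (rule lorentz_e1(1)[OF lorentz_inv[OF L]])
  have c: "mink ?u (lift x) = - (L *v lift x)$1" by (simp add: lorentz_mink_inv[OF L])
  have "1 \<le> ?a * ?a" using a mult_mono[of 1 ?a 1 ?a] by simp
  then have "1 / (2 * ?a) \<le> ?a" using a by (simp add: divide_simps)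
  then have b: "1 / (2 * ?a) \<le> ?u$1" by (simp add: u1)
  have "mink (?u - b *\<^sub>R e1) (?u - b *\<^sub>R e1) = - 1 + 2 * (b * ?a) - b * b" for b
    by (simp add: mink_simps uu u1 algebra_simps)
  then have "mink (?u - (1 / (2 * ?a)) *\<^sub>R e1) (?u - (1 / (2 * ?a)) *\<^sub>R e1) = - (1 / (2 * ?a) * (1 / (2 * ?a)))"
    using a by simp
  also have "\<dots> \<le> 0" by simp
  finally have "future (?u - (1 / (2 * ?a)) *\<^sub>R e1)"
    using b by (simp add: future_def)
  from future_mink_nonpos[OF this future_lift[OF x]]
  show "1 / (2 * ?a) \<le> (L *v lift x)$1" by (simp add: mink_simps c)
  have "future ((2 * ?a) *\<^sub>R e1 - ?u)"
    using a u1 uu by (simp add: future_def mink_simps)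
  from future_mink_nonpos[OF this future_lift[OF x]]
  show "(L *v lift x)$1 \<le> 2 * ?a" by (simp add: mink_simps c)
qed

text \<open>Geodesic rays from two base points to the same ideal point are asymptotic once both base
  vectors are normalised to have the same product with the null vector: their difference is then
  orthogonal to it.\<close>
lemma asymptotic_rays:
  assumes L: "lorentz L" and x: "norm x = 1" and t: "0 \<le> t"
  defines "Z \<equiv> (1 / (L *v lift x)$1) *\<^sub>R (matrix_inv L *v e1)"
  defines "\<epsilon> \<equiv> (6 * (L$1$1)\<^sup>2 + 2) * exp (- t / 2)"
  shows "timelike Z"
    and "future w \<Longrightarrow> - mink (Z + exp t *\<^sub>R lift x) w \<le> (1 + \<epsilon>) * (- mink (e1 + exp t *\<^sub>R lift x) w)"
    and "future w \<Longrightarrow> - mink (e1 + exp t *\<^sub>R lift x) w \<le> (1 + \<epsilon>) * (- mink (Z + exp t *\<^sub>R lift x) w)"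
proof -
  let ?a = "L$1$1" and ?c = "(L *v lift x)$1" and ?N = "lift x" and ?u = "matrix_inv L *v e1"
  define V where "V = e1 - Z"
  \<comment> \<open>One bound for the time coordinate of V, for its form value from above, and for
    its pairings with both base vectors. The sizes come from a / c <= 2 a^2 and 1 / c^2 <= 4
    a^2.\<close>
  define B where "B = 6 * ?a\<^sup>2 + 1"
  have a: "1 \<le> ?a" by (rule lorentz_11_ge_1[OF L])
  have c: "1 / (2 * ?a) \<le> ?c" "?c \<le> 2 * ?a"
    using lorentz_factor_bounds[OF L, of x] x by auto
  have c0: "0 < ?c" using act_factor_pos[OF L, of x] x by simp
  have ic: "0 < 1 / ?c" "1 / ?c \<le> 2 * ?a" using c(1) c0 a by (auto simp: divide_simps mult.commute)
  show tZ: "timelike Z"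
    unfolding Z_def by (rule timelike_scale[OF timelike_lorentz_e1[OF lorentz_inv[OF L]] ic(1)])
  have NN: "mink ?N ?N = 0" using x by (simp add: mink_lift)
  have ZN: "mink Z ?N = -1" unfolding Z_def mink_simps using c0 by (simp add: lorentz_mink_inv[OF L])
  have Z1: "Z$1 = ?a / ?c"
    unfolding Z_def using lorentz_e1(4)[OF lorentz_inv[OF L]] lorentz_inv_11[OF L] by simp
  have ZZ: "mink Z Z = - (1 / ?c * (1 / ?c))"
    unfolding Z_def mink_simps lorentz_e1(1)[OF lorentz_inv[OF L]] by simp
  have ac: "0 \<le> ?a / ?c" "?a / ?c \<le> 2 * ?a\<^sup>2"
    using ic a c0 mult_left_mono[OF ic(2), of ?a] by (auto simp: power2_eq_square)
  have cc: "0 \<le> 1 / ?c * (1 / ?c)" "1 / ?c * (1 / ?c) \<le> 4 * ?a\<^sup>2"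
    using mult_mono[OF ic(2) ic(2)] ic(1) a by (auto simp: power2_eq_square)
  have a2: "0 \<le> ?a\<^sup>2" by simp
  have VN: "mink V ?N = 0" by (simp add: V_def mink_simps ZN)
  have "V$1 = 1 - ?a / ?c" by (simp add: V_def Z1)
  then have V1: "\<bar>V$1\<bar> \<le> B" using ac a2 unfolding B_def by linarith
  have "mink V V = - 1 + Z$1 + Z$1 + mink Z Z" by (simp add: V_def mink_simps)
  then have VV: "mink V V \<le> B"
    using ac cc a2 unfolding B_def ZZ Z1 by linarith
  have Ve: "\<bar>mink V e1\<bar> \<le> B" using V1 by simp
  have "mink V Z = - Z$1 - mink Z Z" by (simp add: V_def mink_simps)
  then have VZ: "\<bar>mink V Z\<bar> \<le> B"
    using ac cc a2 unfolding B_def ZZ Z1 by linarith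
  define u where "u = exp t"
  have u1: "1 \<le> u" using t by (simp add: u_def)
  have su: "sqrt u = exp (t / 2)"
    unfolding u_def by (rule real_sqrt_unique) (simp_all add: power2_eq_square flip: exp_add)
  have \<epsilon>: "\<epsilon> = (B + 1) / sqrt u"
    unfolding \<epsilon>_def B_def su divide_inverse[of _ "exp (t / 2)"] exp_minus[symmetric] by simp
  have key: "- mink (Y + u *\<^sub>R ?N) w * \<epsilon> \<ge> \<bar>mink V w\<bar>"
    if w: "future w" and Y: "mink Y ?N = -1" "mink Y Y \<le> 0" "0 \<le> Y$1" "\<bar>mink V Y\<bar> \<le> B" for Y w
  proof -
    let ?X = "Y + u *\<^sub>R ?N"
    have XX: "mink ?X ?X \<le> - 2 * u" using Y by (simp add: mink_simps mink_commute[of ?N Y] NN)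
    have X1: "u \<le> ?X$1" using Y by simp
    \<comment> \<open>Orthogonality of V to the null vector keeps this bounded while the form value
      of \<open>?X\<close> falls below -2 u; hence the relative difference decays like 1 / sqrt
      u.\<close>
    have VX: "\<bar>mink V ?X\<bar> \<le> B" using Y(4) by (simp add: mink_simps VN)
    have mV: "\<bar>mink (- V) ?X\<bar> \<le> B" "mink (- V) (- V) \<le> B" "\<bar>(- V)$1\<bar> \<le> B"
      using VX VV V1 by (simp_all add: mink_simps mink_commute[of V "- V"])
    have "mink (\<epsilon> *\<^sub>R ?X + V) w \<le> 0" "mink (\<epsilon> *\<^sub>R ?X + - V) w \<le> 0"
      unfolding \<epsilon>
      by (rule future_mink_nonpos[OF future_perturbation[OF u1 XX X1 VX VV V1] w],
          rule future_mink_nonpos[OF future_perturbation[OF u1 XX X1 mV] w])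
    then have "\<epsilon> * mink ?X w + mink V w \<le> 0" "\<epsilon> * mink ?X w - mink V w \<le> 0"
      by (simp_all only: mink_add_left mink_scale_left mink_minus_left)
    then show ?thesis by (simp add: abs_le_iff mult.commute)
  qed
  have diff: "mink (e1 + u *\<^sub>R ?N) w - mink (Z + u *\<^sub>R ?N) w = mink V w"
    by (simp add: V_def mink_simps)
  show "- mink (Z + exp t *\<^sub>R ?N) w \<le> (1 + \<epsilon>) * (- mink (e1 + exp t *\<^sub>R ?N) w)" if "future w"
  proof -
    have "\<bar>mink V w\<bar> \<le> - mink (e1 + u *\<^sub>R ?N) w * \<epsilon>"
      by (rule key[OF that]) (use Ve in simp_all)
    then show ?thesis using diff unfolding u_def by (simp add: algebra_simps abs_le_iff)
  qed
  show "- mink (e1 + exp t *\<^sub>R ?N) w \<le> (1 + \<epsilon>) * (- mink (Z + exp t *\<^sub>R ?N) w)" if "future w"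
  proof -
    have "\<bar>mink V w\<bar> \<le> - mink (Z + u *\<^sub>R ?N) w * \<epsilon>"
      by (rule key[OF that ZN]) (use tZ VZ in \<open>simp_all add: timelike_def\<close>)
    then show ?thesis using diff unfolding u_def by (simp add: algebra_simps abs_le_iff)
  qed
qed

lemma integral_exp_half_le:
  assumes "0 \<le> n"
  shows "(\<integral>t. indicator {0..n} t * exp (- t / 2) \<partial>lborel) \<le> (2::real)"
proof -
  have "(\<integral>t. indicator {0..n} t *\<^sub>R exp (- t / 2) \<partial>lborel) = (- 2 * exp (- n / 2)) - (- 2 * exp (- 0 / 2))"
  proof (rule integral_FTC_atLeastAtMost[OF assms, where F="\<lambda>t. - 2 * exp (- t / 2)"])
    show "((\<lambda>t. - 2 * exp (- t / 2)) has_vector_derivative exp (- x / 2)) (at x within {0..n})" for x :: real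
      unfolding has_real_derivative_iff_has_vector_derivative[symmetric]
      by (auto intro!: derivative_eq_intros)
  qed (auto intro!: continuous_intros)
  then show ?thesis by simp
qed

text \<open>The shift by \<theta> changes the window only near its two ends, inside intervals of
  length 2 |\<theta>| where the integrands are at most 1. On the overlap the exponential bound
  integrates to at most 2 K.\<close>

lemma shifted_average_diff_le:
  fixes A B :: "real \<Rightarrow> real"
  assumes [measurable]: "A \<in> borel_measurable borel" "B \<in> borel_measurable borel"
    and A: "\<And>t. 0 \<le> A t" "\<And>t. A t \<le> 1" and B: "\<And>t. 0 \<le> B t" "\<And>t. B t \<le> 1"
    and AB: "\<And>t. 0 \<le> t \<Longrightarrow> \<bar>A t - B t\<bar> \<le> K * exp (- t / 2)" and n: "0 \<le> n" and K: "0 \<le> K"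
  shows "\<bar>(\<integral>v. indicator {0..n} v * A (v - \<theta>) \<partial>lborel) - (\<integral>v. indicator {0..n} v * B v \<partial>lborel)\<bar>
    \<le> 4 * \<bar>\<theta>\<bar> + 2 * K"
proof -
  have "(\<integral>v. indicator {0..n} v * A (v - \<theta>) \<partial>lborel)
      = \<bar>1\<bar> *\<^sub>R (\<integral>t. indicator {0..n} (\<theta> + 1 * t) * A ((\<theta> + 1 * t) - \<theta>) \<partial>lborel)"
    by (rule lborel_integral_real_affine) simp
  also have "\<dots> = (\<integral>t. indicator {-\<theta>..n-\<theta>} t * A t \<partial>lborel)"
    by (auto simp: indicator_def intro!: Bochner_Integration.integral_cong)
  finally have shift: "(\<integral>v. indicator {0..n} v * A (v - \<theta>) \<partial>lborel) = (\<integral>t. indicator {-\<theta>..n-\<theta>} t * A t \<partial>lborel)" .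
  have int: "integrable lborel (\<lambda>t. indicator {a..b} t * f t)"
    if [measurable]: "f \<in> borel_measurable borel" and f: "\<And>t. 0 \<le> f t" "\<And>t. f t \<le> (1::real)" for f and a b :: real
  proof (rule Bochner_Integration.integrable_bound)
    show "integrable lborel (indicator {a..b} :: real \<Rightarrow> real)"
      by (intro integrable_real_indicator) (auto simp: emeasure_lborel_Icc_eq)
    show "AE t in lborel. norm (indicator {a..b} t * f t) \<le> norm (indicator {a..b} t :: real)"
      using f by (intro AE_I2) (auto simp: indicator_def)
  qed measurable
  have ind: "integrable lborel (indicator {a..b} :: real \<Rightarrow> real)" for a b :: real
    by (intro integrable_real_indicator) (auto simp: emeasure_lborel_Icc_eq)
  have ie: "integrable lborel (\<lambda>t. indicator {0..n} t * exp (- t / 2))"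
  proof -
    have "set_integrable lborel {0..n} (\<lambda>t::real. exp (- t / 2))"
      by (intro borel_integrable_atLeastAtMost' continuous_intros) simp
    then show ?thesis by (simp add: set_integrable_def)
  qed
  let ?D = "\<lambda>t. indicator {-\<bar>\<theta>\<bar>..\<bar>\<theta>\<bar>} t + indicator {n-\<bar>\<theta>\<bar>..n+\<bar>\<theta>\<bar>} t + K * (indicator {0..n} t * exp (- t / 2))"
  have pt: "\<bar>indicator {-\<theta>..n-\<theta>} t * A t - indicator {0..n} t * B t\<bar> \<le> ?D t" for t
  proof -
    have K': "0 \<le> K * (indicator {0..n} t * exp (- t / 2))" using K by simp
    have near: "1 \<le> (indicator {-\<bar>\<theta>\<bar>..\<bar>\<theta>\<bar>} t + indicator {n-\<bar>\<theta>\<bar>..n+\<bar>\<theta>\<bar>} t :: real)"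
      if "t \<in> {-\<bar>\<theta>\<bar>..\<bar>\<theta>\<bar>} \<or> t \<in> {n-\<bar>\<theta>\<bar>..n+\<bar>\<theta>\<bar>}"
      using that by (elim disjE) simp_all
    consider "t \<in> {-\<theta>..n-\<theta>}" "t \<in> {0..n}" | "t \<in> {-\<theta>..n-\<theta>}" "t \<notin> {0..n}"
      | "t \<notin> {-\<theta>..n-\<theta>}" "t \<in> {0..n}" | "t \<notin> {-\<theta>..n-\<theta>}" "t \<notin> {0..n}" by blast
    then show ?thesis
    proof cases
      case 1
      then show ?thesis using AB[of t] by (simp add: add_nonneg_nonneg add_increasing)
    next
      case 2
      then have "t \<in> {-\<bar>\<theta>\<bar>..\<bar>\<theta>\<bar>} \<or> t \<in> {n-\<bar>\<theta>\<bar>..n+\<bar>\<theta>\<bar>}" by auto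
      note near[OF this]
      moreover have "\<bar>indicator {-\<theta>..n-\<theta>} t * A t - indicator {0..n} t * B t\<bar> \<le> 1"
        using 2 A[of t] by simp
      ultimately show ?thesis using K' by linarith
    next
      case 3
      then have "t \<in> {-\<bar>\<theta>\<bar>..\<bar>\<theta>\<bar>} \<or> t \<in> {n-\<bar>\<theta>\<bar>..n+\<bar>\<theta>\<bar>}" by auto
      note near[OF this]
      moreover have "\<bar>indicator {-\<theta>..n-\<theta>} t * A t - indicator {0..n} t * B t\<bar> \<le> 1"
        using 3 B[of t] by simp
      ultimately show ?thesis using K' by linarith
    next
      case 4
      then show ?thesis by simp
    qed
  qed
  have "\<bar>(\<integral>t. indicator {-\<theta>..n-\<theta>} t * A t \<partial>lborel) - (\<integral>v. indicator {0..n} v * B v \<partial>lborel)\<bar>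
      = \<bar>\<integral>t. indicator {-\<theta>..n-\<theta>} t * A t - indicator {0..n} t * B t \<partial>lborel\<bar>"
    by (subst Bochner_Integration.integral_diff) (auto intro!: int A B)
  also have "\<dots> \<le> (\<integral>t. \<bar>indicator {-\<theta>..n-\<theta>} t * A t - indicator {0..n} t * B t\<bar> \<partial>lborel)"
    by (rule integral_abs_bound)
  also have "\<dots> \<le> (\<integral>t. ?D t \<partial>lborel)"
    by (intro integral_mono pt integrable_abs Bochner_Integration.integrable_diff
        Bochner_Integration.integrable_add integrable_mult_right int A B ind ie) auto
  also have "\<dots> = (\<integral>t. indicator {-\<bar>\<theta>\<bar>..\<bar>\<theta>\<bar>} t \<partial>lborel) + (\<integral>t. indicator {n-\<bar>\<theta>\<bar>..n+\<bar>\<theta>\<bar>} t \<partial>lborel)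
      + K * (\<integral>t. indicator {0..n} t * exp (- t / 2) \<partial>lborel)"
    using ind ie by (simp add: Bochner_Integration.integral_add Bochner_Integration.integrable_add integrable_mult_right)
  also have "\<dots> \<le> 2 * \<bar>\<theta>\<bar> + 2 * \<bar>\<theta>\<bar> + K * 2"
    using mult_left_mono[OF integral_exp_half_le[OF n] K] by simp
  finally show ?thesis unfolding shift by simp
qed

context free_kleinian
begin

text \<open>The average of the orbit probabilities along the geodesic ray from the centre of the ball to
  \<open>\<zeta>\<close>; up to a bounded error \<open>v\<close> is twice the arc length.\<close>
definition ray_mean :: "real \<Rightarrow> letter list \<Rightarrow> real^3 \<Rightarrow> letter list set \<Rightarrow> real" where
  "ray_mean n h \<zeta> C = (\<integral>v. indicator {0..n} v * orbit_prob h (e1 + exp v *\<^sub>R lift \<zeta>) C \<partial>lborel) / n"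

text \<open>Pulled back by \<open>g\<close>, the ray to \<open>act (ev g) \<zeta>\<close> becomes a
  ray from another base point to \<zeta>, with its parameter shifted. The total discrepancy is
  bounded, so division by the length makes it small.\<close>

lemma ray_mean_almost_equivariant:
  "\<exists>K. \<forall>n>0. \<forall>h. \<forall>\<zeta>\<in>sphere 0 1. \<forall>D. D \<subseteq> W \<longrightarrow>
    \<bar>ray_mean n h (act (ev g) \<zeta>) D - ray_mean n h \<zeta> {w \<in> W. reduce (g @ w) \<in> D}\<bar> \<le> K / n"
proof -
  let ?L = "ev g" and ?a = "ev g$1$1"
  define K where "K = 2 ^ 68 * (6 * ?a\<^sup>2 + 2)"
  have L: "lorentz ?L" by (rule lorentz_ev)
  have a1: "1 \<le> ?a" by (rule lorentz_11_ge_1[OF L])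
  have K0: "0 \<le> K" by (simp add: K_def)
  have "\<bar>ray_mean n h (act ?L \<zeta>) D - ray_mean n h \<zeta> {w \<in> W. reduce (g @ w) \<in> D}\<bar> \<le> (8 * ln (2 * ?a) + 2 * K) / n"
    if n: "0 < n" and \<zeta>: "\<zeta> \<in> sphere 0 1" and D: "D \<subseteq> W" for n h \<zeta> D
  proof -
    let ?N = "lift \<zeta>" and ?C = "{w \<in> W. reduce (g @ w) \<in> D}"
    define c where "c = (?L *v ?N)$1"
    define Z where "Z = (1 / c) *\<^sub>R (matrix_inv ?L *v e1)"
    \<comment> \<open>exp \<theta> = c^2: one factor c comes from normalising the base vector Z, the
      other from normalising the image of the null vector.\<close>
    define \<theta> where "\<theta> = 2 * ln c"
    have nz: "norm \<zeta> = 1" using \<zeta> by simp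
    have c0: "0 < c" unfolding c_def using act_factor_pos[OF L, of \<zeta>] nz by simp
    have c: "1 / (2 * ?a) \<le> c" "c \<le> 2 * ?a"
      using lorentz_factor_bounds[OF L, of \<zeta>] nz by (simp_all add: c_def)
    \<comment> \<open>The bounds on c are uniform in \<zeta>, and hence so is the bound on the
      shift.\<close>
    have "ln c \<le> ln (2 * ?a)" using c0 c(2) a1 by simp
    moreover have "ln (1 / (2 * ?a)) \<le> ln c" using c0 c(1) a1 by simp
    then have "- ln (2 * ?a) \<le> ln c" using a1 by (simp add: ln_div)
    ultimately have \<theta>: "\<bar>\<theta>\<bar> \<le> 2 * ln (2 * ?a)" unfolding \<theta>_def by (simp add: abs_le_iff)
    have PN: "orbit_prob h (e1 + exp v *\<^sub>R lift (act ?L \<zeta>)) D = orbit_prob h (Z + exp (v - \<theta>) *\<^sub>R ?N) ?C" for v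
    proof -
      have "exp \<theta> = c * c" unfolding \<theta>_def using c0 by (simp add: exp_double power2_eq_square)
      then have ex: "c * exp (v - \<theta>) = exp v / c" using c0 by (simp add: exp_diff)
      have "?L *v (c *\<^sub>R (Z + exp (v - \<theta>) *\<^sub>R ?N)) = ?L *v (matrix_inv ?L *v e1 + (exp v / c) *\<^sub>R ?N)"
        unfolding Z_def scaleR_add_right scaleR_scaleR ex using c0 by simp
      also have "\<dots> = e1 + (exp v / c) *\<^sub>R (?L *v ?N)"
        by (simp add: matrix_vector_right_distrib matrix_vector_mult_scaleR lorentz_matrix_inv[OF L])
      also have "\<dots> = e1 + exp v *\<^sub>R lift (act ?L \<zeta>)"
        using lift_act[OF L, of \<zeta>] nz by (simp add: c_def)
      finally have "orbit_prob h (e1 + exp v *\<^sub>R lift (act ?L \<zeta>)) D = orbit_prob h (?L *v (c *\<^sub>R (Z + exp (v - \<theta>) *\<^sub>R ?N))) D"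
        by simp
      also have "\<dots> = orbit_prob h (c *\<^sub>R (Z + exp (v - \<theta>) *\<^sub>R ?N)) ?C" by (rule orbit_prob_translate[OF D])
      also have "\<dots> = orbit_prob h (Z + exp (v - \<theta>) *\<^sub>R ?N) ?C" by (rule orbit_prob_scale[OF c0])
      finally show ?thesis .
    qed
    have fN: "future ?N" using nz by (intro future_lift) simp
    have diff: "\<bar>orbit_prob h (Z + exp t *\<^sub>R ?N) ?C - orbit_prob h (e1 + exp t *\<^sub>R ?N) ?C\<bar> \<le> K * exp (- t / 2)" if t: "0 \<le> t" for t
    proof -
      let ?\<epsilon> = "(6 * ?a\<^sup>2 + 2) * exp (- t / 2)"
      note rays = asymptotic_rays[OF L nz t, folded c_def, folded Z_def]
      have tl: "timelike (Z + exp t *\<^sub>R ?N)" "timelike (e1 + exp t *\<^sub>R ?N)"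
        by (intro timelike_add_future rays(1) timelike_e1 fN; simp)+
      have e0: "0 \<le> ?\<epsilon>" by simp
      have C: "?C \<subseteq> W" by blast
      have "orbit_prob h (Z + exp t *\<^sub>R ?N) ?C \<le> orbit_prob h (e1 + exp t *\<^sub>R ?N) ?C + 2 ^ 68 * ?\<epsilon>"
        by (rule orbit_prob_Harnack[OF tl e0 C rays(3,2)])
      moreover have "orbit_prob h (e1 + exp t *\<^sub>R ?N) ?C \<le> orbit_prob h (Z + exp t *\<^sub>R ?N) ?C + 2 ^ 68 * ?\<epsilon>"
        by (rule orbit_prob_Harnack[OF tl(2,1) e0 C rays(2,3)])
      moreover have "2 ^ 68 * ?\<epsilon> = K * exp (- t / 2)" unfolding K_def by (simp only: mult.assoc)
      ultimately show ?thesis by (simp only: abs_le_iff) linarith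
    qed
    have [measurable]: "(\<lambda>t. orbit_prob h (Y + exp t *\<^sub>R ?N) ?C) \<in> borel_measurable borel" for Y
      by (rule measurable_compose[OF _ borel_measurable_orbit_prob]) measurable
    have "\<bar>(\<integral>v. indicator {0..n} v * orbit_prob h (Z + exp (v - \<theta>) *\<^sub>R ?N) ?C \<partial>lborel)
        - (\<integral>v. indicator {0..n} v * orbit_prob h (e1 + exp v *\<^sub>R ?N) ?C \<partial>lborel)\<bar> \<le> 4 * \<bar>\<theta>\<bar> + 2 * K"
      by (rule shifted_average_diff_le[where A="\<lambda>t. orbit_prob h (Z + exp t *\<^sub>R ?N) ?C" and B="\<lambda>t. orbit_prob h (e1 + exp t *\<^sub>R ?N) ?C"])
        (use n K0 diff in \<open>simp_all add: orbit_prob_nonneg orbit_prob_le_1\<close>)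
    also have "\<dots> \<le> 8 * ln (2 * ?a) + 2 * K" using \<theta> by simp
    finally show ?thesis
      unfolding ray_mean_def PN diff_divide_distrib[symmetric] using n by (simp add: abs_divide divide_right_mono)
  qed
  then show ?thesis by blast
qed

lemma integrable_ray_mean:
  "integrable lborel (\<lambda>v. indicator {0..n} v * orbit_prob h (e1 + exp v *\<^sub>R lift \<zeta>) C)"
proof (rule Bochner_Integration.integrable_bound)
  show "integrable lborel (indicator {0..n} :: real \<Rightarrow> real)"
    by (intro integrable_real_indicator) (auto simp: emeasure_lborel_Icc_eq)
  show "AE v in lborel. norm (indicator {0..n} v * orbit_prob h (e1 + exp v *\<^sub>R lift \<zeta>) C) \<le> norm (indicator {0..n} v :: real)"
    using orbit_prob_nonneg orbit_prob_le_1 by (intro AE_I2) (auto simp: indicator_def)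
  have [measurable]: "(\<lambda>v. orbit_prob h (e1 + exp v *\<^sub>R lift \<zeta>) C) \<in> borel_measurable borel"
    by (rule measurable_compose[OF _ borel_measurable_orbit_prob]) measurable
  show "(\<lambda>v. indicator {0..n} v * orbit_prob h (e1 + exp v *\<^sub>R lift \<zeta>) C) \<in> borel_measurable lborel"
    by measurable
qed

lemma timelike_ray:
  assumes "\<zeta> \<in> sphere 0 1"
  shows "timelike (e1 + exp v *\<^sub>R lift \<zeta>)"
  by (rule timelike_add_future[OF timelike_e1 future_lift]) (use assms in simp_all)

lemma ray_mean_nonneg: "0 < n \<Longrightarrow> 0 \<le> ray_mean n h \<zeta> C"
  unfolding ray_mean_def using orbit_prob_nonneg by (intro divide_nonneg_pos integral_nonneg) auto

lemma ray_mean_Un: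
  assumes "\<zeta> \<in> sphere 0 1" "A \<subseteq> W" "B \<subseteq> W" "A \<inter> B = {}"
  shows "ray_mean n h \<zeta> (A \<union> B) = ray_mean n h \<zeta> A + ray_mean n h \<zeta> B"
  unfolding ray_mean_def orbit_prob_Un[OF timelike_ray[OF assms(1)] assms(2-4)] distrib_left
    Bochner_Integration.integral_add[OF integrable_ray_mean integrable_ray_mean] add_divide_distrib ..

lemma ray_mean_empty: "ray_mean n h \<zeta> {} = 0"
  by (simp add: ray_mean_def orbit_prob_def)

lemma ray_mean_UN:
  assumes "\<zeta> \<in> sphere 0 1" "finite I" "\<And>i. i \<in> I \<Longrightarrow> A i \<subseteq> W" "disjoint_family_on A I"
  shows "ray_mean n h \<zeta> (\<Union>i\<in>I. A i) = (\<Sum>i\<in>I. ray_mean n h \<zeta> (A i))"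
  using assms(2-4)
proof (induction I)
  case (insert i I)
  have "ray_mean n h \<zeta> (A i \<union> (\<Union>j\<in>I. A j)) = ray_mean n h \<zeta> (A i) + ray_mean n h \<zeta> (\<Union>j\<in>I. A j)"
    using insert by (intro ray_mean_Un assms(1)) (fastforce simp: disjoint_family_on_def)+
  then show ?case using insert by (simp add: disjoint_family_on_def)
qed (simp add: ray_mean_empty)

lemma ray_mean_W:
  assumes "0 < n" "\<zeta> \<in> sphere 0 1"
  shows "ray_mean n h \<zeta> W = 1"
  unfolding ray_mean_def orbit_prob_W[OF timelike_ray[OF assms(2)]] using assms(1) by simp

lemma ray_mean_le_1:
  assumes "0 < n" "\<zeta> \<in> sphere 0 1" "C \<subseteq> W"
  shows "ray_mean n h \<zeta> C \<le> 1"
  using ray_mean_Un[of \<zeta> C "W - C" n h] ray_mean_W[OF assms(1,2), of h] ray_mean_nonneg[OF assms(1), of h \<zeta> "W - C"] assms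
  by (simp add: Un_absorb1)

lemma borel_measurable_ray_mean [measurable]: "(\<lambda>\<zeta>. ray_mean n h \<zeta> C) \<in> borel_measurable borel"
proof -
  have [measurable]: "(\<lambda>p. orbit_prob h (e1 + exp (snd p) *\<^sub>R lift (fst p)) C) \<in> borel_measurable (borel \<Otimes>\<^sub>M lborel)"
    by (rule measurable_compose[OF _ borel_measurable_orbit_prob]) measurable
  have "(\<lambda>(\<zeta>, v). indicator {0..n} v * orbit_prob h (e1 + exp v *\<^sub>R lift \<zeta>) C) \<in> borel_measurable (borel \<Otimes>\<^sub>M lborel)"
    unfolding case_prod_beta by measurable
  then have "(\<lambda>\<zeta>. \<integral>v. indicator {0..n} v * orbit_prob h (e1 + exp v *\<^sub>R lift \<zeta>) C \<partial>lborel) \<in> borel_measurable borel"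
    by (rule lborel.borel_measurable_lebesgue_integral)
  then show ?thesis unfolding ray_mean_def by measurable
qed

end

section \<open>The area measures\<close>

text \<open>Coordinates as quotients of affine functions, from which measurability and
  differentiability can be read off.\<close>

lemma act_eq:
  "act L z =
    ((L$2$1 + L$2$2 * z$1 + L$2$3 * z$2 + L$2$4 * z$3) / (L$1$1 + L$1$2 * z$1 + L$1$3 * z$2 + L$1$4 * z$3)) *\<^sub>R axis 1 1
  + ((L$3$1 + L$3$2 * z$1 + L$3$3 * z$2 + L$3$4 * z$3) / (L$1$1 + L$1$2 * z$1 + L$1$3 * z$2 + L$1$4 * z$3)) *\<^sub>R axis 2 1
  + ((L$4$1 + L$4$2 * z$1 + L$4$3 * z$2 + L$4$4 * z$3) / (L$1$1 + L$1$2 * z$1 + L$1$3 * z$2 + L$1$4 * z$3)) *\<^sub>R axis 3 1"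
  unfolding vec_eq_iff forall_3
  by (simp add: act_def proj_def matrix_vector_mult_def sum_4 axis_def)

lemma borel_measurable_act [measurable]: "act L \<in> borel_measurable borel"
  unfolding act_eq[abs_def] by measurable

lemma differentiable_vec_nth [simp]: "(\<lambda>x::real^'n. x$i) differentiable F"
  by (rule bounded_linear_imp_differentiable) (rule bounded_linear_vec_nth)

lemma differentiable_act:
  assumes "lorentz L" "norm z \<le> 1"
  shows "act L differentiable (at z)"
proof -
  have "L$1$1 + L$1$2 * z$1 + L$1$3 * z$2 + L$1$4 * z$3 \<noteq> 0"
    using act_factor_pos[OF assms] by (simp add: matrix_vector_mult_def sum_4)
  then show ?thesis
    unfolding act_eq[abs_def]
    by (intro differentiable_add differentiable_scaleR differentiable_divide differentiable_mult
        differentiable_const differentiable_vec_nth)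
qed

section \<open>The round measure at the centre and its null sets\<close>

lemma space_S_inf: "space S_inf = sphere 0 1"
  by (simp add: S_inf_def space_restrict_space)

lemma measurable_act_S_inf: "lorentz L \<Longrightarrow> act L \<in> S_inf \<rightarrow>\<^sub>M S_inf"
  unfolding S_inf_def
  by (intro measurable_restrict_space2 measurable_restrict_space1 borel_measurable_act)
    (use act_in_sphere in \<open>auto simp: space_restrict_space\<close>)

lemma radial_in_sphere: "radial x \<in> sphere 0 1"
  by (simp add: radial_def)

lemma measurable_radial: "radial \<in> borel \<rightarrow>\<^sub>M S_inf"
  unfolding S_inf_def
proof (rule measurable_restrict_space2)
  show "radial \<in> borel_measurable borel" unfolding radial_def[abs_def] by measurable
qed (use radial_in_sphere in auto)

lemma emeasure_ball_0_1: "emeasure lborel (ball (0::real^3) 1) \<noteq> 0" "emeasure lborel (ball (0::real^3) 1) \<noteq> \<infinity>"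
proof -
  show "emeasure lborel (ball (0::real^3) 1) \<noteq> \<infinity>"
    using emeasure_bounded_finite[OF bounded_ball, of "0::real^3" 1] by simp
  show "emeasure lborel (ball (0::real^3) 1) \<noteq> 0"
    using content_ball_pos[of 1 "0::real^3"] by (auto simp: measure_def)
qed

lemma sets_A0: "sets A0 = sets S_inf" and space_A0: "space A0 = sphere 0 1"
  by (simp_all add: A0_def space_S_inf)

lemma emeasure_A0:
  assumes "E \<in> sets S_inf"
  shows "emeasure A0 E = emeasure lborel (ball 0 1 \<inter> radial -` E) / emeasure lborel (ball (0::real^3) 1)"
proof -
  have *: "radial -` E \<in> sets borel"
    using measurable_sets[OF measurable_radial assms] by simp
  have "emeasure A0 E = emeasure (uniform_measure lborel (ball 0 1)) (radial -` E)"
    unfolding A0_def using assms measurable_radial by (subst emeasure_distr) auto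
  also have "\<dots> = emeasure lborel (ball 0 1 \<inter> radial -` E) / emeasure lborel (ball (0::real^3) 1)"
    using * by (intro emeasure_uniform_measure) auto
  finally show ?thesis .
qed

lemma emeasure_A0_sphere: "emeasure A0 (sphere 0 1) = 1"
proof -
  have S: "sphere 0 1 \<in> sets S_inf" using sets.top[of S_inf] by (simp add: space_S_inf)
  have "radial -` sphere 0 1 = UNIV" using radial_in_sphere by blast
  then show ?thesis
    unfolding emeasure_A0[OF S] using emeasure_ball_0_1
    by (simp add: ennreal_divide_self less_top[symmetric])
qed

text \<open>Null sets of the round measure are the sets spanning a null cone, and the 1-homogeneous extension
  of a Lorentz transformation to the cone is differentiable away from the apex.\<close>
lemma A0_null_act:
  assumes h: "lorentz h" and E: "E \<in> sets S_inf" and null: "emeasure A0 E = 0"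
  shows "emeasure A0 (act h -` E \<inter> sphere 0 1) = 0"
proof -
  \<comment> \<open>The preimage under \<open>h\<close> is treated as an image under the inverse,
    since differentiable maps send negligible sets to negligible sets.\<close>
  let ?L = "matrix_inv h" and ?E' = "act h -` E \<inter> sphere 0 1"
  have L: "lorentz ?L" by (rule lorentz_inv[OF h])
  have E': "?E' \<in> sets S_inf"
    using measurable_sets[OF measurable_act_S_inf[OF h] E] by (simp add: space_S_inf)
  define K where "K = ball 0 1 \<inter> radial -` E"
  define K' where "K' = ball 0 1 \<inter> radial -` ?E'"
  define \<Theta> where "\<Theta> x = norm x *\<^sub>R act ?L (x /\<^sub>R norm x)" for x :: "real^3"
  have borel: "K \<in> sets borel" "K' \<in> sets borel"
    using measurable_sets[OF measurable_radial E] measurable_sets[OF measurable_radial E']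
    unfolding K_def K'_def by auto
  have "emeasure lborel K = 0"
    using null emeasure_ball_0_1 unfolding emeasure_A0[OF E] K_def by (simp add: ennreal_divide_eq_0_iff)
  then have "K \<in> null_sets lborel" using borel by (intro null_setsI) auto
  then have "negligible K" by (simp add: negligible_iff_null_sets null_sets_completionI)
  then have "negligible (K - {0})" by (rule negligible_subset) blast
  \<comment> \<open>The apex is removed because the norm is not differentiable there.\<close>
  moreover have "\<Theta> differentiable_on (K - {0})"
    unfolding differentiable_on_def
  proof
    fix x assume x: "x \<in> K - {0}"
    then have x0: "x \<noteq> 0" by blast
    have n: "norm differentiable (at x)" using x0 by (rule differentiable_norm_at)
    have "(\<lambda>x. x /\<^sub>R norm x) differentiable (at x)"
      using n x0 by (intro differentiable_scaleR differentiable_inverse differentiable_ident) auto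
    moreover have "act ?L differentiable (at (x /\<^sub>R norm x))"
      by (rule differentiable_act[OF L]) (use x0 in simp)
    ultimately have "(act ?L \<circ> (\<lambda>x. x /\<^sub>R norm x)) differentiable (at x)"
      by (rule differentiable_chain_at)
    then have "\<Theta> differentiable (at x)"
      unfolding \<Theta>_def[abs_def] by (intro differentiable_scaleR n) (simp add: o_def)
    then show "\<Theta> differentiable (at x within K - {0})" by (rule differentiable_at_withinI)
  qed
  ultimately have "negligible (\<Theta> ` (K - {0}))"
    by (intro negligible_differentiable_image_negligible) simp_all
  then have "negligible (insert 0 (\<Theta> ` (K - {0})))" by (simp add: negligible_insert)
  \<comment> \<open>The point 0 is added because \<open>radial\<close> sends it to a default point
    of the sphere, which may belong to the set.\<close>
  moreover have "K' \<subseteq> insert 0 (\<Theta> ` (K - {0}))"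
  proof
    fix y assume y: "y \<in> K'"
    show "y \<in> insert 0 (\<Theta> ` (K - {0}))"
    proof (cases "y = 0")
      case False
      define \<zeta> where "\<zeta> = y /\<^sub>R norm y"
      have \<zeta>: "\<zeta> \<in> sphere 0 1" using False by (simp add: \<zeta>_def)
      have "radial y = \<zeta>" using False by (simp add: radial_def \<zeta>_def)
      then have aE: "act h \<zeta> \<in> E" and ny: "norm y < 1" using y by (auto simp: K'_def)
      define x where "x = norm y *\<^sub>R act h \<zeta>"
      have n1: "norm (act h \<zeta>) = 1" using act_in_sphere[OF h \<zeta>] by simp
      have nx: "norm x = norm y" by (simp add: x_def n1)
      have x0: "x \<noteq> 0" using nx False by auto
      have xn: "x /\<^sub>R norm x = act h \<zeta>" unfolding nx using False by (simp add: x_def)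
      have "x \<in> K" using nx ny aE x0 xn by (simp add: K_def radial_def)
      moreover have "\<Theta> x = y"
        unfolding \<Theta>_def xn unfolding nx using act_inv_act[OF h, of \<zeta>] \<zeta> False by (simp add: \<zeta>_def)
      ultimately show ?thesis using x0 by blast
    qed simp
  qed
  ultimately have "negligible K'" by (rule negligible_subset)
  then have "emeasure lebesgue K' = 0" by (simp add: negligible_iff_null_sets null_setsD1)
  then have "emeasure lborel K' = 0" using borel by simp
  then show ?thesis unfolding emeasure_A0[OF E'] K'_def[symmetric] by simp
qed

section \<open>Area measures at a general base point and their Jacobians\<close>

lemma area_at_eq:
  assumes "z0 \<in> H3"
  obtains g where "lorentz g" "area_at z0 = distr A0 S_inf (act g)"
proof -
  define g where "g = (SOME g. lorentz g \<and> act g 0 = z0)"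
  have "\<exists>g. lorentz g \<and> act g 0 = z0"
    using lorentz_transitive[of z0] assms by (auto simp: H3_def)
  then have "lorentz g \<and> act g 0 = z0" unfolding g_def by (rule someI_ex)
  then show ?thesis by (intro that[of g]) (auto simp: area_at_def g_def)
qed

lemma sets_area_at: "sets (area_at z0) = sets S_inf" and space_area_at: "space (area_at z0) = sphere 0 1"
  by (simp_all add: area_at_def space_S_inf)

lemma emeasure_area_at_sphere:
  assumes "z0 \<in> H3"
  shows "emeasure (area_at z0) (sphere 0 1) = 1"
proof -
  obtain g where g: "lorentz g" "area_at z0 = distr A0 S_inf (act g)" by (rule area_at_eq[OF assms])
  have m: "act g \<in> A0 \<rightarrow>\<^sub>M S_inf"
    using measurable_act_S_inf[OF g(1)] by (simp cong: measurable_cong_sets add: sets_A0)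
  have S: "sphere 0 1 \<in> sets S_inf" using sets.top[of S_inf] by (simp add: space_S_inf)
  have "act g -` sphere 0 1 \<inter> space A0 = sphere 0 1"
    using act_in_sphere[OF g(1)] unfolding space_A0 by blast
  then show ?thesis
    unfolding g(2) emeasure_distr[OF m S] by (simp add: emeasure_A0_sphere)
qed

lemma finite_measure_area_at:
  assumes "z0 \<in> H3"
  shows "finite_measure (area_at z0)"
  by (rule finite_measureI) (simp add: space_area_at emeasure_area_at_sphere[OF assms])

lemma measurable_act_area_at: "lorentz L \<Longrightarrow> act L \<in> area_at z0 \<rightarrow>\<^sub>M S_inf"
  using measurable_act_S_inf[of L] by (simp cong: measurable_cong_sets add: sets_area_at)

text \<open>Conjugating L by the isometry that defines the area measure reduces the claim to the
  round measure at the centre.\<close>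

lemma area_at_quasi_invariant:
  assumes z0: "z0 \<in> H3" and L: "lorentz L"
  shows "absolutely_continuous (area_at z0) (distr (area_at z0) S_inf (act L))"
  unfolding absolutely_continuous_def
proof
  obtain g where g: "lorentz g" "area_at z0 = distr A0 S_inf (act g)" by (rule area_at_eq[OF z0])
  have m: "act g \<in> A0 \<rightarrow>\<^sub>M S_inf"
    using measurable_act_S_inf[OF g(1)] by (simp cong: measurable_cong_sets add: sets_A0)
  have em: "emeasure (area_at z0) E = emeasure A0 (act g -` E \<inter> sphere 0 1)" if "E \<in> sets S_inf" for E
    unfolding g(2) emeasure_distr[OF m that] space_A0 ..
  fix E assume "E \<in> null_sets (area_at z0)"
  then have E: "E \<in> sets S_inf" and E0: "emeasure (area_at z0) E = 0" by (auto simp: sets_area_at)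
  let ?E1 = "act g -` E \<inter> sphere 0 1" and ?E2 = "act L -` E \<inter> sphere 0 1"
  have E1: "?E1 \<in> sets S_inf" and E2: "?E2 \<in> sets S_inf"
    using measurable_sets[OF measurable_act_S_inf[OF g(1)] E] measurable_sets[OF measurable_act_S_inf[OF L] E]
    by (simp_all add: space_S_inf)
  define k where "k = matrix_inv g ** L ** g"
  have k: "lorentz k" unfolding k_def by (intro lorentz_mult lorentz_inv g(1) L)
  have gk: "act g (act k \<zeta>) = act L (act g \<zeta>)" if "\<zeta> \<in> sphere 0 1" for \<zeta>
  proof -
    have \<zeta>: "norm \<zeta> \<le> 1" using that by simp
    have "act g (act k \<zeta>) = act (g ** k) \<zeta>" by (rule act_mult[OF k \<zeta>, symmetric])
    also have "g ** k = L ** g"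
      unfolding k_def by (simp only: matrix_mul_assoc lorentz_matrix_inv[OF g(1)] matrix_mul_lid)
    also have "act (L ** g) \<zeta> = act L (act g \<zeta>)" by (rule act_mult[OF g(1) \<zeta>])
    finally show ?thesis .
  qed
  have "act g -` ?E2 \<inter> sphere 0 1 = act k -` ?E1 \<inter> sphere 0 1"
    using gk act_in_sphere[OF g(1)] act_in_sphere[OF k] by auto
  then have "emeasure (area_at z0) ?E2 = emeasure A0 (act k -` ?E1 \<inter> sphere 0 1)"
    unfolding em[OF E2] by simp
  also have "\<dots> = 0" by (rule A0_null_act[OF k E1]) (use em[OF E] E0 in simp)
  finally have "emeasure (distr (area_at z0) S_inf (act L)) E = 0"
    unfolding emeasure_distr[OF measurable_act_area_at[OF L] E] space_area_at .
  then show "E \<in> null_sets (distr (area_at z0) S_inf (act L))" using E by (intro null_setsI) auto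
qed

text \<open>Quasi-invariance makes \<open>lam2\<close> a genuine density of the push-forward under
  the inverse. Integrals against the Jacobian thus become integrals of values at translated
  points.\<close>

lemma nn_integral_lam2:
  assumes z0: "z0 \<in> H3" and L: "lorentz L" and f: "f \<in> borel_measurable S_inf"
  shows "(\<integral>\<^sup>+\<zeta>. lam2 L z0 \<zeta> * f \<zeta> \<partial>area_at z0) = (\<integral>\<^sup>+\<zeta>. f (act (matrix_inv L) \<zeta>) \<partial>area_at z0)"
proof -
  interpret finite_measure "area_at z0" by (rule finite_measure_area_at[OF z0])
  let ?N = "distr (area_at z0) S_inf (act (matrix_inv L))"
  have d: "density (area_at z0) (lam2 L z0) = ?N"
    unfolding lam2_def
    by (rule density_RN_deriv[OF area_at_quasi_invariant[OF z0 lorentz_inv[OF L]]]) (simp add: sets_area_at)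
  have fm: "f \<in> borel_measurable (area_at z0)"
    using f by (simp cong: measurable_cong_sets add: sets_area_at)
  have lm: "lam2 L z0 \<in> borel_measurable (area_at z0)" by (simp add: lam2_def)
  have "(\<integral>\<^sup>+\<zeta>. lam2 L z0 \<zeta> * f \<zeta> \<partial>area_at z0) = (\<integral>\<^sup>+\<zeta>. f \<zeta> \<partial>?N)"
    unfolding d[symmetric] by (rule nn_integral_density[OF lm fm, symmetric])
  also have "\<dots> = (\<integral>\<^sup>+\<zeta>. f (act (matrix_inv L) \<zeta>) \<partial>area_at z0)"
    by (rule nn_integral_distr[OF measurable_act_area_at[OF lorentz_inv[OF L]]]) (use f in simp)
  finally show ?thesis .
qed

section \<open>The decomposition\<close>

lemma finite_short_words: "finite {w :: letter list. length w \<le> k}"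
  using finite_lists_length_le[OF finite_letters, of k] by simp

lemma finite_Psi: "finite (Psi k)"
  by (rule finite_subset[OF _ finite_short_words[of k]]) (auto simp: Psi_def)

lemma S_rel_subset: "S_rel k g \<psi> \<subseteq> Psi k"
  by (auto simp: S_rel_def)

context free_kleinian
begin

definition cyl :: "letter list \<Rightarrow> letter list set" where
  "cyl \<psi> = {w \<in> W. prefix \<psi> w}"

text \<open>These words lie in no cylinder of level k; their mass is the error term in the
  identities below.\<close>

definition short :: "nat \<Rightarrow> letter list set" where
  "short k = {w \<in> W. length w < k}"

lemma finite_short: "finite (short k)"
  by (rule finite_subset[OF _ finite_short_words[of k]]) (auto simp: short_def)

lemma cyl_iff:
  assumes "\<psi> \<in> Psi k"
  shows "w \<in> cyl \<psi> \<longleftrightarrow> reduced w \<and> k \<le> length w \<and> take k w = \<psi>"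
  using assms by (auto simp: cyl_def Psi_def prefix_def)
    (metis append_take_drop_id)

lemma disjoint_cyl: "disjoint_family_on cyl (Psi k)"
  unfolding disjoint_family_on_def
proof (intro ballI impI)
  fix a b assume "a \<in> Psi k" "b \<in> Psi k" "a \<noteq> b"
  then show "cyl a \<inter> cyl b = {}" using cyl_iff[of a k] cyl_iff[of b k] by auto
qed

lemma take_in_Psi: "reduced w \<Longrightarrow> k \<le> length w \<Longrightarrow> take k w \<in> Psi k"
  using reduced_append[of "take k w" "drop k w"] by (simp add: Psi_def)

lemma W_eq: "W = short k \<union> (\<Union>\<psi>\<in>Psi k. cyl \<psi>)"
proof -
  have "w \<in> short k \<union> (\<Union>\<psi>\<in>Psi k. cyl \<psi>)" if "reduced w" for w
    using that take_in_Psi[of w k] cyl_iff[of "take k w" k w]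
    by (cases "length w < k") (auto simp: short_def not_less)
  then show ?thesis by (auto simp: short_def cyl_def)
qed

lemma sum_ray_mean_cyl:
  assumes "0 < n" "\<zeta> \<in> sphere 0 1"
  shows "(\<Sum>\<psi>\<in>Psi k. ray_mean n h \<zeta> (cyl \<psi>)) = 1 - ray_mean n h \<zeta> (short k)"
proof -
  have "ray_mean n h \<zeta> W = ray_mean n h \<zeta> (short k) + ray_mean n h \<zeta> (\<Union>\<psi>\<in>Psi k. cyl \<psi>)"
    unfolding W_eq[of k]
    by (rule ray_mean_Un[OF assms(2)]) (auto simp: short_def cyl_def Psi_def prefix_def)
  also have "ray_mean n h \<zeta> (\<Union>\<psi>\<in>Psi k. cyl \<psi>) = (\<Sum>\<psi>\<in>Psi k. ray_mean n h \<zeta> (cyl \<psi>))"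
    by (rule ray_mean_UN[OF assms(2) finite_Psi _ disjoint_cyl]) (auto simp: cyl_def)
  finally show ?thesis using ray_mean_W[OF assms] by simp
qed

text \<open>Almost equivariance replaces the mass of the cylinder at the translated point by the
  mass at \<zeta> of its translate D. Off the short words, D is the union of the cylinders not
  indexed by \<open>S_rel\<close>, so the remaining error is the mass of the short words outside
  D.\<close>

lemma ray_mean_relation:
  assumes rel: "grp_relation k g \<psi>"
  shows "\<exists>K. \<forall>n>0. \<forall>h. \<forall>\<zeta>\<in>sphere 0 1.
    \<bar>ray_mean n h (act (matrix_inv (ev g)) \<zeta>) (cyl \<psi>) - (1 - (\<Sum>\<psi>'\<in>S_rel k g \<psi>. ray_mean n h \<zeta> (cyl \<psi>')))\<bar>
      \<le> K / n + ray_mean n h \<zeta> (short k)"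
proof -
  define D where "D = {u \<in> W. prefix \<psi> (reduce (inv_word g @ u))}"
  define T where "T = Psi k - S_rel k g \<psi>"
  obtain K where K: "\<And>n h \<zeta> D. 0 < n \<Longrightarrow> \<zeta> \<in> sphere 0 1 \<Longrightarrow> D \<subseteq> W \<Longrightarrow>
    \<bar>ray_mean n h (act (ev g) \<zeta>) D - ray_mean n h \<zeta> {w \<in> W. reduce (g @ w) \<in> D}\<bar> \<le> K / n"
    using ray_mean_almost_equivariant[of g] by blast
  have pre: "{w \<in> W. reduce (g @ w) \<in> D} = cyl \<psi>"
    unfolding D_def cyl_def by (auto simp: reduce_append_right reduce_cancel' reduce_reduced)
  have long: "u \<in> D \<longleftrightarrow> take k u \<notin> S_rel k g \<psi>" if "reduced u" "k \<le> length u" for u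
    using prefix_reduce_iff_notin_S_rel[OF rel that] that by (simp add: D_def)
  have D_eq: "D = (D \<inter> short k) \<union> (\<Union>\<psi>'\<in>T. cyl \<psi>')"
  proof (intro equalityI subsetI)
    fix u assume u: "u \<in> D"
    then have r: "reduced u" by (simp add: D_def)
    show "u \<in> (D \<inter> short k) \<union> (\<Union>\<psi>'\<in>T. cyl \<psi>')"
    proof (cases "length u < k")
      case True
      then show ?thesis using u r by (simp add: short_def)
    next
      case False
      then have "take k u \<in> T" "u \<in> cyl (take k u)"
        using long[OF r] u take_in_Psi[OF r, of k] cyl_iff[of "take k u" k u] r
        by (auto simp: T_def)
      then show ?thesis by blast
    qed
  next
    fix u assume "u \<in> (D \<inter> short k) \<union> (\<Union>\<psi>'\<in>T. cyl \<psi>')"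
    then show "u \<in> D"
      using long[of u] cyl_iff[of _ k u] by (auto simp: T_def)
  qed
  have "\<bar>ray_mean n h (act (matrix_inv (ev g)) \<zeta>) (cyl \<psi>) - (1 - (\<Sum>\<psi>'\<in>S_rel k g \<psi>. ray_mean n h \<zeta> (cyl \<psi>')))\<bar>
      \<le> K / n + ray_mean n h \<zeta> (short k)" if n: "0 < n" and \<zeta>: "\<zeta> \<in> sphere 0 1" for n h \<zeta>
  proof -
    let ?\<zeta>' = "act (matrix_inv (ev g)) \<zeta>"
    have L: "lorentz (matrix_inv (ev g))" by (rule lorentz_inv[OF lorentz_ev])
    have "act (ev g) ?\<zeta>' = \<zeta>"
      using act_inv_act[OF L, of \<zeta>] \<zeta> by (simp add: matrix_inv_matrix_inv[OF lorentz_ev])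
    then have 1: "\<bar>ray_mean n h \<zeta> D - ray_mean n h ?\<zeta>' (cyl \<psi>)\<bar> \<le> K / n"
      using K[OF n act_in_sphere[OF L \<zeta>], of D h] unfolding pre by (auto simp: D_def)
    have "ray_mean n h \<zeta> D = ray_mean n h \<zeta> (D \<inter> short k) + ray_mean n h \<zeta> (\<Union>\<psi>'\<in>T. cyl \<psi>')"
      by (subst D_eq, rule ray_mean_Un[OF \<zeta>]) (auto simp: short_def cyl_def T_def Psi_def prefix_def)
    also have "ray_mean n h \<zeta> (\<Union>\<psi>'\<in>T. cyl \<psi>') = (\<Sum>\<psi>'\<in>T. ray_mean n h \<zeta> (cyl \<psi>'))"
      using finite_Psi disjoint_cyl[of k]
      by (intro ray_mean_UN[OF \<zeta>]) (auto simp: cyl_def T_def disjoint_family_on_def)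
    finally have 2: "ray_mean n h \<zeta> D = ray_mean n h \<zeta> (D \<inter> short k) + (\<Sum>\<psi>'\<in>T. ray_mean n h \<zeta> (cyl \<psi>'))" .
    have "(\<Sum>\<psi>'\<in>Psi k. ray_mean n h \<zeta> (cyl \<psi>'))
        = (\<Sum>\<psi>'\<in>T. ray_mean n h \<zeta> (cyl \<psi>')) + (\<Sum>\<psi>'\<in>S_rel k g \<psi>. ray_mean n h \<zeta> (cyl \<psi>'))"
      unfolding T_def by (rule sum.subset_diff[OF S_rel_subset finite_Psi])
    then have 3: "1 - (\<Sum>\<psi>'\<in>S_rel k g \<psi>. ray_mean n h \<zeta> (cyl \<psi>')) = (\<Sum>\<psi>'\<in>T. ray_mean n h \<zeta> (cyl \<psi>')) + ray_mean n h \<zeta> (short k)"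
      using sum_ray_mean_cyl[OF n \<zeta>, of h k] by linarith
    have "ray_mean n h \<zeta> ((D \<inter> short k) \<union> (short k - D)) = ray_mean n h \<zeta> (D \<inter> short k) + ray_mean n h \<zeta> (short k - D)"
      by (rule ray_mean_Un[OF \<zeta>]) (auto simp: short_def)
    moreover have "(D \<inter> short k) \<union> (short k - D) = short k" by blast
    ultimately have "ray_mean n h \<zeta> (D \<inter> short k) \<le> ray_mean n h \<zeta> (short k)"
      using ray_mean_nonneg[OF n, of h \<zeta> "short k - D"] by simp
    then show ?thesis
      using 1 2 3 ray_mean_nonneg[OF n, of h \<zeta> "D \<inter> short k"] by linarith
  qed
  then show ?thesis by blast
qed

section \<open>Pushing mass off the short words\<close>

lemma orbit_prob_right_translate:
  assumes "w \<in> W"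
  shows "orbit_prob h X {w} = orbit_prob [] X {reduce (w @ h)}"
proof -
  have orbit_weight: "orbit_weight h X v = orbit_weight [] X (reduce (v @ h))" for v
    by (simp add: orbit_weight_def ev_reduce)
  have m: "measure (orbit_measure h X) A = measure (orbit_measure [] X) B"
    if "A \<subseteq> W" "B \<subseteq> W" "\<And>v. v \<in> W \<Longrightarrow> v \<in> A \<longleftrightarrow> reduce (v @ h) \<in> B" for A B
  proof -
    have "emeasure (orbit_measure h X) A
        = (\<integral>\<^sup>+v. ennreal (orbit_weight [] X (reduce (v @ h))) * indicator B (reduce (v @ h)) \<partial>count_space W)"
      unfolding emeasure_orbit_measure[OF that(1)] orbit_weight
      by (rule nn_integral_cong) (use that(3) in \<open>simp add: indicator_def\<close>)
    also have "\<dots> = emeasure (orbit_measure [] X) B"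
      unfolding emeasure_orbit_measure[OF that(2)]
      by (rule nn_integral_bij_count_space[OF bij_betw_right_mult, where f="\<lambda>v. ennreal (orbit_weight [] X v) * indicator B v"])
    finally show ?thesis by (simp add: measure_def)
  qed
  have inj: "v = w" if "v \<in> W" "reduce (v @ h) = reduce (w @ h)" for v
    using bij_betw_imp_inj_on[OF bij_betw_right_mult[of h]] that assms unfolding inj_on_def by blast
  have "measure (orbit_measure h X) {w} = measure (orbit_measure [] X) {reduce (w @ h)}"
    by (rule m) (use assms inj in auto)
  moreover have "measure (orbit_measure h X) W = measure (orbit_measure [] X) W" by (rule m) auto
  ultimately show ?thesis by (simp add: orbit_prob_def)
qed

lemma ray_mean_right_translate: "w \<in> W \<Longrightarrow> ray_mean n h \<zeta> {w} = ray_mean n [] \<zeta> {reduce (w @ h)}"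
  by (simp add: ray_mean_def orbit_prob_right_translate[of w h])

text \<open>The masses of a fixed word under the right translates by the distinct elements \<open>\<xi>\<^sup>j\<close> add up to at
  most one, so they tend to zero; this pushes the asymptotically invariant means off the finite
  set of short words.\<close>
lemma ray_mean_short_tendsto_0:
  assumes "finite_measure M" and sets: "sets M = sets S_inf" and n: "0 < n"
  shows "(\<lambda>j. \<integral>\<zeta>. ray_mean n (replicate j Xi) \<zeta> (short k) \<partial>M) \<longlonglongrightarrow> 0"
proof -
  interpret finite_measure M by fact
  have space: "space M = sphere 0 1" using sets_eq_imp_space_eq[OF sets] by (simp add: space_S_inf)
  have meas: "(\<lambda>\<zeta>. ray_mean n h \<zeta> C) \<in> borel_measurable M" for h C
    using borel_measurable_ray_mean[of n h C] sets
    by (simp cong: measurable_cong_sets add: S_inf_def measurable_restrict_space1)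
  have int: "integrable M (\<lambda>\<zeta>. ray_mean n h \<zeta> C)" if "C \<subseteq> W" for h C
    by (rule integrable_const_bound[where B=1])
      (use ray_mean_nonneg[OF n] ray_mean_le_1[OF n _ that] meas space in \<open>auto intro!: AE_I2\<close>)
  have one: "(\<lambda>j. \<integral>\<zeta>. ray_mean n (replicate j Xi) \<zeta> {w} \<partial>M) \<longlonglongrightarrow> 0" if w: "w \<in> W" for w
  proof -
    define v where "v j = reduce (w @ replicate j Xi)" for j
    have red: "reduced (replicate j Xi)" for j
      by (induction j) (auto simp: reduced_Cons hd_replicate)
    have "replicate j Xi = reduce (inv_word w @ v j)" for j
      unfolding v_def reduce_append_right reduce_cancel' by (simp add: reduce_reduced[OF red])
    \<comment> \<open>The power of \<open>Xi\<close> is recovered from \<open>v j\<close> by left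
      cancellation, and its length is \<open>j\<close>.\<close>
    then have inj: "v i = v j \<Longrightarrow> i = j" for i j by (metis length_replicate)
    have vW: "v j \<in> W" for j by (simp add: v_def)
    have "summable (\<lambda>j. \<integral>\<zeta>. ray_mean n [] \<zeta> {v j} \<partial>M)"
    proof (rule summableI_nonneg_bounded)
      show "0 \<le> (\<integral>\<zeta>. ray_mean n [] \<zeta> {v j} \<partial>M)" for j by (intro Bochner_Integration.integral_nonneg ray_mean_nonneg n)
      show "(\<Sum>j<m. \<integral>\<zeta>. ray_mean n [] \<zeta> {v j} \<partial>M) \<le> measure M (space M)" for m
      proof -
        have "(\<Sum>j<m. \<integral>\<zeta>. ray_mean n [] \<zeta> {v j} \<partial>M) = (\<integral>\<zeta>. (\<Sum>j<m. ray_mean n [] \<zeta> {v j}) \<partial>M)"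
          by (rule Bochner_Integration.integral_sum[symmetric]) (use int vW in auto)
        also have "\<dots> \<le> (\<integral>\<zeta>. 1 \<partial>M)"
        proof (rule integral_mono)
          fix \<zeta> assume "\<zeta> \<in> space M"
          then have \<zeta>: "\<zeta> \<in> sphere 0 1" by (simp add: space)
          have "(\<Sum>j<m. ray_mean n [] \<zeta> {v j}) = ray_mean n [] \<zeta> (\<Union>j<m. {v j})"
            by (rule ray_mean_UN[OF \<zeta>, symmetric]) (use inj vW in \<open>auto simp: disjoint_family_on_def\<close>)
          also have "\<dots> \<le> 1" by (rule ray_mean_le_1[OF n \<zeta>]) (use vW in auto)
          finally show "(\<Sum>j<m. ray_mean n [] \<zeta> {v j}) \<le> 1" .
        qed (use int vW in \<open>auto intro!: Bochner_Integration.integrable_sum\<close>)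
        also have "\<dots> = measure M (space M)" by simp
        finally show ?thesis .
      qed
    qed
    then have "(\<lambda>j. \<integral>\<zeta>. ray_mean n [] \<zeta> {v j} \<partial>M) \<longlonglongrightarrow> 0" by (rule summable_LIMSEQ_zero)
    then show ?thesis unfolding v_def ray_mean_right_translate[OF w] .
  qed
  have "(\<integral>\<zeta>. ray_mean n h \<zeta> (short k) \<partial>M) = (\<Sum>w\<in>short k. \<integral>\<zeta>. ray_mean n h \<zeta> {w} \<partial>M)" for h
  proof -
    have "(\<integral>\<zeta>. ray_mean n h \<zeta> (short k) \<partial>M) = (\<integral>\<zeta>. (\<Sum>w\<in>short k. ray_mean n h \<zeta> {w}) \<partial>M)"
    proof (rule Bochner_Integration.integral_cong[OF refl])
      fix \<zeta> assume "\<zeta> \<in> space M"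
      then have \<zeta>: "\<zeta> \<in> sphere 0 1" by (simp add: space)
      have "ray_mean n h \<zeta> (\<Union>w\<in>short k. {w}) = (\<Sum>w\<in>short k. ray_mean n h \<zeta> {w})"
        by (rule ray_mean_UN[OF \<zeta> finite_short]) (auto simp: disjoint_family_on_def short_def)
      then show "ray_mean n h \<zeta> (short k) = (\<Sum>w\<in>short k. ray_mean n h \<zeta> {w})" by simp
    qed
    also have "\<dots> = (\<Sum>w\<in>short k. \<integral>\<zeta>. ray_mean n h \<zeta> {w} \<partial>M)"
      by (rule Bochner_Integration.integral_sum) (use int in \<open>auto simp: short_def\<close>)
    finally show ?thesis .
  qed
  moreover have "(\<lambda>j. \<Sum>w\<in>short k. \<integral>\<zeta>. ray_mean n (replicate j Xi) \<zeta> {w} \<partial>M) \<longlonglongrightarrow> (\<Sum>w\<in>short k. 0)"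
    by (intro tendsto_sum one) (simp add: short_def)
  ultimately show ?thesis by simp
qed

end

theorem theorem3p4:
  fixes \<xi> \<eta> :: "real^4^4" and k :: nat and z0 :: "real^3"
  assumes "kleinian \<xi> \<eta>"
    and "free_on \<xi> \<eta>"
    and "geometrically_infinite \<xi> \<eta>"
    and "no_parabolics \<xi> \<eta>"
    and "k \<ge> 2"
    and "z0 \<in> H3"
  shows "\<exists>\<nu> :: letter list \<Rightarrow> (real^3) measure.
           (\<forall>\<psi>\<in>Psi k. sets (\<nu> \<psi>) = sets S_inf)
         \<and> (\<forall>E\<in>sets S_inf. emeasure (area_at z0) E = (\<Sum>\<psi>\<in>Psi k. emeasure (\<nu> \<psi>) E))
         \<and> (\<forall>g \<psi>. grp_relation k g \<psi> \<longrightarrow>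
              (\<integral>\<^sup>+ \<zeta>. lam2 (eval_word \<xi> \<eta> g) z0 \<zeta> \<partial>(\<nu> \<psi>))
                + (\<Sum>\<psi>'\<in>S_rel k g \<psi>. emeasure (\<nu> \<psi>') (space S_inf)) = 1)"
proof -
  interpret free_kleinian \<xi> \<eta> by unfold_locales (fact assms)+
  note z0 = assms(6)
  define M where "M = area_at z0"
  have sets_M: "sets M = sets S_inf" and space_M: "space M = sphere 0 1"
    by (simp_all add: M_def sets_area_at space_area_at)
  have em1: "emeasure M (space M) = 1"
    unfolding M_def space_area_at by (rule emeasure_area_at_sphere[OF z0])
  have fin: "finite_measure M" unfolding M_def by (rule finite_measure_area_at[OF z0])
  interpret finite_measure M by (rule fin)
  have mu1: "measure M (space M) = 1" using em1 by (simp add: measure_def)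
  have meas_M: "borel_measurable M = (borel_measurable S_inf :: (real^3 \<Rightarrow> real) set)"
    by (rule measurable_cong_sets[OF sets_M refl])
  have Qm: "(\<lambda>\<zeta>. ray_mean n h \<zeta> C) \<in> borel_measurable S_inf" for n h C
    unfolding S_inf_def by (rule measurable_restrict_space1[OF borel_measurable_ray_mean])
  \<comment> \<open>The averaging length is fixed first and the translate chosen afterwards; the
    equivariance error is uniform in the translate. \<open>Suc\<close> avoids length 0.\<close>
  have "\<exists>j. (\<integral>\<zeta>. ray_mean (real (Suc n)) (replicate j Xi) \<zeta> (short k) \<partial>M) < 1 / real (Suc n)" for n
  proof -
    have "(\<lambda>j. \<integral>\<zeta>. ray_mean (real (Suc n)) (replicate j Xi) \<zeta> (short k) \<partial>M) \<longlonglongrightarrow> 0"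
      by (rule ray_mean_short_tendsto_0[OF fin sets_M]) simp
    then have "eventually (\<lambda>j. (\<integral>\<zeta>. ray_mean (real (Suc n)) (replicate j Xi) \<zeta> (short k) \<partial>M) < 1 / real (Suc n)) sequentially"
      by (rule order_tendstoD) simp
    then show ?thesis using eventually_sequentially by auto
  qed
  then obtain J where J: "\<And>n. (\<integral>\<zeta>. ray_mean (real (Suc n)) (replicate (J n) Xi) \<zeta> (short k) \<partial>M) < 1 / real (Suc n)"
    by metis
  define q where "q n \<zeta> C = ray_mean (real (Suc n)) (replicate (J n) Xi) \<zeta> C" for n \<zeta> C
  define f where "f n \<psi> \<zeta> = q n \<zeta> (cyl \<psi>)" for n \<psi> \<zeta>
  have qm: "(\<lambda>\<zeta>. q n \<zeta> C) \<in> borel_measurable S_inf" for n C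
    unfolding q_def by (rule Qm)
  have q01: "0 \<le> q n \<zeta> C" "\<zeta> \<in> sphere 0 1 \<Longrightarrow> C \<subseteq> W \<Longrightarrow> q n \<zeta> C \<le> 1" for n \<zeta> C
    unfolding q_def by (rule ray_mean_nonneg, simp) (rule ray_mean_le_1, simp_all)
  have cylW: "cyl \<psi> \<subseteq> W" for \<psi> by (auto simp: cyl_def)
  have shortW: "short k \<subseteq> W" by (auto simp: short_def)
  have short0: "(\<integral>\<zeta>. q n \<zeta> (short k) \<partial>M) < 1 / real (Suc n)" for n
    unfolding q_def by (rule J)
  have qint: "integrable M (\<lambda>\<zeta>. q n \<zeta> C)" if "C \<subseteq> W" for n C
    by (rule integrable_const_bound[where B=1])
      (use q01 that qm meas_M space_M in \<open>auto intro!: AE_I2\<close>)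
  obtain F \<nu> where F: "F \<noteq> bot" "F \<le> sequentially"
    and sets_\<nu>: "\<And>\<psi>. sets (\<nu> \<psi>) = sets M"
    and \<nu>_le: "\<And>\<psi> E. E \<in> sets M \<Longrightarrow> emeasure (\<nu> \<psi>) E \<le> emeasure M E"
    and int_\<nu>: "\<And>\<psi> (h :: real^3 \<Rightarrow> real). integrable M h \<Longrightarrow> integrable (\<nu> \<psi>) h"
    and lim_\<nu>: "\<And>\<psi> h. integrable M h \<Longrightarrow> ((\<lambda>n. \<integral>\<zeta>. h \<zeta> * f n \<psi> \<zeta> \<partial>M) \<longlongrightarrow> (\<integral>\<zeta>. h \<zeta> \<partial>\<nu> \<psi>)) F"
  proof (rule weak_cluster_measures[OF fin, of f])
    show "f n \<psi> \<in> borel_measurable M" for n \<psi>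
      unfolding f_def meas_M by (rule qm)
    show "0 \<le> f n \<psi> \<zeta> \<and> f n \<psi> \<zeta> \<le> 1" if "\<zeta> \<in> space M" for n \<psi> \<zeta>
      using q01 that cylW unfolding f_def space_M by blast
  qed blast
  have fint: "integrable M (f n \<psi>)" for n \<psi>
    unfolding f_def by (rule qint[OF cylW])
  have fin_\<nu>: "finite_measure (\<nu> \<psi>)" for \<psi>
  proof (rule finite_measureI)
    have "emeasure (\<nu> \<psi>) (space M) \<le> 1" using \<nu>_le[of "space M" \<psi>] em1 by simp
    then show "emeasure (\<nu> \<psi>) (space (\<nu> \<psi>)) \<noteq> \<infinity>"
      unfolding sets_eq_imp_space_eq[OF sets_\<nu>] by (auto simp: top_unique)
  qed
  have em_\<nu>: "emeasure (\<nu> \<psi>) E = ennreal (measure (\<nu> \<psi>) E)" for \<psi> E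
    by (rule finite_measure.emeasure_eq_measure[OF fin_\<nu>])
  have lim_E: "((\<lambda>n. \<integral>\<zeta>. indicator E \<zeta> * f n \<psi> \<zeta> \<partial>M) \<longlongrightarrow> measure (\<nu> \<psi>) E) F" if "E \<in> sets M" for E \<psi>
    using lim_\<nu>[of "indicator E" \<psi>] that sets_\<nu>[of \<psi>] by (simp add: less_top[symmetric])
  have inv_n: "((\<lambda>n. c / real (Suc n)) \<longlongrightarrow> 0) F" for c
    by (rule tendsto_mono[OF F(2)]) (rule LIMSEQ_Suc[OF lim_const_over_n])
  have part1: "emeasure (area_at z0) E = (\<Sum>\<psi>\<in>Psi k. emeasure (\<nu> \<psi>) E)" if "E \<in> sets S_inf" for E
  proof -
    have E: "E \<in> sets M" using that by (simp add: sets_M)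
    have "((\<lambda>n. \<Sum>\<psi>\<in>Psi k. \<integral>\<zeta>. indicator E \<zeta> * f n \<psi> \<zeta> \<partial>M) \<longlongrightarrow> (\<Sum>\<psi>\<in>Psi k. measure (\<nu> \<psi>) E)) F"
      by (intro tendsto_sum lim_E E)
    moreover have "((\<lambda>n. \<Sum>\<psi>\<in>Psi k. \<integral>\<zeta>. indicator E \<zeta> * f n \<psi> \<zeta> \<partial>M) \<longlongrightarrow> measure M E) F"
    proof -
      have iE: "integrable M (\<lambda>\<zeta>. indicator E \<zeta> * q n \<zeta> C)" if "C \<subseteq> W" for n C
        using integrable_mult_indicator[OF E qint[OF that]] by simp
      \<comment> \<open>The cylinder densities add up to 1 minus the mass of the short words, whose
        integral is below the stated bound.\<close>
      have bd: "norm ((\<Sum>\<psi>\<in>Psi k. \<integral>\<zeta>. indicator E \<zeta> * f n \<psi> \<zeta> \<partial>M) - measure M E) \<le> 1 / real (Suc n)" for n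
      proof -
        have "(\<Sum>\<psi>\<in>Psi k. \<integral>\<zeta>. indicator E \<zeta> * f n \<psi> \<zeta> \<partial>M) = (\<integral>\<zeta>. (\<Sum>\<psi>\<in>Psi k. indicator E \<zeta> * f n \<psi> \<zeta>) \<partial>M)"
          unfolding f_def by (rule Bochner_Integration.integral_sum[symmetric]) (rule iE[OF cylW])
        also have "\<dots> = (\<integral>\<zeta>. indicator E \<zeta> - indicator E \<zeta> * q n \<zeta> (short k) \<partial>M)"
        proof (rule Bochner_Integration.integral_cong[OF refl])
          fix \<zeta> assume "\<zeta> \<in> space M"
          then have "(\<Sum>\<psi>\<in>Psi k. f n \<psi> \<zeta>) = 1 - q n \<zeta> (short k)"
            unfolding f_def q_def space_M by (intro sum_ray_mean_cyl) simp_all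
          then show "(\<Sum>\<psi>\<in>Psi k. indicator E \<zeta> * f n \<psi> \<zeta>) = indicator E \<zeta> - indicator E \<zeta> * q n \<zeta> (short k)"
            unfolding sum_distrib_left[symmetric] by (simp add: right_diff_distrib)
        qed
        also have "\<dots> = measure M E - (\<integral>\<zeta>. indicator E \<zeta> * q n \<zeta> (short k) \<partial>M)"
          using E by (subst Bochner_Integration.integral_diff[OF _ iE[OF shortW]]) (auto simp: less_top[symmetric])
        finally have "(\<Sum>\<psi>\<in>Psi k. \<integral>\<zeta>. indicator E \<zeta> * f n \<psi> \<zeta> \<partial>M) - measure M E = - (\<integral>\<zeta>. indicator E \<zeta> * q n \<zeta> (short k) \<partial>M)"
          by simp
        moreover have "0 \<le> (\<integral>\<zeta>. indicator E \<zeta> * q n \<zeta> (short k) \<partial>M)"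
          by (intro Bochner_Integration.integral_nonneg mult_nonneg_nonneg q01) simp
        moreover have "(\<integral>\<zeta>. indicator E \<zeta> * q n \<zeta> (short k) \<partial>M) \<le> (\<integral>\<zeta>. q n \<zeta> (short k) \<partial>M)"
          by (rule integral_mono[OF iE[OF shortW] qint[OF shortW]]) (use q01(1) in \<open>simp add: indicator_def\<close>)
        ultimately show ?thesis using short0[of n] by simp
      qed
      have "((\<lambda>n. (\<Sum>\<psi>\<in>Psi k. \<integral>\<zeta>. indicator E \<zeta> * f n \<psi> \<zeta> \<partial>M) - measure M E) \<longlongrightarrow> 0) F"
        by (rule Lim_null_comparison[OF always_eventually inv_n]) (use bd in blast)
      then show ?thesis by (simp only: LIM_zero_iff)
    qed
    ultimately have "(\<Sum>\<psi>\<in>Psi k. measure (\<nu> \<psi>) E) = measure M E" by (rule tendsto_unique[OF F(1)])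
    then show ?thesis
      unfolding M_def[symmetric] em_\<nu> emeasure_eq_measure by (subst sum_ennreal) auto
  qed
  have part2: "(\<integral>\<^sup>+ \<zeta>. lam2 (ev g) z0 \<zeta> \<partial>(\<nu> \<psi>)) + (\<Sum>\<psi>'\<in>S_rel k g \<psi>. emeasure (\<nu> \<psi>') (space S_inf)) = 1"
    if rel: "grp_relation k g \<psi>" for g \<psi>
  proof -
    let ?L = "ev g"
    \<comment> \<open>Weak convergence is tested on real functions. Since \<open>lam2\<close> has
      integral 1, it is finite almost everywhere and agrees there with \<open>l\<close>.\<close>
    define l where "l \<zeta> = enn2real (lam2 ?L z0 \<zeta>)" for \<zeta>
    have lm: "lam2 ?L z0 \<in> borel_measurable M" unfolding lam2_def M_def by simp
    have nn1: "(\<integral>\<^sup>+\<zeta>. lam2 ?L z0 \<zeta> \<partial>M) = 1"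
      using nn_integral_lam2[OF z0 lorentz_ev[of g], of "\<lambda>_. 1"] em1 by (simp add: M_def)
    have "AE \<zeta> in M. lam2 ?L z0 \<zeta> \<noteq> \<infinity>"
      by (rule nn_integral_PInf_AE[OF lm]) (simp add: nn1)
    then have l_eq: "AE \<zeta> in M. lam2 ?L z0 \<zeta> = ennreal (l \<zeta>)"
      by (rule eventually_mono) (simp add: l_def less_top)
    have l_int: "integrable M l"
    proof (rule integrableI_nonneg)
      show "l \<in> borel_measurable M" unfolding l_def using lm by measurable
      have "(\<integral>\<^sup>+\<zeta>. ennreal (l \<zeta>) \<partial>M) = (\<integral>\<^sup>+\<zeta>. lam2 ?L z0 \<zeta> \<partial>M)"
        by (rule nn_integral_cong_AE) (use l_eq in \<open>auto elim: eventually_mono\<close>)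
      then show "(\<integral>\<^sup>+\<zeta>. ennreal (l \<zeta>) \<partial>M) < \<infinity>" by (simp add: nn1)
    qed (simp add: l_def)
    obtain K where K: "\<And>n h \<zeta>. 0 < n \<Longrightarrow> \<zeta> \<in> sphere 0 1 \<Longrightarrow>
      \<bar>ray_mean n h (act (matrix_inv ?L) \<zeta>) (cyl \<psi>) - (1 - (\<Sum>\<psi>'\<in>S_rel k g \<psi>. ray_mean n h \<zeta> (cyl \<psi>')))\<bar>
        \<le> K / n + ray_mean n h \<zeta> (short k)"
      using ray_mean_relation[OF rel] by blast
    have mact: "act (matrix_inv ?L) \<in> M \<rightarrow>\<^sub>M S_inf"
      unfolding M_def by (rule measurable_act_area_at[OF lorentz_inv[OF lorentz_ev]])
    have act_S: "act (matrix_inv ?L) \<zeta> \<in> sphere 0 1" if "\<zeta> \<in> space M" for \<zeta>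
      using act_in_sphere[OF lorentz_inv[OF lorentz_ev]] that by (simp add: space_M)
    have fact_int: "integrable M (\<lambda>\<zeta>. f n \<psi> (act (matrix_inv ?L) \<zeta>))" for n
    proof (rule integrable_const_bound[where B=1])
      show "(\<lambda>\<zeta>. f n \<psi> (act (matrix_inv ?L) \<zeta>)) \<in> borel_measurable M"
        unfolding f_def by (rule measurable_compose[OF mact qm])
      show "AE \<zeta> in M. norm (f n \<psi> (act (matrix_inv ?L) \<zeta>)) \<le> 1"
        using q01 cylW act_S unfolding f_def by (intro AE_I2) auto
    qed
    \<comment> \<open>Brings in the values at the translated point, where
      \<open>ray_mean_relation\<close> applies.\<close>
    have change: "(\<integral>\<zeta>. l \<zeta> * f n \<psi> \<zeta> \<partial>M) = (\<integral>\<zeta>. f n \<psi> (act (matrix_inv ?L) \<zeta>) \<partial>M)" for n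
    proof -
      have fm: "(\<lambda>\<zeta>. f n \<psi> \<zeta>) \<in> borel_measurable S_inf" unfolding f_def by (rule qm)
      have f0: "0 \<le> f n \<psi> \<zeta>" for \<zeta> unfolding f_def by (rule q01)
      have "(\<integral>\<zeta>. l \<zeta> * f n \<psi> \<zeta> \<partial>M) = enn2real (\<integral>\<^sup>+\<zeta>. ennreal (l \<zeta> * f n \<psi> \<zeta>) \<partial>M)"
        by (rule integral_eq_nn_integral[OF borel_measurable_times[OF borel_measurable_integrable[OF l_int]
              borel_measurable_integrable[OF fint]]]) (simp add: l_def f0)
      also have "(\<integral>\<^sup>+\<zeta>. ennreal (l \<zeta> * f n \<psi> \<zeta>) \<partial>M) = (\<integral>\<^sup>+\<zeta>. lam2 ?L z0 \<zeta> * ennreal (f n \<psi> \<zeta>) \<partial>M)"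
        by (rule nn_integral_cong_AE, rule eventually_mono[OF l_eq]) (simp add: ennreal_mult f0 l_def)
      also have "\<dots> = (\<integral>\<^sup>+\<zeta>. ennreal (f n \<psi> (act (matrix_inv ?L) \<zeta>)) \<partial>M)"
        unfolding M_def by (rule nn_integral_lam2[OF z0 lorentz_ev]) (use fm in measurable)
      also have "enn2real \<dots> = (\<integral>\<zeta>. f n \<psi> (act (matrix_inv ?L) \<zeta>) \<partial>M)"
        by (rule integral_eq_nn_integral[symmetric]) (simp_all add: borel_measurable_integrable[OF fact_int] f0)
      finally show ?thesis .
    qed
    let ?s = "\<lambda>n. 1 - (\<Sum>\<psi>'\<in>S_rel k g \<psi>. \<integral>\<zeta>. f n \<psi>' \<zeta> \<partial>M)"
    \<comment> \<open>K accounts for the failure of equivariance, 1 for the short words.\<close>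
    have bd: "norm ((\<integral>\<zeta>. l \<zeta> * f n \<psi> \<zeta> \<partial>M) - ?s n) \<le> (K + 1) / real (Suc n)" for n
    proof -
      let ?d = "\<lambda>\<zeta>. f n \<psi> (act (matrix_inv ?L) \<zeta>) - (1 - (\<Sum>\<psi>'\<in>S_rel k g \<psi>. f n \<psi>' \<zeta>))"
      have sint: "integrable M (\<lambda>\<zeta>. \<Sum>\<psi>'\<in>S_rel k g \<psi>. f n \<psi>' \<zeta>)"
        by (rule Bochner_Integration.integrable_sum) (rule fint)
      have dint: "integrable M ?d"
        by (intro Bochner_Integration.integrable_diff fact_int sint integrable_const)
      have "(\<integral>\<zeta>. ?d \<zeta> \<partial>M) = (\<integral>\<zeta>. f n \<psi> (act (matrix_inv ?L) \<zeta>) \<partial>M) - ?s n"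
        using fact_int sint fint mu1
        by (simp add: Bochner_Integration.integral_diff Bochner_Integration.integral_sum)
      then have "norm ((\<integral>\<zeta>. l \<zeta> * f n \<psi> \<zeta> \<partial>M) - ?s n) = \<bar>\<integral>\<zeta>. ?d \<zeta> \<partial>M\<bar>"
        unfolding change by simp
      also have "\<dots> \<le> (\<integral>\<zeta>. \<bar>?d \<zeta>\<bar> \<partial>M)" by (rule integral_abs_bound)
      also have "\<dots> \<le> (\<integral>\<zeta>. K / real (Suc n) + q n \<zeta> (short k) \<partial>M)"
      proof (rule integral_mono)
        show "integrable M (\<lambda>\<zeta>. \<bar>?d \<zeta>\<bar>)" using dint by (rule integrable_abs)
        show "integrable M (\<lambda>\<zeta>. K / real (Suc n) + q n \<zeta> (short k))"
          by (intro Bochner_Integration.integrable_add integrable_const qint[OF shortW])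
        show "\<bar>?d \<zeta>\<bar> \<le> K / real (Suc n) + q n \<zeta> (short k)" if "\<zeta> \<in> space M" for \<zeta>
          unfolding f_def q_def by (rule K) (use that space_M in simp_all)
      qed
      also have "\<dots> = K / real (Suc n) + (\<integral>\<zeta>. q n \<zeta> (short k) \<partial>M)"
        using qint[OF shortW] mu1 by simp
      also have "\<dots> \<le> (K + 1) / real (Suc n)"
        using short0[of n] by (simp add: add_divide_distrib)
      finally show ?thesis .
    qed
    have "((\<lambda>n. (\<integral>\<zeta>. l \<zeta> * f n \<psi> \<zeta> \<partial>M) - ?s n) \<longlongrightarrow> 0) F"
      by (rule Lim_null_comparison[OF always_eventually inv_n]) (use bd in blast)
    moreover have "((\<lambda>n. (\<integral>\<zeta>. l \<zeta> * f n \<psi> \<zeta> \<partial>M) - ?s n)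
        \<longlongrightarrow> (\<integral>\<zeta>. l \<zeta> \<partial>\<nu> \<psi>) - (1 - (\<Sum>\<psi>'\<in>S_rel k g \<psi>. measure (\<nu> \<psi>') (space M)))) F"
    proof -
      have "((\<lambda>n. \<integral>\<zeta>. f n \<psi>' \<zeta> \<partial>M) \<longlongrightarrow> measure (\<nu> \<psi>') (space M)) F" for \<psi>'
      proof -
        have "(\<integral>\<zeta>. indicator (space M) \<zeta> * f n \<psi>' \<zeta> \<partial>M) = (\<integral>\<zeta>. f n \<psi>' \<zeta> \<partial>M)" for n
          by (rule Bochner_Integration.integral_cong) simp_all
        then show ?thesis using lim_E[of "space M" \<psi>'] by simp
      qed
      then show ?thesis by (intro tendsto_diff lim_\<nu> l_int tendsto_const tendsto_sum)
    qed
    ultimately have "(\<integral>\<zeta>. l \<zeta> \<partial>\<nu> \<psi>) - (1 - (\<Sum>\<psi>'\<in>S_rel k g \<psi>. measure (\<nu> \<psi>') (space M))) = 0"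
      using tendsto_unique[OF F(1)] by blast
    then have total: "(\<integral>\<zeta>. l \<zeta> \<partial>\<nu> \<psi>) + (\<Sum>\<psi>'\<in>S_rel k g \<psi>. measure (\<nu> \<psi>') (space M)) = 1" by simp
    \<comment> \<open>Domination by M makes M-null sets null for the limit measure, so the two
      versions of the Jacobian also agree there.\<close>
    have "AE \<zeta> in \<nu> \<psi>. lam2 ?L z0 \<zeta> = ennreal (l \<zeta>)"
    proof -
      obtain N where N: "N \<in> null_sets M" "{\<zeta> \<in> space M. lam2 ?L z0 \<zeta> \<noteq> ennreal (l \<zeta>)} \<subseteq> N"
        using l_eq unfolding eventually_ae_filter by blast
      have "N \<in> null_sets (\<nu> \<psi>)"
        using N(1) \<nu>_le[of N \<psi>] sets_\<nu>[of \<psi>] by (auto simp: null_sets_def)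
      then show ?thesis
        using N(2) sets_eq_imp_space_eq[OF sets_\<nu>[of \<psi>]] by (intro AE_I') auto
    qed
    then have "(\<integral>\<^sup>+ \<zeta>. lam2 ?L z0 \<zeta> \<partial>(\<nu> \<psi>)) = (\<integral>\<^sup>+ \<zeta>. ennreal (l \<zeta>) \<partial>(\<nu> \<psi>))"
      by (rule nn_integral_cong_AE)
    also have "\<dots> = ennreal (\<integral>\<zeta>. l \<zeta> \<partial>\<nu> \<psi>)"
      by (rule nn_integral_eq_integral[OF int_\<nu>[OF l_int]]) (simp add: l_def)
    finally have "(\<integral>\<^sup>+ \<zeta>. lam2 ?L z0 \<zeta> \<partial>(\<nu> \<psi>)) + (\<Sum>\<psi>'\<in>S_rel k g \<psi>. emeasure (\<nu> \<psi>') (space S_inf))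
        = ennreal (\<integral>\<zeta>. l \<zeta> \<partial>\<nu> \<psi>) + ennreal (\<Sum>\<psi>'\<in>S_rel k g \<psi>. measure (\<nu> \<psi>') (space M))"
      unfolding em_\<nu> space_S_inf space_M by (simp add: sum_ennreal)
    also have "\<dots> = ennreal ((\<integral>\<zeta>. l \<zeta> \<partial>\<nu> \<psi>) + (\<Sum>\<psi>'\<in>S_rel k g \<psi>. measure (\<nu> \<psi>') (space M)))"
      by (rule ennreal_plus[symmetric]) (auto simp: l_def intro!: Bochner_Integration.integral_nonneg sum_nonneg)
    finally show ?thesis unfolding total by simp
  qed
  show ?thesis
    by (rule exI[of _ \<nu>]) (use part1 part2 sets_\<nu> sets_M in blast)
qed

end
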